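(* Let $\omega$ be a non-quasianalytic weight function. Then the multiplication operator $M\colon\mathcal{O}_{C,\omega}(\mathbb{R}^N)\times\mathcal{S}_\omega(\mathbb{R}^N)\to\mathcal{S}_\omega(\mathbb{R}^N)$, $(f,g)\mapsto fg$, is separately continuous and hence a hypocontinuous bilinear mapping.
   Context: Weights. A non-quasianalytic weight function is a continuous increasing function $\omega:[0,\infty)\to[0,\infty)$ such that: ($\alpha$) there is $K\ge 1$ with $\omega(2t)\le K(1+\omega(t))$ for all $t\ge 0$; ($\beta$) $\int_1^\infty \frac{\omega(t)}{1+t^2}\,dt<\infty$; ($\gamma$) there are $a\in\mathbb{R}$, $b>0$ with $\omega(t)\ge a+b\log(1+t)$ for all $t\ge 0$; ($\delta$) $\varphi_\omega(t)=\omega(e^t)$ is convex. It is assumed (normalization) that $\omega$ vanishes on $[0,1]$. For $x\in\mathbb{R}^N$, $\omega(x):=\omega(|x|)$. The Young conjugate is $\varphi^*_\omega(s):=\sup_{t\ge 0}\{st-\varphi_\omega(t)\}$, $s\ge 0$ (the value $+\infty$ is allowed, with $\exp(-\infty)=0$). Spaces. $\mathcal{S}_\omega(\mathbb{R}^N)$ is the set of all $f\in L^1(\mathbb{R}^N)$ such that $f,\hat f\in C^\infty(\mathbb{R}^N)$ and $\|\exp(\lambda\omega)\partial^\alpha f\|_\infty<\infty$, $\|\exp(\lambda\omega)\partial^\alpha\hat f\|_\infty<\infty$ for all $\lambda>0$, $\alpha\in\mathbb{N}_0^N$; it is a Fréchet space with the norms $q_{m,n}(f):=\sup_{\alpha}\|\exp(n\omega)\partial^\alpha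 f\|_\infty\exp\left(-m\varphi^*_\omega\left(\frac{|\alpha|}{m}\right)\right)$, $m,n\in\mathbb{N}$. For $m,n\in\mathbb{N}$ let $\mathcal{O}^m_{n,\omega}(\mathbb{R}^N)$ be the space of all $f\in C^\infty(\mathbb{R}^N)$ with $r_{m,n}(f):=\sup_{\alpha\in\mathbb{N}_0^N}\sup_{x\in\mathbb{R}^N}|\partial^\alpha f(x)|\exp\left(-n\omega(x)-m\varphi^*_\omega\left(\frac{|\alpha|}{m}\right)\right)<\infty$, with norm $r_{m,n}$. Set $\mathcal{O}_{C,\omega}(\mathbb{R}^N):=\bigcup_{n}\bigcap_{m}\mathcal{O}^m_{n,\omega}(\mathbb{R}^N)$ with the topology of the locally convex inductive limit over $n$ of the projective limits $\mathrm{proj}_m\,\mathcal{O}^m_{n,\omega}(\mathbb{R}^N)$. Hypocontinuity. A bilinear map $b\colon E\times F\to G$ between topological vector spaces is hypocontinuous if for every bounded $A\subset E$ the set $\{b(x,\cdot):x\in A\}$ is equicontinuous in $\mathcal{L}(F,G)$, and for every bounded $B\subset F$ the set $\{b(\cdot,y):y\in B\}$ is equicontinuous in $\mathcal{L}(E,G)$. *)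

theory Defs
  imports "HOL-Analysis.Analysis"
begin

section \<open>Weight functions\<close>

definition nonquasianalytic_weight :: "(real \<Rightarrow> real) \<Rightarrow> bool" where
  "nonquasianalytic_weight \<omega> \<longleftrightarrow>
     continuous_on {0..} \<omega> \<and> mono_on {0..} \<omega> \<and> (\<forall>t\<ge>0. \<omega> t \<ge> 0) \<and>
     (\<exists>K\<ge>1. \<forall>t\<ge>0. \<omega> (2 * t) \<le> K * (1 + \<omega> t)) \<and>
     set_integrable lborel {1..} (\<lambda>t. \<omega> t / (1 + t\<^sup>2)) \<and>
     (\<exists>a b. b > 0 \<and> (\<forall>t\<ge>0. \<omega> t \<ge> a + b * ln (1 + t))) \<and>
     convex_on UNIV (\<lambda>t. \<omega> (exp t)) \<and>
     (\<forall>t\<in>{0..1}. \<omega> t = 0)"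

definition young_conj :: "(real \<Rightarrow> real) \<Rightarrow> real \<Rightarrow> ereal" where
  "young_conj \<omega> s = (SUP t\<in>{0..}. ereal (s * t - \<omega> (exp t)))"

definition exp_ereal :: "ereal \<Rightarrow> ennreal" where
  "exp_ereal x = (if x = -\<infinity> then 0 else if x = \<infinity> then \<infinity> else ennreal (exp (real_of_ereal x)))"

section \<open>Smooth functions and partial derivatives\<close>

definition partial_deriv :: "'n::finite \<Rightarrow> (real^'n \<Rightarrow> complex) \<Rightarrow> real^'n \<Rightarrow> complex" where
  "partial_deriv i f x = vector_derivative (\<lambda>t. f (x + t *\<^sub>R axis i 1)) (at 0)"

definition has_partial_deriv :: "'n::finite \<Rightarrow> (real^'n \<Rightarrow> complex) \<Rightarrow> bool" where
  "has_partial_deriv i f \<longleftrightarrow> (\<forall>x. (\<lambda>t. f (x + t *\<^sub>R axis i 1)) differentiable at 0)"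

primrec Ck :: "nat \<Rightarrow> (real^'n::finite \<Rightarrow> complex) \<Rightarrow> bool" where
  "Ck 0 f \<longleftrightarrow> continuous_on UNIV f"
| "Ck (Suc k) f \<longleftrightarrow> continuous_on UNIV f \<and>
     (\<forall>i. has_partial_deriv i f \<and> Ck k (partial_deriv i f))"

definition smooth :: "(real^'n::finite \<Rightarrow> complex) \<Rightarrow> bool" where
  "smooth f \<longleftrightarrow> (\<forall>k. Ck k f)"

text \<open>The index type carries no order, so the order in which the coordinate derivatives of
  \<open>\<partial>\<^sup>\<alpha>\<close> are taken is fixed by an arbitrary enumeration of it. By Schwarz's theorem
  this choice does not matter for smooth functions, the only ones \<open>mderiv\<close> is applied to.\<close>

definition coordinates :: "'n::finite list" where
  "coordinates = (SOME is. set is = UNIV \<and> distinct is)"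

definition mderiv :: "('n::finite \<Rightarrow> nat) \<Rightarrow> (real^'n \<Rightarrow> complex) \<Rightarrow> real^'n \<Rightarrow> complex" where
  "mderiv \<alpha> f = foldr (\<lambda>i. partial_deriv i ^^ \<alpha> i) coordinates f"

definition mlength :: "('n::finite \<Rightarrow> nat) \<Rightarrow> nat" where
  "mlength \<alpha> = (\<Sum>i\<in>UNIV. \<alpha> i)"

definition fourier :: "(real^'n::finite \<Rightarrow> complex) \<Rightarrow> real^'n \<Rightarrow> complex" where
  "fourier f \<xi> = (LINT x|lborel. f x * cis (- (x \<bullet> \<xi>)))"

section \<open>Locally convex topologies on spaces of complex-valued functions\<close>

text \<open>Vector spaces are sets of functions with the pointwise operations; their topologies have
  the space itself as \<open>topspace\<close>.\<close>

definition complex_subspace :: "('a \<Rightarrow> complex) set \<Rightarrow> bool" where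
  "complex_subspace V \<longleftrightarrow> (\<lambda>x. 0) \<in> V \<and>
     (\<forall>f\<in>V. \<forall>g\<in>V. (\<lambda>x. f x + g x) \<in> V) \<and> (\<forall>c. \<forall>f\<in>V. (\<lambda>x. c * f x) \<in> V)"

definition convex_fun :: "('a \<Rightarrow> complex) set \<Rightarrow> bool" where
  "convex_fun C \<longleftrightarrow> (\<forall>f\<in>C. \<forall>g\<in>C. \<forall>t::real. 0 \<le> t \<and> t \<le> 1 \<longrightarrow>
     (\<lambda>x. complex_of_real (1 - t) * f x + complex_of_real t * g x) \<in> C)"

definition locally_convex_topology :: "('a \<Rightarrow> complex) set \<Rightarrow> ('a \<Rightarrow> complex) topology \<Rightarrow> bool" where
  "locally_convex_topology V T \<longleftrightarrow>
     complex_subspace V \<and> topspace T = V \<and>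
     continuous_map (prod_topology T T) T (\<lambda>(f, g). \<lambda>x. f x + g x) \<and>
     continuous_map (prod_topology euclidean T) T (\<lambda>(c, f). \<lambda>x. c * f x) \<and>
     (\<forall>U. openin T U \<and> (\<lambda>x. 0) \<in> U \<longrightarrow>
        (\<exists>C W. openin T W \<and> (\<lambda>x. 0) \<in> W \<and> W \<subseteq> C \<and> C \<subseteq> U \<and> convex_fun C))"

text \<open>Seminorms are allowed to take the value \<open>\<infinity>\<close> outside the space \<open>V\<close> they are used on.\<close>

definition seminorm_topology ::
    "('a \<Rightarrow> complex) set \<Rightarrow> (('a \<Rightarrow> complex) \<Rightarrow> ennreal) set \<Rightarrow> ('a \<Rightarrow> complex) topology" where
  "seminorm_topology V P = topology_generated_by
     {{g \<in> V. p (\<lambda>x. g x - f x) < ennreal \<epsilon>} | p f \<epsilon>. p \<in> P \<and> f \<in> V \<and> \<epsilon> > 0}"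

text \<open>The finest locally convex topology on the union of the steps that makes all inclusions
  continuous: the supremum of all such topologies is again one.\<close>

definition lc_inductive_limit ::
    "'i set \<Rightarrow> ('i \<Rightarrow> ('a \<Rightarrow> complex) topology) \<Rightarrow> ('a \<Rightarrow> complex) topology" where
  "lc_inductive_limit I X = topology_generated_by
     {U. \<exists>T. locally_convex_topology (\<Union>n\<in>I. topspace (X n)) T \<and>
            (\<forall>n\<in>I. continuous_map (X n) T (\<lambda>f. f)) \<and> openin T U}"

section \<open>Linear and bilinear maps\<close>

definition linear_map ::
    "('a \<Rightarrow> complex) set \<Rightarrow> ('b \<Rightarrow> complex) set \<Rightarrow> (('a \<Rightarrow> complex) \<Rightarrow> 'b \<Rightarrow> complex) \<Rightarrow> bool" where
  "linear_map V W h \<longleftrightarrow> complex_subspace V \<and> complex_subspace W \<and> h ` V \<subseteq> W \<and>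
     (\<forall>f\<in>V. \<forall>g\<in>V. h (\<lambda>x. f x + g x) = (\<lambda>y. h f y + h g y)) \<and>
     (\<forall>c. \<forall>f\<in>V. h (\<lambda>x. c * f x) = (\<lambda>y. c * h f y))"

definition bilinear_map ::
    "('a \<Rightarrow> complex) set \<Rightarrow> ('b \<Rightarrow> complex) set \<Rightarrow> ('c \<Rightarrow> complex) set \<Rightarrow>
     (('a \<Rightarrow> complex) \<Rightarrow> ('b \<Rightarrow> complex) \<Rightarrow> 'c \<Rightarrow> complex) \<Rightarrow> bool" where
  "bilinear_map E F G b \<longleftrightarrow>
     (\<forall>f\<in>E. linear_map F G (b f)) \<and> (\<forall>g\<in>F. linear_map E G (\<lambda>f. b f g))"

definition separately_continuous ::
    "'e topology \<Rightarrow> 'f topology \<Rightarrow> 'g topology \<Rightarrow> ('e \<Rightarrow> 'f \<Rightarrow> 'g) \<Rightarrow> bool" where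
  "separately_continuous E F G b \<longleftrightarrow>
     (\<forall>x\<in>topspace E. continuous_map F G (b x)) \<and>
     (\<forall>y\<in>topspace F. continuous_map E G (\<lambda>x. b x y))"

definition tvs_bounded :: "('a \<Rightarrow> complex) topology \<Rightarrow> ('a \<Rightarrow> complex) set \<Rightarrow> bool" where
  "tvs_bounded T A \<longleftrightarrow> A \<subseteq> topspace T \<and>
     (\<forall>U. openin T U \<and> (\<lambda>x. 0) \<in> U \<longrightarrow>
        (\<exists>r>0. \<forall>c. cmod c \<ge> r \<longrightarrow> A \<subseteq> (\<lambda>f x. c * f x) ` U))"

definition equicontinuous ::
    "('a \<Rightarrow> complex) topology \<Rightarrow> ('b \<Rightarrow> complex) topology \<Rightarrow>
     (('a \<Rightarrow> complex) \<Rightarrow> 'b \<Rightarrow> complex) set \<Rightarrow> bool" where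
  "equicontinuous F G H \<longleftrightarrow>
     (\<forall>h\<in>H. linear_map (topspace F) (topspace G) h \<and> continuous_map F G h) \<and>
     (\<forall>U. openin G U \<and> (\<lambda>x. 0) \<in> U \<longrightarrow>
        (\<exists>W. openin F W \<and> (\<lambda>x. 0) \<in> W \<and> (\<forall>h\<in>H. h ` W \<subseteq> U)))"

definition hypocontinuous ::
    "('a \<Rightarrow> complex) topology \<Rightarrow> ('b \<Rightarrow> complex) topology \<Rightarrow> ('c \<Rightarrow> complex) topology \<Rightarrow>
     (('a \<Rightarrow> complex) \<Rightarrow> ('b \<Rightarrow> complex) \<Rightarrow> 'c \<Rightarrow> complex) \<Rightarrow> bool" where
  "hypocontinuous E F G b \<longleftrightarrow>
     (\<forall>A. tvs_bounded E A \<longrightarrow> equicontinuous F G {b f | f. f \<in> A}) \<and>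
     (\<forall>B. tvs_bounded F B \<longrightarrow> equicontinuous E G {\<lambda>f. b f g | g. g \<in> B})"

section \<open>The spaces\<close>

definition sup_norm :: "('a \<Rightarrow> complex) \<Rightarrow> ennreal" where
  "sup_norm f = (SUP x. ennreal (cmod (f x)))"

definition S_space :: "(real \<Rightarrow> real) \<Rightarrow> (real^'n::finite \<Rightarrow> complex) set" where
  "S_space \<omega> = {f. integrable lborel f \<and> smooth f \<and> smooth (fourier f) \<and>
     (\<forall>l>0. \<forall>\<alpha>.
        sup_norm (\<lambda>x. complex_of_real (exp (l * \<omega> (norm x))) * mderiv \<alpha> f x) < \<infinity> \<and>
        sup_norm (\<lambda>x. complex_of_real (exp (l * \<omega> (norm x))) * mderiv \<alpha> (fourier f) x) < \<infinity>)}"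

definition q_norm :: "(real \<Rightarrow> real) \<Rightarrow> nat \<Rightarrow> nat \<Rightarrow> (real^'n::finite \<Rightarrow> complex) \<Rightarrow> ennreal" where
  "q_norm \<omega> m n f = (SUP \<alpha>.
     sup_norm (\<lambda>x. complex_of_real (exp (real n * \<omega> (norm x))) * mderiv \<alpha> f x) *
     exp_ereal (- (ereal (real m) * young_conj \<omega> (real (mlength \<alpha>) / real m))))"

definition S_topology :: "(real \<Rightarrow> real) \<Rightarrow> (real^'n::finite \<Rightarrow> complex) topology" where
  "S_topology \<omega> = seminorm_topology (S_space \<omega>) {q_norm \<omega> m n | m n. m \<ge> 1 \<and> n \<ge> 1}"

definition r_norm :: "(real \<Rightarrow> real) \<Rightarrow> nat \<Rightarrow> nat \<Rightarrow> (real^'n::finite \<Rightarrow> complex) \<Rightarrow> ennreal" where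
  "r_norm \<omega> m n f = (SUP \<alpha>. SUP x. ennreal (cmod (mderiv \<alpha> f x)) *
     exp_ereal (- ereal (real n * \<omega> (norm x))
                - ereal (real m) * young_conj \<omega> (real (mlength \<alpha>) / real m)))"

definition O_space :: "(real \<Rightarrow> real) \<Rightarrow> nat \<Rightarrow> nat \<Rightarrow> (real^'n::finite \<Rightarrow> complex) set" where
  "O_space \<omega> m n = {f. smooth f \<and> r_norm \<omega> m n f < \<infinity>}"

definition OC_space :: "(real \<Rightarrow> real) \<Rightarrow> (real^'n::finite \<Rightarrow> complex) set" where
  "OC_space \<omega> = (\<Union>n\<in>{1..}. \<Inter>m\<in>{1..}. O_space \<omega> m n)"

text \<open>The projective limit topology on the intersection over \<open>m\<close> is the one given by all the
  norms of the spaces \<open>O_space \<omega> m n\<close>.\<close>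

definition OC_step_topology :: "(real \<Rightarrow> real) \<Rightarrow> nat \<Rightarrow> (real^'n::finite \<Rightarrow> complex) topology" where
  "OC_step_topology \<omega> n =
     seminorm_topology (\<Inter>m\<in>{1..}. O_space \<omega> m n) {r_norm \<omega> m n | m. m \<ge> 1}"

definition OC_topology :: "(real \<Rightarrow> real) \<Rightarrow> (real^'n::finite \<Rightarrow> complex) topology" where
  "OC_topology \<omega> = lc_inductive_limit {1..} (OC_step_topology \<omega>)"

definition mult_op :: "('a \<Rightarrow> complex) \<Rightarrow> ('a \<Rightarrow> complex) \<Rightarrow> 'a \<Rightarrow> complex" where
  "mult_op f g = (\<lambda>x. f x * g x)"

end

theory Submission
  imports Defs
    "HOL-Library.Sublist"
    "HOL-Computational_Algebra.Polynomial"
    "HOL-Probability.Sinc_Integral"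
begin

text \<open>A function lies in \<open>S_space \<omega>\<close> iff it is smooth and all its norms \<open>q\<^bsub>m,n\<^esub>\<close> are finite. From the norms to the
  Fourier transform this is integration by parts, optimised over the order of differentiation by means of
  the supporting lines of the convex function \<open>t \<mapsto> \<omega> (exp t)\<close>. Conversely, Fourier inversion bounds the
  derivatives of \<open>f\<close> without a weight, and an interpolation inequality of Landau type on half-lines leading
  away from the origin combines this with the decay of \<open>f\<close>. The Leibniz rule then yields
  \<open>q\<^bsub>m,n\<^esub> (f g) \<le> D * r\<^bsub>m',k\<^esub> f * q\<^bsub>m',n+k\<^esub> g\<close>, where the powers of \<open>2\<close> are absorbed by enlarging \<open>m\<close>. This
  gives separate continuity. For hypocontinuity one argues directly with seminorms: on a bounded
  set \<open>A\<close> in the inductive limit, for every \<open>m\<close> some \<open>r\<^bsub>m,k\<^esub>\<close> is bounded, since otherwise a gliding hump produces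
  a continuous seminorm that is unbounded on \<open>A\<close>; and for bounded \<open>B\<close> in \<open>S_space \<omega>\<close> the supremum of
  \<open>q\<^bsub>m,n\<^esub> (f g)\<close> over \<open>g \<in> B\<close> is a continuous seminorm in \<open>f\<close>.\<close>

section \<open>Topologies generated by seminorms\<close>

text \<open>The definition of \<open>S_space\<close> bounds every derivative of \<open>f\<close> and
  of its Fourier transform separately and mentions no \<open>q_norm\<close>. The transform of a
  product is a convolution, so membership of \<open>f g\<close> is awkward to check there; a
  description by the norms alone makes it a consequence of the Leibniz estimate, and it also shows
  that the norms are finite on the space. All losses must be geometric in the order of
  differentiation: the doubling condition turns a factor \<open>C ^ k\<close> into a larger
  \<open>m\<close>, whereas a factor \<open>k!\<close> cannot be absorbed in general. This is why
  the constants of the interpolation inequality are tracked explicitly. Half-lines occur because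
  \<omega> is increasing: its value at a point is a lower bound on the ray leading outward, but not
  on the whole line. Hypocontinuity is usually deduced from barrelledness; here two uniform
  estimates take the place of that deduction. On a bounded set the growth index \<open>k\<close> may
  depend on \<open>m\<close>. This is harmless, because each \<open>q\<close> norm involves a single
  \<open>m\<close> and the decay index \<open>n + k\<close> of the other factor is free.\<close>

definition seminorm_on :: "('a \<Rightarrow> complex) set \<Rightarrow> (('a \<Rightarrow> complex) \<Rightarrow> ennreal) \<Rightarrow> bool" where
  "seminorm_on V p \<longleftrightarrow> (\<forall>f\<in>V. p f < \<infinity>) \<and>
     (\<forall>f\<in>V. \<forall>g\<in>V. p (\<lambda>x. f x + g x) \<le> p f + p g) \<and>
     (\<forall>c. \<forall>f\<in>V. p (\<lambda>x. c * f x) = ennreal (cmod c) * p f)"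

lemma complex_subspaceD:
  assumes "complex_subspace V"
  shows "(\<lambda>x. 0) \<in> V"
    and "f \<in> V \<Longrightarrow> g \<in> V \<Longrightarrow> (\<lambda>x. f x + g x) \<in> V"
    and "f \<in> V \<Longrightarrow> (\<lambda>x. c * f x) \<in> V"
    and "f \<in> V \<Longrightarrow> g \<in> V \<Longrightarrow> (\<lambda>x. f x - g x) \<in> V"
proof -
  show *: "(\<lambda>x. 0) \<in> V" "f \<in> V \<Longrightarrow> g \<in> V \<Longrightarrow> (\<lambda>x. f x + g x) \<in> V"
    "f \<in> V \<Longrightarrow> (\<lambda>x. c * f x) \<in> V" for f g c
    using assms unfolding complex_subspace_def by blast+
  assume "f \<in> V" "g \<in> V"
  then show "(\<lambda>x. f x - g x) \<in> V"
    using *(2)[OF _ *(3)[of g "-1"], of f] by simp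
qed

lemma seminorm_onD:
  assumes "seminorm_on V p"
  shows "f \<in> V \<Longrightarrow> p f < \<infinity>"
    and "f \<in> V \<Longrightarrow> g \<in> V \<Longrightarrow> p (\<lambda>x. f x + g x) \<le> p f + p g"
    and "f \<in> V \<Longrightarrow> p (\<lambda>x. c * f x) = ennreal (cmod c) * p f"
  using assms unfolding seminorm_on_def by blast+

lemma seminorm_on_zero:
  assumes "seminorm_on V p" "complex_subspace V"
  shows "p (\<lambda>x. 0) = 0"
  using seminorm_onD(3)[OF assms(1) complex_subspaceD(1)[OF assms(2)], of 0] by simp

lemma seminorm_on_triangle:
  assumes "seminorm_on V p" "complex_subspace V" "f \<in> V" "g \<in> V" "h \<in> V"
  shows "p (\<lambda>x. f x - h x) \<le> p (\<lambda>x. f x - g x) + p (\<lambda>x. g x - h x)"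
  using seminorm_onD(2)[OF assms(1) complex_subspaceD(4)[OF assms(2,3,4)]
      complex_subspaceD(4)[OF assms(2,4,5)]] by simp

text \<open>All seminorms used later are suprema of moduli of linear functionals: the weighted
  norms, the gliding hump, and the supremum of norms of products over a bounded set. Only finiteness
  has to be checked case by case.\<close>

lemma seminorm_on_SUP_functionals:
  assumes "\<And>i f g. i \<in> I \<Longrightarrow> f \<in> V \<Longrightarrow> g \<in> V \<Longrightarrow> L i (\<lambda>x. f x + g x) = L i f + L i g"
    and "\<And>i c f. i \<in> I \<Longrightarrow> f \<in> V \<Longrightarrow> L i (\<lambda>x. c * f x) = c * L i f"
    and "\<And>f. f \<in> V \<Longrightarrow> (SUP i\<in>I. ennreal (cmod (L i f))) < \<infinity>"
  shows "seminorm_on V (\<lambda>f. SUP i\<in>I. ennreal (cmod (L i f)))"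
proof -
  have "(SUP i\<in>I. ennreal (cmod (L i (\<lambda>x. f x + g x)))) \<le>
      (SUP i\<in>I. ennreal (cmod (L i f))) + (SUP i\<in>I. ennreal (cmod (L i g)))"
    if "f \<in> V" "g \<in> V" for f g
  proof (rule SUP_least)
    fix i assume i: "i \<in> I"
    have "ennreal (cmod (L i (\<lambda>x. f x + g x))) \<le> ennreal (cmod (L i f)) + ennreal (cmod (L i g))"
      using i that by (simp add: assms(1) norm_triangle_ineq flip: ennreal_plus)
    also have "\<dots> \<le> (SUP i\<in>I. ennreal (cmod (L i f))) + (SUP i\<in>I. ennreal (cmod (L i g)))"
      using i by (intro add_mono SUP_upper)
    finally show "ennreal (cmod (L i (\<lambda>x. f x + g x))) \<le> \<dots>" .
  qed
  moreover have "(SUP i\<in>I. ennreal (cmod (L i (\<lambda>x. c * f x)))) =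
      ennreal (cmod c) * (SUP i\<in>I. ennreal (cmod (L i f)))" if "f \<in> V" for c f
    using that by (simp add: assms(2) norm_mult ennreal_mult SUP_mult_left_ennreal cong: SUP_cong)
  ultimately show ?thesis
    using assms(3) unfolding seminorm_on_def by blast
qed

text \<open>\<open>P\<close> is nonempty because the carrier of a generated topology is the union of
  its generators; without any ball it would be empty instead of \<open>V\<close>.\<close>

locale seminormed =
  fixes V :: "('a \<Rightarrow> complex) set" and P :: "(('a \<Rightarrow> complex) \<Rightarrow> ennreal) set"
  assumes subspace: "complex_subspace V"
    and seminorm: "p \<in> P \<Longrightarrow> seminorm_on V p"
    and nonempty: "P \<noteq> {}"
begin

lemma topspace_seminorm [simp]: "topspace (seminorm_topology V P) = V"
proof -
  obtain p where "p \<in> P"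
    using nonempty by blast
  then have "f \<in> V \<Longrightarrow> f \<in> {g \<in> V. p (\<lambda>x. g x - f x) < ennreal 1}" for f
    using seminorm_on_zero[OF seminorm[OF \<open>p \<in> P\<close>] subspace] by simp
  then have "f \<in> V \<Longrightarrow> f \<in> \<Union> {{g \<in> V. p (\<lambda>x. g x - f x) < ennreal \<epsilon>} |p f \<epsilon>. p \<in> P \<and> f \<in> V \<and> 0 < \<epsilon>}" for f
    using \<open>p \<in> P\<close> zero_less_one[where ?'a=real] by (intro UnionI[of "{g \<in> V. p (\<lambda>x. g x - f x) < ennreal 1}"]) blast+
  then show ?thesis
    unfolding seminorm_topology_def topology_generated_by_topspace by auto
qed

lemma openin_seminorm_ball:
  "p \<in> P \<Longrightarrow> f \<in> V \<Longrightarrow> openin (seminorm_topology V P) {g \<in> V. p (\<lambda>x. g x - f x) < ennreal \<epsilon>}"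
  by (cases "\<epsilon> > 0") (auto simp: seminorm_topology_def ennreal_neg intro!: topology_generated_by_Basis)

lemma openin_seminorm_ball0:
  "p \<in> P \<Longrightarrow> openin (seminorm_topology V P) {g \<in> V. p g < ennreal \<epsilon>}"
  using openin_seminorm_ball[OF _ complex_subspaceD(1)[OF subspace], of p \<epsilon>] by simp

text \<open>The generating balls have arbitrary centres. By the triangle inequality such a ball
  contains a ball around each of its points, with radius \<open>\<epsilon>\<close> minus the
  distance to the centre.\<close>

lemma seminorm_ball_shrink:
  assumes "p \<in> P" "f \<in> V" "g \<in> V" "p (\<lambda>x. g x - f x) < ennreal \<epsilon>"
  obtains \<delta> where "\<delta> > 0" "\<And>h. h \<in> V \<Longrightarrow> p (\<lambda>x. h x - g x) < ennreal \<delta> \<Longrightarrow> p (\<lambda>x. h x - f x) < ennreal \<epsilon>"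
proof
  define r where "r = enn2real (p (\<lambda>x. g x - f x))"
  have r: "p (\<lambda>x. g x - f x) = ennreal r" "r \<ge> 0"
    using order.strict_trans[OF assms(4) ennreal_less_top] unfolding r_def by (simp_all add: less_top)
  then have "r < \<epsilon>"
    using assms(4) by (simp add: ennreal_less_iff)
  then show "\<epsilon> - r > 0" by simp
  fix h assume h: "h \<in> V" "p (\<lambda>x. h x - g x) < ennreal (\<epsilon> - r)"
  have "p (\<lambda>x. h x - f x) \<le> p (\<lambda>x. h x - g x) + ennreal r"
    using seminorm_on_triangle[OF seminorm[OF assms(1)] subspace h(1) assms(3,2)] r by simp
  also have "\<dots> < ennreal \<epsilon>"
    using h(2) r(2) \<open>r < \<epsilon>\<close>
    by (cases "p (\<lambda>x. h x - g x)") (auto simp: ennreal_less_iff simp flip: ennreal_plus)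
  finally show "p (\<lambda>x. h x - f x) < ennreal \<epsilon>" .
qed

text \<open>The generators form only a subbase. Induction over the generation of an open set yields
  the usual neighbourhoods: finitely many seminorms and one common radius, centred at the given
  point.\<close>

lemma openin_seminormD:
  assumes "openin (seminorm_topology V P) U" "f \<in> U"
  shows "\<exists>F \<epsilon>. finite F \<and> F \<subseteq> P \<and> \<epsilon> > 0 \<and> {g \<in> V. \<forall>p\<in>F. p (\<lambda>x. g x - f x) < ennreal \<epsilon>} \<subseteq> U"
proof -
  have "generate_topology_on {{g \<in> V. p (\<lambda>x. g x - f x) < ennreal \<epsilon>} | p f \<epsilon>. p \<in> P \<and> f \<in> V \<and> \<epsilon> > 0} U"
    using assms(1) unfolding seminorm_topology_def openin_topology_generated_by_iff .
  then show ?thesis using assms(2)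
  proof induction
    case Empty
    then show ?case by simp
  next
    case (Int a b)
    then obtain F \<epsilon> F' \<epsilon>' where
      F: "finite F" "F \<subseteq> P" "\<epsilon> > 0" "{g \<in> V. \<forall>p\<in>F. p (\<lambda>x. g x - f x) < ennreal \<epsilon>} \<subseteq> a" and
      F': "finite F'" "F' \<subseteq> P" "\<epsilon>' > 0" "{g \<in> V. \<forall>p\<in>F'. p (\<lambda>x. g x - f x) < ennreal \<epsilon>'} \<subseteq> b"
      by (meson IntD1 IntD2)
    have "{g \<in> V. \<forall>p\<in>F \<union> F'. p (\<lambda>x. g x - f x) < ennreal (min \<epsilon> \<epsilon>')} \<subseteq> a \<inter> b"
    proof (rule subsetI)
      fix g assume g: "g \<in> {g \<in> V. \<forall>p\<in>F \<union> F'. p (\<lambda>x. g x - f x) < ennreal (min \<epsilon> \<epsilon>')}"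
      have "p (\<lambda>x. g x - f x) < ennreal \<epsilon> \<and> p (\<lambda>x. g x - f x) < ennreal \<epsilon>'" if "p \<in> F \<union> F'" for p
      proof -
        have "p (\<lambda>x. g x - f x) < ennreal (min \<epsilon> \<epsilon>')" using g that by blast
        moreover have "ennreal (min \<epsilon> \<epsilon>') \<le> ennreal \<epsilon>" "ennreal (min \<epsilon> \<epsilon>') \<le> ennreal \<epsilon>'"
          by (intro ennreal_leI; simp)+
        ultimately show ?thesis by (meson order.strict_trans2)
      qed
      then show "g \<in> a \<inter> b" using F(4) F'(4) g by blast
    qed
    then show ?case
      using F F' by (intro exI[of _ "F \<union> F'"] exI[of _ "min \<epsilon> \<epsilon>'"]) auto
  next
    case (UN K)
    then obtain k where "k \<in> K" "f \<in> k" by blast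
    show ?case
      using UN.IH[OF \<open>k \<in> K\<close> \<open>f \<in> k\<close>] by (elim ex_forward conj_forward) (use \<open>k \<in> K\<close> in blast)+
  next
    case (Basis s)
    then obtain p f' \<epsilon> where s: "s = {g \<in> V. p (\<lambda>x. g x - f' x) < ennreal \<epsilon>}" "p \<in> P" "f' \<in> V"
      by blast
    then have f: "f \<in> V" "p (\<lambda>x. f x - f' x) < ennreal \<epsilon>"
      using Basis by auto
    obtain \<delta> where "\<delta> > 0" "\<And>h. h \<in> V \<Longrightarrow> p (\<lambda>x. h x - f x) < ennreal \<delta> \<Longrightarrow> p (\<lambda>x. h x - f' x) < ennreal \<epsilon>"
      using seminorm_ball_shrink[OF s(2,3) f] by blast
    then show ?case
      using s by (intro exI[of _ "{p}"] exI[of _ \<delta>]) auto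
  qed
qed

text \<open>Preimages of generators suffice, and \<open>seminorm_ball_shrink\<close> recentres a
  generator at \<open>h x\<close>. \<open>h\<close> is an arbitrary map, so that addition and scalar
  multiplication on product spaces are covered.\<close>

lemma continuous_map_into_seminorm:
  assumes "h ` topspace X \<subseteq> V"
    and "\<And>x p \<epsilon>. x \<in> topspace X \<Longrightarrow> p \<in> P \<Longrightarrow> \<epsilon> > 0 \<Longrightarrow>
      \<exists>N. openin X N \<and> x \<in> N \<and> (\<forall>y\<in>N. p (\<lambda>z. h y z - h x z) < ennreal \<epsilon>)"
  shows "continuous_map X (seminorm_topology V P) h"
  unfolding seminorm_topology_def
proof (rule continuous_on_generated_topo)
  show "h ` topspace X \<subseteq> \<Union> {{g \<in> V. p (\<lambda>x. g x - f x) < ennreal \<epsilon>} |p f \<epsilon>. p \<in> P \<and> f \<in> V \<and> 0 < \<epsilon>}"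
    using assms(1) topspace_seminorm unfolding seminorm_topology_def topology_generated_by_topspace by simp
  fix U assume "U \<in> {{g \<in> V. p (\<lambda>x. g x - f x) < ennreal \<epsilon>} |p f \<epsilon>. p \<in> P \<and> f \<in> V \<and> 0 < \<epsilon>}"
  then obtain p f \<epsilon> where U: "U = {g \<in> V. p (\<lambda>x. g x - f x) < ennreal \<epsilon>}" "p \<in> P" "f \<in> V"
    by blast
  show "openin X (h -` U \<inter> topspace X)"
  proof (subst openin_subopen, safe)
    fix x assume x: "h x \<in> U" "x \<in> topspace X"
    obtain \<delta> where \<delta>: "\<delta> > 0" "\<And>g. g \<in> V \<Longrightarrow> p (\<lambda>z. g z - h x z) < ennreal \<delta> \<Longrightarrow> p (\<lambda>z. g z - f z) < ennreal \<epsilon>"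
      using seminorm_ball_shrink[OF U(2,3)] x U(1) by blast
    obtain N where N: "openin X N" "x \<in> N" "\<forall>y\<in>N. p (\<lambda>z. h y z - h x z) < ennreal \<delta>"
      using assms(2)[OF x(2) U(2) \<delta>(1)] by blast
    have "N \<subseteq> topspace X"
      using N(1) by (rule openin_subset)
    then show "\<exists>T. openin X T \<and> x \<in> T \<and> T \<subseteq> h -` U \<inter> topspace X"
      using N \<delta>(2) assms(1) unfolding U(1) by (intro exI[of _ N]) (auto simp: image_subset_iff subset_iff)
  qed
qed

lemma locally_convex_seminorm: "locally_convex_topology V (seminorm_topology V P)"
  unfolding locally_convex_topology_def
proof (intro conjI allI impI)
  let ?T = "seminorm_topology V P"
  show "complex_subspace V" by (fact subspace)
  show "topspace ?T = V" by simp
  show "continuous_map (prod_topology ?T ?T) ?T (\<lambda>(f, g). \<lambda>x. f x + g x)"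
  proof (rule continuous_map_into_seminorm)
    show "(\<lambda>(f, g). \<lambda>x. f x + g x) ` topspace (prod_topology ?T ?T) \<subseteq> V"
      using complex_subspaceD(2)[OF subspace] by auto
    fix z :: "('a \<Rightarrow> complex) \<times> ('a \<Rightarrow> complex)" and p and \<epsilon> :: real
    assume z: "z \<in> topspace (prod_topology ?T ?T)" and p: "p \<in> P" and \<epsilon>: "\<epsilon> > 0"
    obtain f g where fg: "z = (f, g)" "f \<in> V" "g \<in> V"
      using z by auto
    let ?N = "{h \<in> V. p (\<lambda>x. h x - f x) < ennreal (\<epsilon>/2)} \<times> {h \<in> V. p (\<lambda>x. h x - g x) < ennreal (\<epsilon>/2)}"
    have "p (\<lambda>x. (f' x + g' x) - (f x + g x)) < ennreal \<epsilon>"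
      if "f' \<in> V" "g' \<in> V" "p (\<lambda>x. f' x - f x) < ennreal (\<epsilon>/2)" "p (\<lambda>x. g' x - g x) < ennreal (\<epsilon>/2)" for f' g'
    proof -
      have "p (\<lambda>x. (f' x - f x) + (g' x - g x)) \<le> p (\<lambda>x. f' x - f x) + p (\<lambda>x. g' x - g x)"
        using that fg complex_subspaceD(4)[OF subspace] by (intro seminorm_onD(2)[OF seminorm[OF p]])
      also have "\<dots> < ennreal (\<epsilon>/2) + ennreal (\<epsilon>/2)"
        using that(3,4) by (rule add_strict_mono)
      also have "\<dots> = ennreal \<epsilon>"
        using \<epsilon> by (simp flip: ennreal_plus)
      finally show ?thesis by (simp add: algebra_simps)
    qed
    moreover have "openin (prod_topology ?T ?T) ?N"
      using openin_seminorm_ball[OF p] fg by (simp add: openin_prod_Times_iff)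
    moreover have "z \<in> ?N"
      using fg seminorm_on_zero[OF seminorm[OF p] subspace] \<epsilon> by simp
    ultimately show "\<exists>N. openin (prod_topology ?T ?T) N \<and> z \<in> N \<and>
        (\<forall>y\<in>N. p (\<lambda>x. (case y of (f, g) \<Rightarrow> \<lambda>x. f x + g x) x - (case z of (f, g) \<Rightarrow> \<lambda>x. f x + g x) x) < ennreal \<epsilon>)"
      unfolding fg(1) by (intro exI[of _ ?N]) auto
  qed
  show "continuous_map (prod_topology euclidean ?T) ?T (\<lambda>(c, f). \<lambda>x. c * f x)"
  proof (rule continuous_map_into_seminorm)
    show "(\<lambda>(c, f). \<lambda>x. c * f x) ` topspace (prod_topology euclidean ?T) \<subseteq> V"
      using complex_subspaceD(3)[OF subspace] by auto
    fix z :: "complex \<times> ('a \<Rightarrow> complex)" and p and \<epsilon> :: real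
    assume z: "z \<in> topspace (prod_topology euclidean ?T)" and p: "p \<in> P" and \<epsilon>: "\<epsilon> > 0"
    obtain c f where cf: "z = (c, f)" "f \<in> V"
      using z by auto
    define r where "r = enn2real (p f)"
    have r: "p f = ennreal r" "r \<ge> 0"
      using seminorm_onD(1)[OF seminorm[OF p] cf(2)] unfolding r_def by auto
    \<comment> \<open>Since \<open>c' f' - c f = c' (f' - f) + (c' - c) f\<close>, each summand gets
      half of \<open>\<epsilon>\<close>. The \<open>+ 1\<close> guards against \<open>r = 0\<close>,
      and \<open>cmod c + d\<close> bounds \<open>cmod c'\<close>.\<close>
    define d where "d = \<epsilon> / 2 / (r + 1)"
    define e where "e = \<epsilon> / 2 / (cmod c + d)"
    have d: "d > 0" and e: "e > 0"
      using \<epsilon> r by (auto simp: d_def e_def intro!: divide_pos_pos add_nonneg_pos)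
    have "d * r < \<epsilon>/2"
      using r \<epsilon> by (simp add: d_def field_simps)
    let ?N = "ball c d \<times> {h \<in> V. p (\<lambda>x. h x - f x) < ennreal e}"
    have "p (\<lambda>x. c' * f' x - c * f x) < ennreal \<epsilon>"
      if "c' \<in> ball c d" "f' \<in> V" "p (\<lambda>x. f' x - f x) < ennreal e" for c' f'
    proof -
      have cc: "cmod (c' - c) \<le> d" "cmod c' \<le> cmod c + d"
        using that(1) norm_triangle_ineq2[of c' c] by (auto simp: dist_norm norm_minus_commute)
      have "p (\<lambda>x. c' * (f' x - f x) + (c' - c) * f x) \<le> p (\<lambda>x. c' * (f' x - f x)) + p (\<lambda>x. (c' - c) * f x)"
        using that cf complex_subspaceD(3,4)[OF subspace]
        by (intro seminorm_onD(2)[OF seminorm[OF p]]) auto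
      also have "\<dots> = ennreal (cmod c') * p (\<lambda>x. f' x - f x) + ennreal (cmod (c' - c)) * ennreal r"
        using that cf complex_subspaceD(4)[OF subspace] r seminorm_onD(3)[OF seminorm[OF p]] by simp
      also have "\<dots> \<le> ennreal (cmod c + d) * ennreal e + ennreal d * ennreal r"
        using that cc by (intro add_mono mult_mono) (auto intro: ennreal_leI)
      also have "\<dots> = ennreal ((cmod c + d) * e + d * r)"
        using d e r by (simp add: ennreal_mult ennreal_plus)
      also have "\<dots> < ennreal \<epsilon>"
      proof -
        have "cmod c + d > 0" using d by (intro add_nonneg_pos) auto
        then have "(cmod c + d) * e = \<epsilon>/2"
          unfolding e_def by (subst times_divide_eq_right) (subst nonzero_mult_div_cancel_left; simp)
        then show ?thesis using \<open>d * r < \<epsilon>/2\<close> \<epsilon> by (intro ennreal_lessI) auto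
      qed
      finally show ?thesis by (simp add: algebra_simps)
    qed
    moreover have "openin (prod_topology euclidean ?T) ?N"
      using openin_seminorm_ball[OF p] cf by (simp add: openin_prod_Times_iff)
    moreover have "z \<in> ?N"
      using cf seminorm_on_zero[OF seminorm[OF p] subspace] d e by simp
    ultimately show "\<exists>N. openin (prod_topology euclidean ?T) N \<and> z \<in> N \<and>
        (\<forall>y\<in>N. p (\<lambda>x. (case y of (c, f) \<Rightarrow> \<lambda>x. c * f x) x - (case z of (c, f) \<Rightarrow> \<lambda>x. c * f x) x) < ennreal \<epsilon>)"
      unfolding cf(1) by (intro exI[of _ ?N]) auto
  qed
  fix U assume U: "openin ?T U \<and> (\<lambda>x. 0) \<in> U"
  obtain F \<epsilon> where F: "finite F" "F \<subseteq> P" "\<epsilon> > 0" "{g \<in> V. \<forall>p\<in>F. p g < ennreal \<epsilon>} \<subseteq> U"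
    using openin_seminormD[of U "\<lambda>x. 0"] U by auto
  let ?W = "{g \<in> V. \<forall>p\<in>F. p g < ennreal \<epsilon>}"
  have W_eq: "?W = V \<inter> (\<Inter>p\<in>F. {g \<in> V. p g < ennreal \<epsilon>})" by blast
  have "openin ?T ?W"
    unfolding W_eq
    using F openin_INT[of F ?T "\<lambda>p. {g \<in> V. p g < ennreal \<epsilon>}"] openin_seminorm_ball0
    by (auto simp: Int_commute)
  have "p (\<lambda>x. 0) < ennreal \<epsilon>" if "p \<in> F" for p
    using that F seminorm_on_zero[OF seminorm subspace, of p] by auto
  then have W0: "(\<lambda>x. 0) \<in> ?W"
    using complex_subspaceD(1)[OF subspace] by simp
  have "convex_fun ?W"
    unfolding convex_fun_def
  proof safe
    fix f g and t :: real
    assume fg: "f \<in> V" "g \<in> V" "\<forall>p\<in>F. p f < ennreal \<epsilon>" "\<forall>p\<in>F. p g < ennreal \<epsilon>" and t: "0 \<le> t" "t \<le> 1"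
    show "(\<lambda>x. complex_of_real (1 - t) * f x + complex_of_real t * g x) \<in> V"
      by (intro complex_subspaceD(2,3)[OF subspace] fg)
    fix p assume p: "p \<in> F"
    then have sp: "seminorm_on V p" using F seminorm by auto
    define r s where "r = enn2real (p f)" and "s = enn2real (p g)"
    have r: "p f = ennreal r" "p g = ennreal s" "r \<ge> 0" "s \<ge> 0"
      using seminorm_onD(1)[OF sp] fg unfolding r_def s_def by auto
    then have rs: "r < \<epsilon>" "s < \<epsilon>"
      using fg p by (auto simp: ennreal_less_iff)
    have "p (\<lambda>x. complex_of_real (1 - t) * f x + complex_of_real t * g x)
        \<le> p (\<lambda>x. complex_of_real (1 - t) * f x) + p (\<lambda>x. complex_of_real t * g x)"
      by (intro seminorm_onD(2)[OF sp] complex_subspaceD(3)[OF subspace] fg)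
    also have "\<dots> = ennreal (1 - t) * ennreal r + ennreal t * ennreal s"
    proof -
      have "cmod (complex_of_real (1 - t)) = 1 - t" "cmod (complex_of_real t) = t"
        using t by (simp_all only: norm_of_real abs_of_nonneg diff_ge_0_iff_ge)
      then show ?thesis
        using r fg seminorm_onD(3)[OF sp] by metis
    qed
    also have "\<dots> = ennreal ((1 - t) * r + t * s)"
      using t r by (subst ennreal_plus) (auto simp: ennreal_mult)
    also have "\<dots> < ennreal \<epsilon>"
      using rs t F(3) by (intro ennreal_lessI convex_bound_lt) auto
    finally show "p (\<lambda>x. complex_of_real (1 - t) * f x + complex_of_real t * g x) < ennreal \<epsilon>" .
  qed
  then show "\<exists>C W. openin ?T W \<and> (\<lambda>x. 0) \<in> W \<and> W \<subseteq> C \<and> C \<subseteq> U \<and> convex_fun C"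
    by (intro exI[of _ ?W] conjI \<open>openin ?T ?W\<close> W0 F(4) order_refl)
qed

text \<open>An open neighbourhood of \<open>0\<close> involves finitely many seminorms, so the
  neighbourhoods found for each of them can be intersected. \<open>E\<close> is an arbitrary
  topology, which lets the lemma serve for \<open>S_topology\<close> and for the inductive
  limit.\<close>

lemma equicontinuous_at_zero:
  assumes "(\<lambda>x. 0) \<in> topspace E"
    and "\<And>h f. h \<in> H \<Longrightarrow> f \<in> topspace E \<Longrightarrow> h f \<in> V"
    and "\<And>p \<epsilon>. p \<in> P \<Longrightarrow> \<epsilon> > 0 \<Longrightarrow>
      \<exists>W. openin E W \<and> (\<lambda>x. 0) \<in> W \<and> (\<forall>h\<in>H. \<forall>f\<in>W. p (h f) < ennreal \<epsilon>)"
    and U: "openin (seminorm_topology V P) U" "(\<lambda>x. 0) \<in> U"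
  shows "\<exists>W. openin E W \<and> (\<lambda>x. 0) \<in> W \<and> (\<forall>h\<in>H. h ` W \<subseteq> U)"
proof -
  obtain F \<epsilon> where F: "finite F" "F \<subseteq> P" "\<epsilon> > 0" "{g \<in> V. \<forall>p\<in>F. p g < ennreal \<epsilon>} \<subseteq> U"
    using openin_seminormD[OF U] by auto
  have "\<forall>p\<in>F. \<exists>W. openin E W \<and> (\<lambda>x. 0) \<in> W \<and> (\<forall>h\<in>H. \<forall>f\<in>W. p (h f) < ennreal \<epsilon>)"
    using F assms(3) by blast
  then obtain W where W: "\<And>p. p \<in> F \<Longrightarrow> openin E (W p) \<and> (\<lambda>x. 0) \<in> W p \<and> (\<forall>h\<in>H. \<forall>f\<in>W p. p (h f) < ennreal \<epsilon>)"
    by metis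
  let ?W = "topspace E \<inter> (\<Inter>p\<in>F. W p)"
  have "openin E ?W"
    using openin_INT[of F E W] F(1) W by (simp add: Int_commute)
  moreover have "(\<lambda>x. 0) \<in> ?W" using W assms(1) by blast
  moreover have "h ` ?W \<subseteq> U" if "h \<in> H" for h
  proof safe
    fix f assume f: "f \<in> topspace E" "f \<in> (\<Inter>p\<in>F. W p)"
    have "p (h f) < ennreal \<epsilon>" if "p \<in> F" for p
      using W[OF that] that f(2) \<open>h \<in> H\<close> by (metis INT_D)
    then have "h f \<in> {g \<in> V. \<forall>p\<in>F. p g < ennreal \<epsilon>}"
      using assms(2)[OF \<open>h \<in> H\<close> f(1)] by simp
    then show "h f \<in> U" using F(4) by (rule subsetD[rotated])
  qed
  ultimately show ?thesis by (intro exI[of _ ?W] conjI ballI)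
qed

end

section \<open>Linear maps between seminormed spaces, inductive limits and bounded sets\<close>

lemma linear_mapD:
  assumes "linear_map V W h"
  shows "f \<in> V \<Longrightarrow> h f \<in> W"
    and "f \<in> V \<Longrightarrow> g \<in> V \<Longrightarrow> h (\<lambda>x. f x + g x) = (\<lambda>y. h f y + h g y)"
    and "f \<in> V \<Longrightarrow> h (\<lambda>x. c * f x) = (\<lambda>y. c * h f y)"
  using assms unfolding linear_map_def by auto

lemma continuous_map_seminorm_linear:
  assumes E: "seminormed V P" and G: "seminormed W Q" and h: "linear_map V W h"
    and bound: "\<And>q. q \<in> Q \<Longrightarrow> \<exists>p\<in>P. \<exists>C. \<forall>f\<in>V. q (h f) \<le> ennreal C * p f"
  shows "continuous_map (seminorm_topology V P) (seminorm_topology W Q) h"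
proof -
  interpret E: seminormed V P by (fact E)
  interpret G: seminormed W Q by (fact G)
  show ?thesis
  proof (rule G.continuous_map_into_seminorm)
    show "h ` topspace (seminorm_topology V P) \<subseteq> W"
      using h by (simp add: linear_map_def)
    fix f q and \<epsilon> :: real assume "f \<in> topspace (seminorm_topology V P)" and q: "q \<in> Q" and \<epsilon>: "\<epsilon> > 0"
    then have f: "f \<in> V" by simp
    obtain p C where pC: "p \<in> P" "\<And>g. g \<in> V \<Longrightarrow> q (h g) \<le> ennreal C * p g"
      using bound[OF q] by blast
    \<comment> \<open>\<open>C\<close> may be any real number, hence the absolute value; the
      \<open>+ 1\<close> keeps the divisor positive.\<close>
    define d where "d = \<epsilon> / (\<bar>C\<bar> + 1)"
    have "\<bar>C\<bar> + 1 > 0" by linarith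
    then have d: "d > 0" "\<bar>C\<bar> * d < \<epsilon>"
      using \<epsilon> by (auto simp: d_def field_simps)
    have "q (\<lambda>z. h g z - h f z) < ennreal \<epsilon>" if g: "g \<in> V" "p (\<lambda>x. g x - f x) < ennreal d" for g
    proof -
      have "h (\<lambda>x. -1 * f x) = (\<lambda>y. -1 * h f y)"
        using f by (rule linear_mapD(3)[OF h])
      moreover have "h (\<lambda>x. g x + -1 * f x) = (\<lambda>y. h g y + h (\<lambda>x. -1 * f x) y)"
        by (rule linear_mapD(2)[OF h g(1) complex_subspaceD(3)[OF E.subspace f]])
      ultimately have "(\<lambda>z. h g z - h f z) = h (\<lambda>x. g x - f x)" by simp
      then have "q (\<lambda>z. h g z - h f z) \<le> ennreal C * p (\<lambda>x. g x - f x)"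
        using pC(2)[OF complex_subspaceD(4)[OF E.subspace g(1) f]] by simp
      also have "\<dots> \<le> ennreal \<bar>C\<bar> * ennreal d"
        using g(2) by (intro mult_mono) (auto intro: ennreal_leI)
      also have "\<dots> < ennreal \<epsilon>"
        using d \<epsilon> by (simp add: ennreal_lessI flip: ennreal_mult)
      finally show ?thesis .
    qed
    then show "\<exists>N. openin (seminorm_topology V P) N \<and> f \<in> N \<and> (\<forall>g\<in>N. q (\<lambda>z. h g z - h f z) < ennreal \<epsilon>)"
      using f d(1) E.openin_seminorm_ball[OF pC(1) f, of d] seminorm_on_zero[OF E.seminorm[OF pC(1)] E.subspace]
      by (intro exI[of _ "{g \<in> V. p (\<lambda>x. g x - f x) < ennreal d}"]) auto
  qed
qed

lemma topspace_lc_inductive_limit_subset: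
  "topspace (lc_inductive_limit I X) \<subseteq> (\<Union>n\<in>I. topspace (X n))"
  unfolding lc_inductive_limit_def topology_generated_by_topspace
  by (auto simp: locally_convex_topology_def dest!: openin_subset)

text \<open>The topology given by \<open>p\<close> alone is locally convex, and the bounds make all
  inclusions of the steps continuous for it. It is therefore one of the topologies whose open sets
  generate the limit, so its balls are open there. The carrier comes out at the same time, because
  the whole union is open in this topology.\<close>

lemma
  fixes V :: "'i \<Rightarrow> ('a \<Rightarrow> complex) set"
  assumes "\<And>n. n \<in> I \<Longrightarrow> seminormed (V n) (P n)"
    and sub: "complex_subspace (\<Union>n\<in>I. V n)"
    and p: "seminorm_on (\<Union>n\<in>I. V n) p"
    and bound: "\<And>n. n \<in> I \<Longrightarrow> \<exists>q\<in>P n. \<exists>C. \<forall>f\<in>V n. p f \<le> ennreal C * q f"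
  shows openin_lc_inductive_limit_ball: "f \<in> (\<Union>n\<in>I. V n) \<Longrightarrow>
      openin (lc_inductive_limit I (\<lambda>n. seminorm_topology (V n) (P n)))
        {g \<in> (\<Union>n\<in>I. V n). p (\<lambda>x. g x - f x) < ennreal \<epsilon>}"
    and topspace_lc_inductive_limit:
      "topspace (lc_inductive_limit I (\<lambda>n. seminorm_topology (V n) (P n))) = (\<Union>n\<in>I. V n)"
proof -
  let ?V = "\<Union>n\<in>I. V n" and ?X = "\<lambda>n. seminorm_topology (V n) (P n)"
  interpret seminormed ?V "{p}"
    using sub p by unfold_locales auto
  have top: "topspace (?X n) = V n" if "n \<in> I" for n
    using assms(1)[OF that] by (simp add: seminormed.topspace_seminorm)
  have "continuous_map (?X n) (seminorm_topology ?V {p}) (\<lambda>f. f)" if n: "n \<in> I" for n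
  proof (rule continuous_map_seminorm_linear[OF assms(1)[OF n]])
    show "seminormed ?V {p}" ..
    show "linear_map (V n) ?V (\<lambda>f. f)"
      using assms(1)[OF n] sub n unfolding linear_map_def seminormed_def by auto
    show "\<exists>q\<in>P n. \<exists>C. \<forall>f\<in>V n. r f \<le> ennreal C * q f" if "r \<in> {p}" for r
      using bound[OF n] that by simp
  qed
  then have "openin (lc_inductive_limit I ?X) U" if "openin (seminorm_topology ?V {p}) U" for U
    unfolding lc_inductive_limit_def
    using locally_convex_seminorm that top
    by (intro topology_generated_by_Basis CollectI exI[of _ "seminorm_topology ?V {p}"]) simp
  note op = this
  show "f \<in> ?V \<Longrightarrow> openin (lc_inductive_limit I ?X) {g \<in> ?V. p (\<lambda>x. g x - f x) < ennreal \<epsilon>}"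
    by (intro op openin_seminorm_ball) auto
  have "?V \<subseteq> topspace (lc_inductive_limit I ?X)"
    using op[OF openin_topspace] by (intro openin_subset) simp
  moreover have "(\<Union>n\<in>I. topspace (?X n)) = ?V"
    using top by (rule SUP_cong[OF refl])
  ultimately show "topspace (lc_inductive_limit I ?X) = ?V"
    using topspace_lc_inductive_limit_subset[of I ?X] by (metis subset_antisym)
qed

text \<open>The open unit ball of \<open>p\<close> absorbs \<open>A\<close>, and the single scalar
  \<open>c = r\<close> gives the bound.\<close>

lemma tvs_bounded_seminorm_bound:
  assumes "tvs_bounded T A" "openin T {f \<in> V. p f < ennreal 1}" "(\<lambda>x. 0) \<in> V" "seminorm_on V p"
  shows "\<exists>r. \<forall>f\<in>A. p f \<le> ennreal r"
proof -
  have "p (\<lambda>x. 0) = 0"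
    using seminorm_onD(3)[OF assms(4,3), of 0] by simp
  then have "(\<lambda>x. 0) \<in> {f \<in> V. p f < ennreal 1}"
    using assms(3) by simp
  then obtain r where r: "r > 0" "\<And>c. cmod c \<ge> r \<Longrightarrow> A \<subseteq> (\<lambda>f x. c * f x) ` {f \<in> V. p f < ennreal 1}"
    using assms(1,2) unfolding tvs_bounded_def by meson
  have "p f \<le> ennreal r" if "f \<in> A" for f
  proof -
    have "cmod (complex_of_real r) \<ge> r" using r by simp
    from r(2)[OF this] that obtain g where g: "g \<in> V" "p g < ennreal 1" "f = (\<lambda>x. complex_of_real r * g x)"
      by blast
    then have "p f = ennreal r * p g"
      using r(1) seminorm_onD(3)[OF assms(4) g(1), of "complex_of_real r"] by simp
    also have "\<dots> \<le> ennreal r * 1"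
      using g(2) by (intro mult_left_mono) auto
    finally show ?thesis by simp
  qed
  then show ?thesis by blast
qed

section \<open>The weights in the norms\<close>

locale weight =
  fixes \<omega> :: "real \<Rightarrow> real"
  assumes weight: "nonquasianalytic_weight \<omega>"
begin

text \<open>The factor \<open>exp (- m * young_conj \<omega> (k / m))\<close> of both families of
  norms, as a real number. It is \<open>0\<close> when the conjugate is infinite, so divisions by it
  call for a case distinction.\<close>

definition wt :: "nat \<Rightarrow> nat \<Rightarrow> real" where
  "wt m k = enn2real (exp_ereal (- (ereal (real m) * young_conj \<omega> (real k / real m))))"

lemma omega_nonneg: "t \<ge> 0 \<Longrightarrow> \<omega> t \<ge> 0"
  and omega_zero: "0 \<le> t \<Longrightarrow> t \<le> 1 \<Longrightarrow> \<omega> t = 0"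
  and omega_mono: "0 \<le> s \<Longrightarrow> s \<le> t \<Longrightarrow> \<omega> s \<le> \<omega> t"
  and omega_doubling: "\<exists>K\<ge>1. \<forall>t\<ge>0. \<omega> (2 * t) \<le> K * (1 + \<omega> t)"
  and omega_log: "\<exists>a b. b > 0 \<and> (\<forall>t\<ge>0. \<omega> t \<ge> a + b * ln (1 + t))"
  and omega_convex: "convex_on UNIV (\<lambda>t. \<omega> (exp t))"
  using weight unfolding nonquasianalytic_weight_def mono_on_def by auto

lemma young_conj_nonneg: "young_conj \<omega> s \<ge> 0"
  unfolding young_conj_def
  by (rule SUP_upper2[of 0]) (auto simp: omega_zero)

lemma exp_ereal_young:
  assumes "m \<ge> 1"
  shows "exp_ereal (- (ereal (real m) * young_conj \<omega> (real k / real m))) = ennreal (wt m k)"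
proof -
  have "exp_ereal (- (ereal (real m) * young_conj \<omega> (real k / real m))) < top"
    using young_conj_nonneg[of "real k / real m"] assms
    by (cases "young_conj \<omega> (real k / real m)") (auto simp: exp_ereal_def)
  then show ?thesis unfolding wt_def by simp
qed

lemma exp_ereal_diff_young:
  assumes "m \<ge> 1"
  shows "exp_ereal (- ereal x - ereal (real m) * young_conj \<omega> (real k / real m)) = ennreal (exp (- x) * wt m k)"
proof (cases "young_conj \<omega> (real k / real m)")
  case (real y)
  then show ?thesis by (simp add: wt_def exp_ereal_def flip: exp_add)
next
  case PInf
  then show ?thesis using assms by (simp add: wt_def exp_ereal_def)
next
  case MInf
  then show ?thesis using young_conj_nonneg[of "real k / real m"] by simp
qed

lemma wt_nonneg [simp]: "wt m k \<ge> 0"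
  by (simp add: wt_def)

text \<open>Writing \<open>t = exp s\<close> in the supremum that defines the conjugate shows that
  \<open>wt m k\<close> is the infimum of \<open>exp (m * \<omega> t) / t ^ k\<close> over
  \<open>t \<ge> 1\<close>. The estimates of the weights below are read off from this
  description.\<close>

lemma le_wt_iff:
  assumes "m \<ge> 1" "c \<ge> 0"
  shows "c \<le> wt m k \<longleftrightarrow> (\<forall>t\<ge>1. c * t ^ k \<le> exp (real m * \<omega> t))"
proof (cases "c = 0")
  case False
  then have c: "c > 0" using assms by simp
  let ?Y = "young_conj \<omega> (real k / real m)"
  have m: "real m > 0" using assms by simp
  have "c \<le> wt m k \<longleftrightarrow> ?Y \<le> ereal (- ln c / real m)"
  proof (cases ?Y)
    case (real y)
    have "c \<le> exp (- (real m * y)) \<longleftrightarrow> ln c \<le> - (real m * y)"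
      using c by (metis exp_le_cancel_iff exp_ln)
    also have "\<dots> \<longleftrightarrow> y \<le> - ln c / real m"
      using pos_le_divide_eq[OF m, of y "- ln c"] by (auto simp: mult.commute)
    finally show ?thesis using real by (simp add: wt_def exp_ereal_def)
  next
    case PInf
    then show ?thesis using c assms by (simp add: wt_def exp_ereal_def)
  next
    case MInf
    then show ?thesis using young_conj_nonneg[of "real k / real m"] by simp
  qed
  also have "\<dots> \<longleftrightarrow> (\<forall>s\<ge>0. real k / real m * s - \<omega> (exp s) \<le> - ln c / real m)"
    unfolding young_conj_def SUP_le_iff by auto
  also have "\<dots> \<longleftrightarrow> (\<forall>s\<ge>0. c * exp s ^ k \<le> exp (real m * \<omega> (exp s)))"
  proof (intro all_cong1 imp_cong refl)
    fix s :: real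
    have "real k / real m * s - \<omega> (exp s) \<le> - ln c / real m \<longleftrightarrow> ln c + real k * s \<le> real m * \<omega> (exp s)"
      using mult_le_cancel_left_pos[OF m, of "real k / real m * s - \<omega> (exp s)" "- ln c / real m"] m
      by (auto simp: right_diff_distrib)
    also have "\<dots> \<longleftrightarrow> exp (ln c + real k * s) \<le> exp (real m * \<omega> (exp s))" by simp
    also have "exp (ln c + real k * s) = c * exp s ^ k"
      using c by (simp add: exp_add exp_of_nat_mult)
    finally show "(real k / real m * s - \<omega> (exp s) \<le> - ln c / real m) = (c * exp s ^ k \<le> exp (real m * \<omega> (exp s)))" .
  qed
  also have "\<dots> \<longleftrightarrow> (\<forall>t\<ge>1. c * t ^ k \<le> exp (real m * \<omega> t))"
  proof safe
    fix t :: real assume "t \<ge> 1" "\<forall>s\<ge>0. c * exp s ^ k \<le> exp (real m * \<omega> (exp s))"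
    then show "c * t ^ k \<le> exp (real m * \<omega> t)"
      using spec[of "\<lambda>s. s \<ge> 0 \<longrightarrow> c * exp s ^ k \<le> exp (real m * \<omega> (exp s))" "ln t"] by simp
  qed auto
  finally show ?thesis .
qed auto

lemma wt_pow_le:
  assumes "m \<ge> 1" "t \<ge> 1"
  shows "wt m k * t ^ k \<le> exp (real m * \<omega> t)"
  using le_wt_iff[OF assms(1) wt_nonneg, of m k k] assms by auto

lemma wt_le_1: "m \<ge> 1 \<Longrightarrow> wt m k \<le> 1"
  using wt_pow_le[of m 1 k] by (simp add: omega_zero)

lemma wt_0: "m \<ge> 1 \<Longrightarrow> wt m 0 = 1"
  using le_wt_iff[of m 1 0] wt_le_1[of m 0] omega_nonneg by (intro antisym) auto

lemma wt_pow_le':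
  assumes "m \<ge> 1" "t \<ge> 0"
  shows "wt m k * t ^ k \<le> exp (real m * \<omega> t)"
proof (cases "t \<ge> 1")
  case False
  then have "wt m k * t ^ k \<le> 1 * 1"
    using assms wt_le_1 by (intro mult_mono power_le_one) auto
  also have "\<dots> \<le> exp (real m * \<omega> t)" using assms omega_nonneg by simp
  finally show ?thesis .
qed (use assms wt_pow_le in auto)

text \<open>This is superadditivity of the conjugate, a convex function that vanishes at
  \<open>0\<close>. In terms of \<open>le_wt_iff\<close>: raise
  \<open>c * t ^ (j + k) \<le> exp (m * \<omega> t)\<close> to the power \<open>i / (j + k)\<close>;
  as the right-hand side is at least \<open>1\<close>, the corresponding power of \<open>c\<close>
  is at most \<open>wt m i\<close>.\<close>

lemma wt_superadditive:
  assumes "m \<ge> 1"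
  shows "wt m (j + k) \<le> wt m j * wt m k"
proof -
  define c where "c = wt m (j + k)"
  show ?thesis
  proof (cases "c = 0 \<or> j + k = 0")
    case True
    then show ?thesis using assms by (auto simp: c_def wt_0)
  next
    case False
    moreover have "c \<ge> 0" unfolding c_def by (rule wt_nonneg)
    ultimately have c: "c > 0" and jk: "real (j + k) > 0" by linarith+
    have *: "c powr (real i / real (j + k)) \<le> wt m i" if "i \<le> j + k" for i
    proof -
      define \<theta> where "\<theta> = real i / real (j + k)"
      have \<theta>: "0 \<le> \<theta>" "\<theta> \<le> 1" "real (j + k) * \<theta> = real i"
        using that jk by (auto simp: \<theta>_def)
      have "c powr \<theta> * t ^ i \<le> exp (real m * \<omega> t)" if t: "t \<ge> 1" for t
      proof -
        have "t ^ i = (t ^ (j + k)) powr \<theta>"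
          using t \<theta>(3) powr_realpow[of t "j + k"] powr_realpow[of t i]
          by (metis powr_powr zero_less_one order_less_le_trans)
        then have "c powr \<theta> * t ^ i = (c * t ^ (j + k)) powr \<theta>"
          using c t by (simp add: powr_mult)
        also have "\<dots> \<le> exp (real m * \<omega> t) powr \<theta>"
        proof (rule powr_mono2)
          show "c * t ^ (j + k) \<le> exp (real m * \<omega> t)"
            using wt_pow_le[OF assms t, of "j + k"] by (simp add: c_def)
          show "0 \<le> c * t ^ (j + k)" using c t by simp
        qed (fact \<theta>(1))
        also have "\<dots> \<le> exp (real m * \<omega> t) powr 1"
        proof (rule powr_mono)
          show "1 \<le> exp (real m * \<omega> t)" using omega_nonneg[of t] t by simp
        qed (fact \<theta>(2))
        finally show ?thesis by simp
      qed
      then show ?thesis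
        using le_wt_iff[OF assms, of "c powr \<theta>" i] by (simp add: \<theta>_def)
    qed
    have "c = c powr (real j / real (j + k)) * c powr (real k / real (j + k))"
      using c jk by (simp flip: powr_add add_divide_distrib)
    also have "\<dots> \<le> wt m j * wt m k"
      using *[of j] *[of k] by (intro mult_mono) auto
    finally show ?thesis by (simp add: c_def)
  qed
qed

lemma wt_square_le:
  assumes "m \<ge> 1"
  shows "wt m k ^ 2 \<le> wt (2 * m) (2 * k)"
proof (subst le_wt_iff, safe)
  fix t :: real assume t: "t \<ge> 1"
  have "(wt m k * t ^ k)\<^sup>2 \<le> exp (real m * \<omega> t) ^ 2"
    using wt_pow_le[OF assms t] t by (intro power_mono) auto
  then show "(wt m k)\<^sup>2 * t ^ (2 * k) \<le> exp (real (2 * m) * \<omega> t)"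
    by (simp add: power_mult_distrib power_mult mult.commute[of 2] mult.assoc flip: exp_double power_mult)
qed (use assms in auto)

text \<open>The interpolation inequality bounds the derivative of order \<open>a + k\<close> by the
  geometric mean of those of orders \<open>a\<close> and \<open>a + 2 * k\<close>. This is the
  matching inequality between the weights, with \<open>m\<close> doubled to pay for the
  square.\<close>

lemma wt_midpoint:
  assumes "m \<ge> 1"
  shows "wt m (a + k) ^ 2 \<le> wt (2 * m) a * wt (2 * m) (a + 2 * k)"
proof -
  have "wt m (a + k) ^ 2 \<le> wt (2 * m) (2 * (a + k))"
    by (rule wt_square_le[OF assms])
  also have "2 * (a + k) = a + (a + 2 * k)" by simp
  also have "wt (2 * m) (a + (a + 2 * k)) \<le> wt (2 * m) a * wt (2 * m) (a + 2 * k)"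
    using assms by (intro wt_superadditive) auto
  finally show ?thesis .
qed

text \<open>Iterate the doubling condition until \<open>2 ^ j\<close> exceeds \<open>C\<close>.
  \<open>L\<close> is a natural number so that it can be multiplied into the index
  \<open>m\<close>.\<close>

lemma omega_scale:
  assumes "C \<ge> 0"
  shows "\<exists>L\<ge>1::nat. \<forall>t\<ge>0. \<omega> (C * t) \<le> real L * (1 + \<omega> t)"
proof -
  obtain K where K: "K \<ge> 1" "\<And>t. t \<ge> 0 \<Longrightarrow> \<omega> (2 * t) \<le> K * (1 + \<omega> t)"
    using omega_doubling by blast
  have "\<exists>L\<ge>1. \<forall>t\<ge>0. \<omega> (2 ^ j * t) \<le> L * (1 + \<omega> t)" for j
  proof (induction j)
    case 0
    then show ?case by (intro exI[of _ 1]) auto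
  next
    case (Suc j)
    then obtain L where L: "L \<ge> 1" "\<And>t. t \<ge> 0 \<Longrightarrow> \<omega> (2 ^ j * t) \<le> L * (1 + \<omega> t)" by blast
    have "\<omega> (2 ^ Suc j * t) \<le> (2 * K * L) * (1 + \<omega> t)" if t: "t \<ge> 0" for t
    proof -
      have "\<omega> (2 ^ Suc j * t) \<le> K * (1 + \<omega> (2 ^ j * t))"
        using K(2)[of "2 ^ j * t"] t by (simp add: mult.assoc)
      also have "\<dots> \<le> K * (L * (1 + \<omega> t) + L * (1 + \<omega> t))"
      proof -
        have "1 * 1 \<le> L * (1 + \<omega> t)"
          using L(1) omega_nonneg[OF t] by (intro mult_mono) auto
        then show ?thesis using L(2)[OF t] K(1) by (intro mult_left_mono) auto
      qed
      finally show ?thesis by (simp add: algebra_simps)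
    qed
    moreover have "2 * K * L \<ge> 1"
      using K(1) L(1) mult_mono[of 1 K 1 L] by simp
    ultimately show ?case by blast
  qed
  moreover obtain j where "C < 2 ^ j" using real_arch_pow[of 2 C] by auto
  ultimately obtain L where L: "L \<ge> 1" "\<And>t. t \<ge> 0 \<Longrightarrow> \<omega> (2 ^ j * t) \<le> L * (1 + \<omega> t)" by blast
  have "\<omega> (C * t) \<le> real (nat \<lceil>L\<rceil>) * (1 + \<omega> t)" if t: "t \<ge> 0" for t
  proof -
    have "\<omega> (C * t) \<le> \<omega> (2 ^ j * t)"
      using \<open>C < 2 ^ j\<close> t assms by (intro omega_mono mult_right_mono) auto
    also have "\<dots> \<le> L * (1 + \<omega> t)" using L t by simp
    also have "\<dots> \<le> real (nat \<lceil>L\<rceil>) * (1 + \<omega> t)"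
      using omega_nonneg[OF t] by (intro mult_right_mono) (auto simp: real_nat_ceiling_ge)
    finally show ?thesis .
  qed
  then show ?thesis using L(1) by (intro exI[of _ "nat \<lceil>L\<rceil>"]) (auto simp: le_nat_iff)
qed

text \<open>Replacing \<open>t\<close> by \<open>C * t\<close> in \<open>wt_pow_le\<close> produces
  the factor \<open>C ^ k\<close>, and \<open>\<omega> (C * t) \<le> L * (1 + \<omega> t)\<close>
  gives \<open>m' = m * L\<close> with \<open>D = exp (m * L)\<close>. It is applied with
  \<open>C = 2\<close> for the Leibniz rule and \<open>C = 20736\<close> for the interpolation
  inequality.\<close>

lemma wt_geometric:
  assumes "m \<ge> 1" "C \<ge> 1"
  shows "\<exists>m'\<ge>1. \<exists>D>0. \<forall>k. C ^ k * wt m k \<le> D * wt m' k"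
proof -
  obtain L :: nat where L: "L \<ge> 1" "\<And>t. t \<ge> 0 \<Longrightarrow> \<omega> (C * t) \<le> real L * (1 + \<omega> t)"
    using omega_scale[of C] assms by force
  define D where "D = exp (real (m * L))"
  have "C ^ k * wt m k / D \<le> wt (m * L) k" for k
  proof (subst le_wt_iff, goal_cases)
    case 3
    show ?case
    proof safe
      fix t :: real assume t: "t \<ge> 1"
      have Ct: "C * t \<ge> 1" using assms t mult_mono[of 1 C 1 t] by simp
      have "wt m k * (C * t) ^ k \<le> exp (real m * \<omega> (C * t))"
        by (rule wt_pow_le[OF assms(1) Ct])
      also have "\<dots> \<le> exp (real m * (real L * (1 + \<omega> t)))"
        using L(2)[of t] t by (auto intro: mult_left_mono)
      also have "\<dots> = D * exp (real (m * L) * \<omega> t)"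
        by (simp add: D_def algebra_simps flip: exp_add)
      finally show "C ^ k * wt m k / D * t ^ k \<le> exp (real (m * L) * \<omega> t)"
        by (simp add: D_def field_simps power_mult_distrib)
    qed
  qed (use assms L(1) in \<open>auto simp: D_def\<close>)
  then have "\<forall>k. C ^ k * wt m k \<le> D * wt (m * L) k"
    by (simp add: D_def field_simps)
  moreover have "D > 0" "m * L \<ge> 1" using assms L by (auto simp: D_def)
  ultimately show ?thesis by blast
qed

text \<open>Settles the degenerate case in the arguments that divide by
  \<open>wt m' k\<close>.\<close>

lemma wt_eq_0_if_geometric:
  assumes "C ^ k * wt m k \<le> D * wt m' k" "C > 0" "wt m' k = 0"
  shows "wt m k = 0"
proof (rule ccontr)
  assume "wt m k \<noteq> 0"
  then have "wt m k > 0" using wt_nonneg[of m k] by linarith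
  then have "C ^ k * wt m k > 0" using assms(2) by simp
  then show False using assms by simp
qed

text \<open>The logarithmic lower bound on \<omega> gives \<open>exp (n * \<omega> t) \<ge> exp (n *
  a) * (1 + t) powr (n * b)\<close>, so any \<open>n \<ge> N / b\<close> works.\<close>

lemma poly_le_exp_omega: "\<exists>n\<ge>1. \<exists>C>0. \<forall>t\<ge>0. (1 + t) ^ N \<le> C * exp (real n * \<omega> t)"
proof -
  obtain a b where ab: "b > 0" "\<And>t. t \<ge> 0 \<Longrightarrow> \<omega> t \<ge> a + b * ln (1 + t)"
    using omega_log by blast
  define n where "n = nat \<lceil>real N / b\<rceil> + 1"
  have n: "real n * b \<ge> real N"
  proof -
    have "real N / b \<le> real n" unfolding n_def by linarith
    then show ?thesis using ab by (simp add: field_simps)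
  qed
  have "(1 + t) ^ N \<le> exp (- real n * a) * exp (real n * \<omega> t)" if t: "t \<ge> 0" for t
  proof -
    have "(1 + t) ^ N = exp (real N * ln (1 + t))"
      using t by (simp add: exp_of_nat_mult)
    also have "\<dots> \<le> exp (real n * b * ln (1 + t))"
      using n t by (auto intro: mult_right_mono)
    also have "\<dots> \<le> exp (real n * (\<omega> t - a))"
      using mult_left_mono[of "b * ln (1 + t)" "\<omega> t - a" "real n"] ab(2)[OF t] by (simp add: algebra_simps)
    also have "\<dots> = exp (- real n * a) * exp (real n * \<omega> t)"
      by (simp add: algebra_simps flip: exp_add)
    finally show ?thesis .
  qed
  then show ?thesis by (intro exI[of _ n] conjI exI[of _ "exp (- real n * a)"]) (auto simp: n_def)
qed

text \<open>With this the weighted norms control each single derivative: for a suitable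
  \<open>m\<close> the factor in front of it does not vanish.\<close>

lemma wt_pos: "\<exists>m\<ge>1. wt m k > 0"
proof -
  obtain n C where n: "n \<ge> 1" "C > 0" "\<And>t. t \<ge> 0 \<Longrightarrow> (1 + t) ^ k \<le> C * exp (real n * \<omega> t)"
    using poly_le_exp_omega[of k] by blast
  have "inverse C \<le> wt n k"
  proof (subst le_wt_iff, safe)
    fix t :: real assume t: "t \<ge> 1"
    have "t ^ k \<le> (1 + t) ^ k" using t by (intro power_mono) auto
    also have "\<dots> \<le> C * exp (real n * \<omega> t)" using n t by simp
    finally show "inverse C * t ^ k \<le> exp (real n * \<omega> t)" using n by (simp add: field_simps)
  qed (use n in auto)
  then show ?thesis using n by (meson inverse_positive_iff_positive less_le_trans)
qed

text \<open>A converse of \<open>le_wt_iff\<close>: \<omega> is recovered from its conjugate up to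
  one power of \<open>t\<close>. The convex function \<open>u \<mapsto> \<omega> (exp u)\<close> has
  a supporting line of slope \<open>s\<close> at \<open>ln t\<close>. The ideal order would be
  \<open>m * s\<close>, and rounding it down to an integer \<open>k\<close> costs the factor
  \<open>t\<close>.\<close>

lemma exp_omega_le_wt:
  assumes "m \<ge> 1" "t \<ge> 1"
  shows "\<exists>k. exp (real m * \<omega> t) \<le> wt m k * t ^ (k + 1)"
proof -
  \<comment> \<open>The right-hand derivative at \<open>ln t\<close>, in the form that
    \<open>convex_le_Inf_differential\<close> uses; it is nonnegative because \<omega> is
    increasing.\<close>
  define s where "s = Inf ((\<lambda>u. (\<omega> (exp (ln t)) - \<omega> (exp u)) / (ln t - u)) ` ({ln t<..} \<inter> UNIV))"
  have supp: "\<omega> u \<ge> \<omega> t + s * (ln u - ln t)" if "u > 0" for u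
    using convex_le_Inf_differential[OF omega_convex, of "ln t" "ln u"] assms that
    by (simp add: s_def)
  have s: "s \<ge> 0"
  proof -
    have "{ln t<..} \<noteq> {}" by (metis empty_iff greaterThan_iff less_add_one)
    then show ?thesis
      unfolding s_def
    proof (intro cINF_greatest)
      fix u assume "u \<in> {ln t<..} \<inter> (UNIV :: real set)"
      then have u: "ln t < u" by simp
      then have "\<omega> (exp (ln t)) \<le> \<omega> (exp u)" by (intro omega_mono) auto
      then show "0 \<le> (\<omega> (exp (ln t)) - \<omega> (exp u)) / (ln t - u)"
        using u by (intro divide_nonpos_neg) auto
    qed auto
  qed
  define k where "k = nat \<lfloor>real m * s\<rfloor>"
  have k: "real k \<le> real m * s" "real m * s \<le> real k + 1"
  proof -
    have "real k = of_int \<lfloor>real m * s\<rfloor>"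
      using s by (simp add: k_def)
    then show "real k \<le> real m * s" "real m * s \<le> real k + 1" by linarith+
  qed
  have "exp (real m * \<omega> t) / t ^ (k + 1) \<le> wt m k"
  proof (subst le_wt_iff[OF assms(1)], goal_cases)
    case 2
    show ?case
    proof safe
      fix u :: real assume u: "u \<ge> 1"
      have lnu: "ln u \<ge> 0" and lnt: "ln t \<ge> 0" using u assms by auto
      have "real k * ln u - (real k + 1) * ln t \<le> real m * s * ln u - real m * s * ln t"
        using mult_right_mono[OF k(1) lnu] mult_right_mono[OF k(2) lnt] by linarith
      moreover have "real m * (\<omega> t + s * (ln u - ln t)) \<le> real m * \<omega> u"
        using supp[of u] u by (intro mult_left_mono) auto
      ultimately have "real m * \<omega> t - (real k + 1) * ln t + real k * ln u \<le> real m * \<omega> u"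
        by (simp add: algebra_simps)
      then have "exp (real m * \<omega> t - (real k + 1) * ln t + real k * ln u) \<le> exp (real m * \<omega> u)"
        by simp
      also have "exp (real m * \<omega> t - (real k + 1) * ln t + real k * ln u) = exp (real m * \<omega> t) / exp (real (k + 1) * ln t) * exp (real k * ln u)"
        by (simp add: exp_add exp_diff)
      also have "\<dots> = exp (real m * \<omega> t) / t ^ (k + 1) * u ^ k"
        using u assms unfolding exp_of_nat_mult by simp
      finally show "exp (real m * \<omega> t) / t ^ (k + 1) * u ^ k \<le> exp (real m * \<omega> u)" .
    qed
  qed (use assms in auto)
  then show ?thesis using assms by (intro exI[of _ k]) (simp add: field_simps)
qed

text \<open>The surplus power of \<open>t\<close> is cancelled against
  \<open>t \<le> C * exp (n * \<omega> t)\<close>, hence \<open>m = l + n\<close>.\<close>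

lemma exp_omega_le_wt_pow:
  "\<exists>m\<ge>1. \<exists>C>0. \<forall>t\<ge>1. \<exists>k. exp (real l * \<omega> t) \<le> C * wt m k * t ^ k"
proof -
  obtain n C where n: "n \<ge> 1" "C > 0" "\<And>t. t \<ge> 0 \<Longrightarrow> (1 + t) ^ 1 \<le> C * exp (real n * \<omega> t)"
    using poly_le_exp_omega[of 1] by blast
  have "\<exists>k. exp (real l * \<omega> t) \<le> C * wt (l + n) k * t ^ k" if t: "t \<ge> 1" for t
  proof -
    obtain k where k: "exp (real (l + n) * \<omega> t) \<le> wt (l + n) k * t ^ (k + 1)"
      using exp_omega_le_wt[of "l + n" t] n t by auto
    have "exp (real l * \<omega> t) * t \<le> exp (real l * \<omega> t) * (C * exp (real n * \<omega> t))"
      using n(3)[of t] t by (intro mult_left_mono) auto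
    also have "\<dots> = C * exp (real (l + n) * \<omega> t)"
      by (simp add: algebra_simps flip: exp_add)
    also have "\<dots> \<le> C * (wt (l + n) k * t ^ (k + 1))"
      using k n by (intro mult_left_mono) auto
    finally show ?thesis using t by (intro exI[of _ k]) (simp add: mult.assoc)
  qed
  then show ?thesis using n by (intro exI[of _ "l + n"] conjI exI[of _ C]) auto
qed

end

section \<open>Iterated partial derivatives\<close>

text \<open>\<open>partial_deriv\<close> has a value whether or not the derivative exists. The
  relation records existence and value together, which is what the differentiation rules
  deliver.\<close>

definition has_pd :: "'n::finite \<Rightarrow> (real^'n \<Rightarrow> complex) \<Rightarrow> (real^'n \<Rightarrow> complex) \<Rightarrow> bool" where
  "has_pd i f f' \<longleftrightarrow> (\<forall>x. ((\<lambda>t. f (x + t *\<^sub>R axis i 1)) has_vector_derivative f' x) (at 0))"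

lemma has_pd_iff: "has_pd i f f' \<longleftrightarrow> has_partial_deriv i f \<and> partial_deriv i f = f'"
  unfolding has_pd_def has_partial_deriv_def partial_deriv_def fun_eq_iff
  by (metis differentiableI_vector vector_derivative_at vector_derivative_works)

text \<open>Moves the base point from \<open>0\<close> to any \<open>s\<close> and allows a reversed
  direction: \<open>\<sigma> = 1\<close> serves for translations, \<open>\<sigma> = - 1\<close> for
  half-lines pointing in a negative direction.\<close>

lemma has_pd_along:
  assumes "has_pd i f f'"
  shows "((\<lambda>t. f (x + (\<sigma> * t) *\<^sub>R axis i 1)) has_vector_derivative \<sigma> *\<^sub>R f' (x + (\<sigma> * s) *\<^sub>R axis i 1)) (at s)"
proof -
  have 1: "((\<lambda>t. \<sigma> * (t - s)) has_vector_derivative \<sigma>) (at s)"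
    by (auto intro!: derivative_eq_intros simp: has_real_derivative_iff_has_vector_derivative[symmetric])
  have 2: "((\<lambda>t. f ((x + (\<sigma> * s) *\<^sub>R axis i 1) + t *\<^sub>R axis i 1)) has_vector_derivative f' (x + (\<sigma> * s) *\<^sub>R axis i 1)) (at (\<sigma> * (s - s)))"
    using assms unfolding has_pd_def by simp
  have "((\<lambda>t. f ((x + (\<sigma> * s) *\<^sub>R axis i 1) + t *\<^sub>R axis i 1)) \<circ> (\<lambda>t. \<sigma> * (t - s)) has_vector_derivative \<sigma> *\<^sub>R f' (x + (\<sigma> * s) *\<^sub>R axis i 1)) (at s)"
    by (rule vector_diff_chain_at[OF 1 2])
  then show ?thesis
    by (simp add: o_def add.assoc algebra_simps flip: scaleR_add_left)
qed

lemma has_pd_const: "has_pd i (\<lambda>x. c) (\<lambda>x. 0)"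
  unfolding has_pd_def by simp

lemma has_pd_coord: "has_pd i (\<lambda>x. complex_of_real (x $ j)) (\<lambda>x. if i = j then 1 else 0)"
  unfolding has_pd_def
proof
  fix x :: "real^'a"
  have "((\<lambda>t. complex_of_real (x $ j + t * axis i 1 $ j)) has_vector_derivative complex_of_real (axis i 1 $ j)) (at 0)"
    by (intro has_vector_derivative_of_real) (auto intro!: derivative_eq_intros)
  then show "((\<lambda>t. complex_of_real ((x + t *\<^sub>R axis i 1) $ j)) has_vector_derivative (if i = j then 1 else 0)) (at 0)"
    by (cases "i = j") (simp_all add: axis_def)
qed

lemma has_pd_add: "has_pd i f f' \<Longrightarrow> has_pd i g g' \<Longrightarrow> has_pd i (\<lambda>x. f x + g x) (\<lambda>x. f' x + g' x)"
  unfolding has_pd_def by (auto intro: has_vector_derivative_add)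

lemma has_pd_mult:
  assumes "has_pd i f f'" "has_pd i g g'"
  shows "has_pd i (\<lambda>x. f x * g x) (\<lambda>x. f' x * g x + f x * g' x)"
  unfolding has_pd_def
proof
  fix x
  show "((\<lambda>t. f (x + t *\<^sub>R axis i 1) * g (x + t *\<^sub>R axis i 1)) has_vector_derivative f' x * g x + f x * g' x) (at 0)"
    using has_vector_derivative_mult[of "\<lambda>t. f (x + t *\<^sub>R axis i 1)" "f' x" 0 UNIV "\<lambda>t. g (x + t *\<^sub>R axis i 1)" "g' x"] assms
    unfolding has_pd_def by (simp add: add.commute)
qed

lemma Ck_continuous: "Ck k f \<Longrightarrow> continuous_on UNIV f"
  by (cases k) auto

lemma Ck_SucD: "Ck (Suc k) f \<Longrightarrow> Ck k f"
  by (induction k arbitrary: f) auto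

lemma Ck_Suc_iff: "Ck (Suc k) f \<longleftrightarrow> continuous_on UNIV f \<and> (\<forall>i. \<exists>f'. has_pd i f f' \<and> Ck k f')"
  by (auto simp: has_pd_iff)

lemma Ck_add: "Ck k f \<Longrightarrow> Ck k g \<Longrightarrow> Ck k (\<lambda>x. f x + g x)"
proof (induction k arbitrary: f g)
  case (Suc k)
  then show ?case
    unfolding Ck_Suc_iff by (blast intro: continuous_on_add has_pd_add)
qed (auto intro: continuous_intros)

lemma Ck_mult: "Ck k f \<Longrightarrow> Ck k g \<Longrightarrow> Ck k (\<lambda>x. f x * g x)"
proof (induction k arbitrary: f g)
  case (Suc k)
  have "\<exists>h. has_pd i (\<lambda>x. f x * g x) h \<and> Ck k h" for i
  proof -
    obtain f' g' where "has_pd i f f'" "Ck k f'" "has_pd i g g'" "Ck k g'"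
      using Suc.prems unfolding Ck_Suc_iff by blast
    moreover have "Ck k f" "Ck k g"
      using Suc.prems by (blast dest: Ck_SucD)+
    ultimately have "Ck k (\<lambda>x. f' x * g x + f x * g' x)"
      by (intro Ck_add Suc.IH)
    then show ?thesis
      using has_pd_mult[OF \<open>has_pd i f f'\<close> \<open>has_pd i g g'\<close>] by blast
  qed
  then show ?case
    using Suc.prems unfolding Ck_Suc_iff by (auto intro: continuous_intros)
qed (auto intro: continuous_intros)

lemma smooth_continuous: "smooth f \<Longrightarrow> continuous_on UNIV f"
  using Ck_continuous unfolding smooth_def by blast

lemma smooth_has_pd: "smooth f \<Longrightarrow> has_pd i f (partial_deriv i f)"
  unfolding smooth_def has_pd_iff by (metis Ck.simps(2))

lemma smooth_partial_deriv: "smooth f \<Longrightarrow> smooth (partial_deriv i f)"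
  unfolding smooth_def by (metis Ck.simps(2))

text \<open>\<open>smooth\<close> describes the largest class of continuous functions whose partial
  derivatives exist and stay in the class, so any such class containing \<open>f\<close> is enough.
  Fourier transforms of rapidly decreasing functions form one.\<close>

lemma smooth_coinduct:
  assumes "X f" and "\<And>f. X f \<Longrightarrow> continuous_on UNIV f"
    and "\<And>f i. X f \<Longrightarrow> \<exists>f'. has_pd i f f' \<and> X f'"
  shows "smooth f"
proof -
  have "Ck k f" if "X f" for k f
    using that
  proof (induction k arbitrary: f)
    case (Suc k)
    then show ?case unfolding Ck_Suc_iff using assms(2,3) by meson
  qed (use assms in auto)
  then show ?thesis unfolding smooth_def using assms(1) by blast
qed

lemma smooth_add: "smooth f \<Longrightarrow> smooth g \<Longrightarrow> smooth (\<lambda>x. f x + g x)"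
  unfolding smooth_def by (blast intro: Ck_add)

lemma smooth_mult: "smooth f \<Longrightarrow> smooth g \<Longrightarrow> smooth (\<lambda>x. f x * g x)"
  unfolding smooth_def by (blast intro: Ck_mult)

lemma smooth_const: "smooth (\<lambda>x. c)"
proof (rule smooth_coinduct[where X = "\<lambda>f. \<exists>c. f = (\<lambda>x. c)"])
  show "\<exists>f'. has_pd i f f' \<and> (\<exists>c. f' = (\<lambda>x. c))" if "\<exists>c. f = (\<lambda>x. c)" for f :: "real^'a \<Rightarrow> complex" and i
    using that has_pd_const by blast
qed auto

lemma smooth_coord: "smooth (\<lambda>x. complex_of_real (x $ j))"
proof (rule smooth_coinduct[where X = "\<lambda>f. f = (\<lambda>x. complex_of_real (x $ j)) \<or> (\<exists>c. f = (\<lambda>x. c))"])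
  show "\<exists>f'. has_pd i f f' \<and> (f' = (\<lambda>x. complex_of_real (x $ j)) \<or> (\<exists>c. f' = (\<lambda>x. c)))"
    if "f = (\<lambda>x. complex_of_real (x $ j)) \<or> (\<exists>c. f = (\<lambda>x. c))" for f :: "real^'a \<Rightarrow> complex" and i
    using that has_pd_const has_pd_coord by blast
qed (auto intro!: continuous_intros)

lemma smooth_cmult: "smooth f \<Longrightarrow> smooth (\<lambda>x. c * f x)"
  by (intro smooth_mult smooth_const)

lemma partial_deriv_add:
  "smooth f \<Longrightarrow> smooth g \<Longrightarrow> partial_deriv i (\<lambda>x. f x + g x) = (\<lambda>x. partial_deriv i f x + partial_deriv i g x)"
  using has_pd_add[OF smooth_has_pd smooth_has_pd] unfolding has_pd_iff by blast

lemma partial_deriv_mult: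
  "smooth f \<Longrightarrow> smooth g \<Longrightarrow> partial_deriv i (\<lambda>x. f x * g x) = (\<lambda>x. partial_deriv i f x * g x + f x * partial_deriv i g x)"
  using has_pd_mult[OF smooth_has_pd smooth_has_pd] unfolding has_pd_iff by blast

lemma partial_deriv_cmult:
  "smooth f \<Longrightarrow> partial_deriv i (\<lambda>x. c * f x) = (\<lambda>x. c * partial_deriv i f x)"
  using has_pd_mult[OF has_pd_const smooth_has_pd] unfolding has_pd_iff by force

text \<open>Derivatives indexed by words of coordinates, the last letter being applied first. The
  order is part of the data, so that partial derivatives are never commuted.\<close>

definition Dw :: "'n::finite list \<Rightarrow> (real^'n \<Rightarrow> complex) \<Rightarrow> real^'n \<Rightarrow> complex" where
  "Dw w f = foldr partial_deriv w f"

lemma Dw_Nil [simp]: "Dw [] f = f"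
  and Dw_Cons: "Dw (i # w) f = partial_deriv i (Dw w f)"
  and Dw_append: "Dw (u @ w) f = Dw u (Dw w f)"
  by (simp_all add: Dw_def)

lemma Dw_replicate: "Dw (replicate n i) f = (partial_deriv i ^^ n) f"
  by (induction n) (auto simp: Dw_Cons)

lemma smooth_Dw: "smooth f \<Longrightarrow> smooth (Dw w f)"
  by (induction w) (auto simp: Dw_Cons smooth_partial_deriv)

lemma Dw_add: "smooth f \<Longrightarrow> smooth g \<Longrightarrow> Dw w (\<lambda>x. f x + g x) = (\<lambda>x. Dw w f x + Dw w g x)"
  by (induction w) (auto simp: Dw_Cons partial_deriv_add smooth_Dw)

lemma Dw_cmult: "smooth f \<Longrightarrow> Dw w (\<lambda>x. c * f x) = (\<lambda>x. c * Dw w f x)"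
  by (induction w) (auto simp: Dw_Cons partial_deriv_cmult smooth_Dw)

text \<open>The Leibniz rule expands the left-hand side into \<open>2 ^ length w\<close> products.\<close>

lemma norm_Dw_mult_le:
  assumes "smooth f" "smooth g"
    and "\<And>u v. subseq u w \<Longrightarrow> subseq v w \<Longrightarrow> length u + length v = length w \<Longrightarrow>
      cmod (Dw u f x) * cmod (Dw v g x) \<le> B"
  shows "cmod (Dw w (\<lambda>x. f x * g x) x) \<le> 2 ^ length w * B"
  using assms
\<comment> \<open>Peeling off the last letter means differentiating the product itself first: both
  resulting products have smooth factors, and a subword of \<open>w\<close> extended by
  \<open>i\<close> is a subword of \<open>w @ [i]\<close>.\<close>
proof (induction w arbitrary: f g rule: rev_induct)
  case Nil
  show ?case using Nil(3)[of "[]" "[]"] by (simp add: norm_mult)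
next
  case (snoc i w)
  have "cmod (Dw w (\<lambda>x. partial_deriv i f x * g x) x) \<le> 2 ^ length w * B"
  proof (rule snoc.IH)
    fix u v assume "subseq u w" "subseq v w" "length u + length v = length w"
    then show "cmod (Dw u (partial_deriv i f) x) * cmod (Dw v g x) \<le> B"
      using snoc.prems(3)[of "u @ [i]" v] by (simp add: Dw_append Dw_Cons subseq_rev_drop_many)
  qed (use snoc.prems smooth_partial_deriv in auto)
  moreover have "cmod (Dw w (\<lambda>x. f x * partial_deriv i g x) x) \<le> 2 ^ length w * B"
  proof (rule snoc.IH)
    fix u v assume "subseq u w" "subseq v w" "length u + length v = length w"
    then show "cmod (Dw u f x) * cmod (Dw v (partial_deriv i g) x) \<le> B"
      using snoc.prems(3)[of u "v @ [i]"] by (simp add: Dw_append Dw_Cons subseq_rev_drop_many)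
  qed (use snoc.prems smooth_partial_deriv in auto)
  moreover have "Dw (w @ [i]) (\<lambda>x. f x * g x) x =
      Dw w (\<lambda>x. partial_deriv i f x * g x) x + Dw w (\<lambda>x. f x * partial_deriv i g x) x"
    using snoc.prems by (simp add: Dw_append Dw_Cons partial_deriv_mult Dw_add smooth_mult smooth_partial_deriv)
  ultimately show ?case
    using norm_triangle_ineq[of "Dw w (\<lambda>x. partial_deriv i f x * g x) x" "Dw w (\<lambda>x. f x * partial_deriv i g x) x"]
    by simp
qed

lemma norm_Dw_coord_le: "cmod (Dw w (\<lambda>x. complex_of_real (x $ j)) x) \<le> 1 + norm x"
proof -
  have "Dw w (\<lambda>x. complex_of_real (x $ j)) \<in> {\<lambda>x. complex_of_real (x $ j), \<lambda>x. 1, \<lambda>x. 0}"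
  proof (induction w)
    case (Cons i w)
    moreover have "partial_deriv i (\<lambda>x. complex_of_real (x $ j)) = (\<lambda>x. if i = j then 1 else 0)"
      using has_pd_coord[of i j] by (simp add: has_pd_iff)
    moreover have "partial_deriv i (\<lambda>x. c) = (\<lambda>x. 0)" for c
      using has_pd_const[of i c] by (simp add: has_pd_iff)
    ultimately show ?case by (auto simp: Dw_Cons)
  qed simp
  moreover have "cmod (complex_of_real (x $ j)) \<le> 1 + norm x"
    using component_le_norm_cart[of x j] by simp
  ultimately show ?thesis by auto
qed

section \<open>Multi-indices as words\<close>

definition word :: "('n \<Rightarrow> nat) \<Rightarrow> 'n list \<Rightarrow> 'n list" where
  "word \<alpha> is = concat (map (\<lambda>i. replicate (\<alpha> i) i) is)"

lemma word_Nil [simp]: "word \<alpha> [] = []"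
  and word_Cons: "word \<alpha> (i # is) = replicate (\<alpha> i) i @ word \<alpha> is"
  by (simp_all add: word_def)

lemma coordinates: "set (coordinates :: 'n::finite list) = UNIV" "distinct (coordinates :: 'n list)"
  using someI_ex[OF finite_distinct_list[of "UNIV :: 'n set"]] unfolding coordinates_def by simp_all

lemma mderiv_eq_Dw: "mderiv \<alpha> f = Dw (word \<alpha> coordinates) f"
proof -
  have "foldr (\<lambda>i. partial_deriv i ^^ \<alpha> i) is f = Dw (word \<alpha> is) f" for "is"
    by (induction "is") (auto simp: word_Cons Dw_append Dw_replicate)
  then show ?thesis by (simp add: mderiv_def)
qed

lemma mlength_eq_length: "mlength \<alpha> = length (word \<alpha> coordinates)"
proof -
  have "length (word \<alpha> is) = sum_list (map \<alpha> is)" for "is"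
    by (induction "is") (auto simp: word_Cons)
  then show ?thesis
    using coordinates by (metis mlength_def sum_list_distinct_conv_sum_set)
qed

lemma word_cong: "(\<And>i. i \<in> set is \<Longrightarrow> \<alpha> i = \<beta> i) \<Longrightarrow> word \<alpha> is = word \<beta> is"
  by (induction "is") (auto simp: word_Cons)

text \<open>Deleting letters from a word made of blocks, one for each entry of \<open>is\<close>,
  only shortens the blocks. Hence the factors in the Leibniz terms of an \<open>mderiv\<close> are
  again of the form \<open>mderiv\<close> and are controlled by the norms.\<close>

lemma subseq_word:
  assumes "distinct is" "subseq u (word \<alpha> is)"
  obtains \<beta> where "u = word \<beta> is"
  using assms
proof (induction "is" arbitrary: u thesis)
  case (Cons i "is")
  from Cons.prems(3) obtain u1 u2 where u: "u = u1 @ u2" "subseq u1 (replicate (\<alpha> i) i)" "subseq u2 (word \<alpha> is)"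
    unfolding word_Cons by (rule subseq_appendE)
  obtain \<beta> where \<beta>: "u2 = word \<beta> is"
    using Cons.IH[OF _ _ u(3)] Cons.prems(2) by auto
  have "set u1 \<subseteq> {i}"
  proof
    fix x assume "x \<in> set u1"
    from list_emb_set[OF u(2) this] obtain y where "y \<in> set (replicate (\<alpha> i) i)" "x = y"
      by metis
    then show "x \<in> {i}" by simp
  qed
  then have "u1 = replicate (length u1) i"
    by (intro replicate_eqI) auto
  moreover have "word (\<beta>(i := length u1)) is = word \<beta> is"
    using Cons.prems(2) by (intro word_cong) auto
  ultimately have "u = word (\<beta>(i := length u1)) (i # is)"
    using u \<beta> by (simp add: word_Cons)
  then show ?case by (rule Cons.prems(1))
qed simp

lemma word_single:
  "i \<in> set is \<Longrightarrow> distinct is \<Longrightarrow> word (\<lambda>j. if j = i then k else 0) is = replicate k i"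
proof (induction "is")
  case (Cons a "is")
  moreover have "word (\<lambda>j. if j = i then k else 0) is = []" if "i \<notin> set is"
    using that by (induction "is") (auto simp: word_Cons)
  ultimately show ?case by (auto simp: word_Cons)
qed simp

section \<open>The Fourier transform of rapidly decreasing functions\<close>

text \<open>Since \<open>1 + (x \<bullet> b)\<^sup>2 \<le> (1 + norm x)\<^sup>2\<close> for every
  basis vector \<open>b\<close>, the function is dominated by a product of one-dimensional functions
  \<open>1 / (1 + t\<^sup>2)\<close>. The exponent counts two for each coordinate.\<close>

lemma integrable_inverse_polynomial:
  "integrable lborel (\<lambda>x::'a::euclidean_space. inverse ((1 + norm x) ^ (2 * DIM('a))))"
proof (rule integrableI_bounded)
  have fin: "(\<integral>\<^sup>+t. ennreal (inverse (1 + t\<^sup>2)) \<partial>lborel) < \<infinity>"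
    using integrable_inverse_1_plus_square
    by (simp add: set_integrable_def integrable_iff_bounded add_nonneg_nonneg)
  have "(\<integral>\<^sup>+x. ennreal (norm (inverse ((1 + norm (x::'a)) ^ (2 * DIM('a))))) \<partial>lborel)
      \<le> (\<integral>\<^sup>+x. (\<Prod>b\<in>(Basis::'a set). ennreal (inverse (1 + (x \<bullet> b)\<^sup>2))) \<partial>lborel)"
  proof (rule nn_integral_mono)
    fix x :: 'a
    have "(\<Prod>b\<in>(Basis::'a set). 1 + (x \<bullet> b)\<^sup>2) \<le> (\<Prod>b\<in>(Basis::'a set). (1 + norm x)\<^sup>2)"
    proof (rule prod_mono, safe)
      fix b :: 'a assume "b \<in> Basis"
      then have "(x \<bullet> b)\<^sup>2 \<le> (norm x)\<^sup>2"
        by (metis Basis_le_norm abs_le_square_iff abs_norm_cancel)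
      also have "1 + (norm x)\<^sup>2 \<le> (1 + norm x)\<^sup>2" by (simp add: power2_sum)
      finally show "1 + (x \<bullet> b)\<^sup>2 \<le> (1 + norm x)\<^sup>2" by simp
    qed (simp add: add_nonneg_nonneg)
    also have "\<dots> = (1 + norm x) ^ (2 * DIM('a))" by (simp flip: power_mult)
    finally have "inverse ((1 + norm x) ^ (2 * DIM('a))) \<le> inverse (\<Prod>b\<in>(Basis::'a set). 1 + (x \<bullet> b)\<^sup>2)"
      by (intro le_imp_inverse_le prod_pos) (auto intro: add_pos_nonneg)
    also have "\<dots> = (\<Prod>b\<in>(Basis::'a set). inverse (1 + (x \<bullet> b)\<^sup>2))"
      using prod_inversef[of "\<lambda>b. 1 + (x \<bullet> b)\<^sup>2" "Basis :: 'a set"] by (simp add: o_def)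
    finally show "ennreal (norm (inverse ((1 + norm x) ^ (2 * DIM('a))))) \<le> (\<Prod>b\<in>Basis. ennreal (inverse (1 + (x \<bullet> b)\<^sup>2)))"
      by (subst prod_ennreal) (auto intro!: ennreal_leI simp: add_nonneg_nonneg)
  qed
  also have "\<dots> = (\<Prod>b\<in>(Basis::'a set). \<integral>\<^sup>+t. ennreal (inverse (1 + t\<^sup>2)) \<partial>lborel)"
    by (rule nn_integral_lborel_prod) auto
  also have "\<dots> < \<infinity>"
    using fin by (simp add: power_less_top_ennreal)
  finally show "(\<integral>\<^sup>+x. ennreal (norm (inverse ((1 + norm (x::'a)) ^ (2 * DIM('a))))) \<partial>lborel) < \<infinity>" .
qed simp

abbreviation inv_poly :: "'a::euclidean_space \<Rightarrow> real" where
  "inv_poly x \<equiv> inverse ((1 + norm x) ^ (2 * DIM('a)))"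

text \<open>Decay is imposed on \<open>g\<close> alone and not on derivatives. The class is thus
  stable under multiplication by continuous functions of polynomial growth, in particular by
  characters and monomials.\<close>

definition rapid :: "('a::euclidean_space \<Rightarrow> complex) \<Rightarrow> bool" where
  "rapid g \<longleftrightarrow> continuous_on UNIV g \<and> (\<forall>k. \<exists>C. \<forall>x. (1 + norm x) ^ k * cmod (g x) \<le> C)"

lemma rapid_continuous: "rapid g \<Longrightarrow> continuous_on UNIV g"
  by (simp add: rapid_def)

lemma rapid_bound:
  assumes "rapid g"
  obtains C where "C > 0" "\<And>x. (1 + norm x) ^ k * cmod (g x) \<le> C"
proof -
  obtain C where "\<And>x. (1 + norm x) ^ k * cmod (g x) \<le> C"
    using assms unfolding rapid_def by blast
  then have "(1 + norm x) ^ k * cmod (g x) \<le> \<bar>C\<bar> + 1" for x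
    by (smt (verit))
  then show ?thesis by (rule that[rotated]) simp
qed

lemma rapid_bounded:
  assumes "rapid g"
  obtains C where "C > 0" "\<And>x. cmod (g x) \<le> C"
proof -
  obtain C where "C > 0" "\<And>x. (1 + norm x) ^ 0 * cmod (g x) \<le> C"
    using rapid_bound[OF assms] by blast
  then show ?thesis using that by simp
qed

lemma rapid_measurable: "rapid g \<Longrightarrow> g \<in> borel_measurable borel"
  by (simp add: rapid_def borel_measurable_continuous_onI)

lemma rapid_le_inverse_polynomial:
  assumes "rapid g"
  obtains C where "C > 0" "\<And>x. cmod (g x) \<le> C * inverse ((1 + norm x) ^ k)"
proof -
  obtain C where C: "C > 0" "\<And>x. (1 + norm x) ^ k * cmod (g x) \<le> C"
    using rapid_bound[OF assms] by blast
  have "cmod (g x) \<le> C * inverse ((1 + norm x) ^ k)" for x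
  proof -
    have "(1 + norm x) ^ k > 0" by (simp add: add_pos_nonneg)
    then show ?thesis using C(2)[of x] by (simp add: field_simps)
  qed
  then show ?thesis using C(1) that by blast
qed

lemma rapid_integrable:
  fixes g :: "'a::euclidean_space \<Rightarrow> complex"
  assumes "rapid g"
  shows "integrable lborel g"
proof -
  obtain C where C: "C > 0" "\<And>x. cmod (g x) \<le> C * inv_poly x"
    using rapid_le_inverse_polynomial[OF assms] by blast
  show ?thesis
  proof (rule Bochner_Integration.integrable_bound)
    show "integrable lborel (\<lambda>x::'a. C * inv_poly x)"
      by (intro integrable_mult_right integrable_inverse_polynomial)
    show "g \<in> borel_measurable lborel" using rapid_measurable[OF assms] by simp
    show "AE x in lborel. cmod (g x) \<le> norm (C * inv_poly x)"
      using C by (auto intro!: AE_I2 simp: abs_mult)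
  qed
qed

lemma rapid_mult_bounded:
  assumes "rapid g" "continuous_on UNIV p" "\<And>x. cmod (p x) \<le> c * (1 + norm x) ^ j"
  shows "rapid (\<lambda>x. p x * g x)"
  unfolding rapid_def
proof (intro conjI allI)
  show "continuous_on UNIV (\<lambda>x. p x * g x)"
    using assms by (auto intro!: continuous_intros simp: rapid_def)
  fix k
  obtain C where C: "C > 0" "\<And>x. (1 + norm x) ^ (k + j) * cmod (g x) \<le> C"
    using rapid_bound[OF assms(1)] by blast
  have c: "c \<ge> 0" using order_trans[OF norm_ge_zero assms(3)[of 0]] by simp
  have "(1 + norm x) ^ k * cmod (p x * g x) \<le> c * C" for x
  proof -
    have "(1 + norm x) ^ k * cmod (p x * g x) \<le> (1 + norm x) ^ k * ((c * (1 + norm x) ^ j) * cmod (g x))"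
      unfolding norm_mult by (intro mult_left_mono mult_right_mono assms(3)) auto
    also have "\<dots> = c * ((1 + norm x) ^ (k + j) * cmod (g x))" by (simp add: power_add)
    also have "\<dots> \<le> c * C" using C c by (intro mult_left_mono) auto
    finally show ?thesis .
  qed
  then show "\<exists>C. \<forall>x. (1 + norm x) ^ k * cmod (p x * g x) \<le> C" by blast
qed

text \<open>Dominated convergence along an arbitrary sequence tending to \<open>0\<close>: the mean
  value inequality turns the bound on \<open>F'\<close> into the same bound on the difference
  quotients.\<close>

lemma has_vector_derivative_integral:
  fixes F F' :: "real \<Rightarrow> 'a \<Rightarrow> complex"
  assumes int: "\<And>t. integrable M (F t)"
    and der: "\<And>x t. \<bar>t\<bar> < 1 \<Longrightarrow> ((\<lambda>s. F s x) has_vector_derivative F' t x) (at t)"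
    and bound: "\<And>x t. \<bar>t\<bar> < 1 \<Longrightarrow> cmod (F' t x) \<le> w x"
    and w: "integrable M w"
    and meas: "F' 0 \<in> borel_measurable M"
  shows "((\<lambda>t. integral\<^sup>L M (F t)) has_vector_derivative integral\<^sup>L M (F' 0)) (at 0)"
proof -
  let ?I = "\<lambda>t. integral\<^sup>L M (F t)" and ?J = "integral\<^sup>L M (F' 0)"
  have quot: "cmod ((F t x - F 0 x) /\<^sub>R t) \<le> w x" if "\<bar>t\<bar> < 1" "t \<noteq> 0" for t x
  proof -
    have "norm (F t x - F 0 x) \<le> w x * norm (t - 0)"
    proof (rule differentiable_bound[of "{-1<..<1}" "\<lambda>s. F s x" "\<lambda>s h. h *\<^sub>R F' s x"])
      fix s :: real assume s: "s \<in> {-1<..<1}"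
      then show "((\<lambda>s. F s x) has_derivative (\<lambda>h. h *\<^sub>R F' s x)) (at s within {-1<..<1})"
        using der[of s x] unfolding has_vector_derivative_def by (auto intro: has_derivative_at_withinI)
      show "onorm (\<lambda>h. h *\<^sub>R F' s x) \<le> w x"
        using bound[of s x] s by (intro onorm_le) (auto intro!: mult_left_mono simp: mult.commute[of "w x"])
    qed (use that in auto)
    moreover have "cmod ((F t x - F 0 x) /\<^sub>R t) = cmod (F t x - F 0 x) / \<bar>t\<bar>"
      unfolding norm_scaleR by (simp add: divide_inverse mult.commute)
    ultimately show ?thesis using that by (simp add: pos_divide_le_eq)
  qed
  have int': "integrable M (F' 0)"
    using bound[of 0] by (intro Bochner_Integration.integrable_bound[OF w meas] AE_I2) (force intro: order_trans)
  have "((\<lambda>t. (?I t - ?I 0) /\<^sub>R t) \<longlongrightarrow> ?J) (at 0)"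
    unfolding tendsto_at_iff_sequentially
  proof (intro allI impI)
    fix X :: "nat \<Rightarrow> real" assume X: "\<forall>i. X i \<in> UNIV - {0}" "X \<longlonglongrightarrow> 0"
    have "eventually (\<lambda>n. \<bar>X n\<bar> < 1) sequentially"
      using tendstoD[OF X(2), of 1] by simp
    then obtain N where N: "\<And>n. n \<ge> N \<Longrightarrow> \<bar>X n\<bar> < 1"
      unfolding eventually_sequentially by blast
    \<comment> \<open>The shift by \<open>N\<close> makes the bound on the quotients valid for all
      indices; \<open>LIMSEQ_offset\<close> removes it at the end.\<close>
    have "(\<lambda>n. integral\<^sup>L M (\<lambda>x. (F (X (n + N)) x - F 0 x) /\<^sub>R X (n + N))) \<longlonglongrightarrow> ?J"
    proof (rule integral_dominated_convergence[where w = w])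
      show "AE x in M. (\<lambda>n. (F (X (n + N)) x - F 0 x) /\<^sub>R X (n + N)) \<longlonglongrightarrow> F' 0 x"
      proof (rule AE_I2)
        fix x
        have "((\<lambda>h. norm (F h x - F 0 x - h *\<^sub>R F' 0 x) / norm h) \<longlongrightarrow> 0) (at 0)"
          using der[of 0 x] unfolding has_vector_derivative_def has_derivative_at by simp
        then have "(\<lambda>n. norm (F (X n) x - F 0 x - X n *\<^sub>R F' 0 x) / norm (X n)) \<longlonglongrightarrow> 0"
          using X unfolding tendsto_at_iff_sequentially by (auto simp: o_def)
        moreover have "norm (F (X n) x - F 0 x - X n *\<^sub>R F' 0 x) / norm (X n) = norm ((F (X n) x - F 0 x) /\<^sub>R X n - F' 0 x)" for n
        proof -
          have "(F (X n) x - F 0 x) /\<^sub>R X n - F' 0 x = (F (X n) x - F 0 x - X n *\<^sub>R F' 0 x) /\<^sub>R X n"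
            using X(1) by (simp add: scaleR_diff_right)
          then show ?thesis by (simp add: divide_inverse mult.commute)
        qed
        ultimately have "(\<lambda>n. (F (X n) x - F 0 x) /\<^sub>R X n) \<longlonglongrightarrow> F' 0 x"
          by (simp add: tendsto_norm_zero_iff LIM_zero_iff)
        then show "(\<lambda>n. (F (X (n + N)) x - F 0 x) /\<^sub>R X (n + N)) \<longlonglongrightarrow> F' 0 x"
          by (rule LIMSEQ_ignore_initial_segment)
      qed
      show "AE x in M. cmod ((F (X (n + N)) x - F 0 x) /\<^sub>R X (n + N)) \<le> w x" for n
        using quot N X(1) by (intro AE_I2) auto
      show "(\<lambda>x. (F (X (n + N)) x - F 0 x) /\<^sub>R X (n + N)) \<in> borel_measurable M" for n
        using int by (intro borel_measurable_scaleR borel_measurable_diff) auto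
    qed (use w meas in auto)
    then have "(\<lambda>n. (?I (X (n + N)) - ?I 0) /\<^sub>R X (n + N)) \<longlonglongrightarrow> ?J"
      using int by simp
    then show "((\<lambda>t. (?I t - ?I 0) /\<^sub>R t) \<circ> X) \<longlonglongrightarrow> ?J"
      unfolding o_def by (rule LIMSEQ_offset)
  qed
  then have "((\<lambda>h. (?I h - ?I 0) /\<^sub>R h - ?J) \<longlongrightarrow> 0) (at 0)"
    by (simp add: LIM_zero_iff)
  then have "((\<lambda>h. norm ((?I h - ?I 0) /\<^sub>R h - ?J)) \<longlongrightarrow> 0) (at 0)"
    by (rule tendsto_norm_zero)
  also have "?this \<longleftrightarrow> ((\<lambda>h. norm (?I h - ?I 0 - h *\<^sub>R ?J) / norm h) \<longlongrightarrow> 0) (at 0)"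
  proof (rule filterlim_cong[OF refl refl])
    show "eventually (\<lambda>h. norm ((?I h - ?I 0) /\<^sub>R h - ?J) =
        norm (?I h - ?I 0 - h *\<^sub>R ?J) / norm h) (at 0)"
      unfolding eventually_at_filter
    proof (intro always_eventually allI impI)
      fix h :: real assume "h \<noteq> 0"
      then have "(?I h - ?I 0) /\<^sub>R h - ?J =
          (?I h - ?I 0 - h *\<^sub>R ?J) /\<^sub>R h"
        by (simp add: scaleR_diff_right)
      then show "norm ((?I h - ?I 0) /\<^sub>R h - ?J) =
        norm (?I h - ?I 0 - h *\<^sub>R ?J) / norm h"
        by (simp add: divide_inverse mult.commute)
    qed
  qed
  finally show ?thesis
    unfolding has_vector_derivative_def has_derivative_at
    by (simp add: bounded_linear_scaleR_left)
qed

text \<open>Up to a constant, \<open>ft 1\<close> is the inverse of the Fourier transform \<open>ft (- 1)\<close>.\<close>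

definition ft :: "real \<Rightarrow> (real^'n::finite \<Rightarrow> complex) \<Rightarrow> real^'n \<Rightarrow> complex" where
  "ft s g \<xi> = (LINT x|lborel. g x * cis (s * (x \<bullet> \<xi>)))"

lemma fourier_eq_ft: "fourier = ft (-1)"
  by (intro ext) (simp add: fourier_def ft_def)

lemma rapid_mult_cis:
  "rapid g \<Longrightarrow> rapid (\<lambda>x. g x * cis (s * (x \<bullet> \<xi>)))"
  using rapid_mult_bounded[of g "\<lambda>x. cis (s * (x \<bullet> \<xi>))" 1 0]
  by (simp add: continuous_intros mult.commute)

lemma norm_ft_le:
  assumes "rapid g"
  shows "cmod (ft s g \<xi>) \<le> (LINT x|lborel. cmod (g x))"
  unfolding ft_def
  by (rule order_trans[OF integral_norm_bound]) (simp add: norm_mult)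

lemma continuous_on_ft:
  assumes "rapid g"
  shows "continuous_on UNIV (ft s g)"
  unfolding continuous_on_sequentially
proof safe
  fix X :: "nat \<Rightarrow> real^'a" and \<xi> assume "X \<longlonglongrightarrow> \<xi>"
  then have "(\<lambda>n. LINT x|lborel. g x * cis (s * (x \<bullet> X n))) \<longlonglongrightarrow> (LINT x|lborel. g x * cis (s * (x \<bullet> \<xi>)))"
    using rapid_integrable[OF assms] rapid_integrable[OF rapid_mult_cis[OF assms]]
    by (intro integral_dominated_convergence[where w = "\<lambda>x. cmod (g x)"] AE_I2)
       (auto intro!: tendsto_intros isCont_tendsto_compose[of _ cis] continuous_on_interior[of UNIV] continuous_intros simp: norm_mult)
  then show "(ft s g \<circ> X) \<longlonglongrightarrow> ft s g \<xi>"
    by (simp add: ft_def o_def)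
qed

lemma rapid_mult_coord:
  fixes g :: "real^'n::finite \<Rightarrow> complex"
  shows "rapid g \<Longrightarrow> rapid (\<lambda>x. (c * complex_of_real (x $ i)) * g x)"
proof (rule rapid_mult_bounded[where c = "cmod c" and j = 1])
  fix x :: "real^'n"
  have "\<bar>x $ i\<bar> \<le> 1 + norm x" using component_le_norm_cart[of x i] by simp
  then show "cmod (c * complex_of_real (x $ i)) \<le> cmod c * (1 + norm x) ^ 1"
    by (simp add: norm_mult mult_left_mono)
qed (auto intro!: continuous_intros)

lemma has_pd_ft:
  assumes "rapid g"
  shows "has_pd i (ft s g) (ft s (\<lambda>x. (\<i> * s * complex_of_real (x $ i)) * g x))"
  unfolding has_pd_def
proof
  fix \<xi> :: "real^'a"
  define F where "F = (\<lambda>(t::real) x. g x * cis (s * (x \<bullet> (\<xi> + t *\<^sub>R axis i 1))))"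
  define F' where "F' = (\<lambda>(t::real) x. ((\<i> * s * complex_of_real (x $ i)) * g x) * cis (s * (x \<bullet> (\<xi> + t *\<^sub>R axis i 1))))"
  have r: "rapid (\<lambda>x. (\<i> * s * complex_of_real (x $ i)) * g x)"
    by (rule rapid_mult_coord[OF assms])
  have "((\<lambda>t. integral\<^sup>L lborel (F t)) has_vector_derivative integral\<^sup>L lborel (F' 0)) (at 0)"
  proof (rule has_vector_derivative_integral)
    show "integrable lborel (F t)" for t
      unfolding F_def by (intro rapid_integrable rapid_mult_cis assms)
    show "((\<lambda>s. F s x) has_vector_derivative F' t x) (at t)" for t x
    proof -
      have "((\<lambda>t. cis (s * (x \<bullet> (\<xi> + t *\<^sub>R axis i 1)))) has_derivative
          (\<lambda>h. (s * (x \<bullet> (h *\<^sub>R axis i 1))) *\<^sub>R (\<i> * cis (s * (x \<bullet> (\<xi> + t *\<^sub>R axis i 1)))))) (at t)"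
        by (auto intro!: derivative_eq_intros)
      then have "((\<lambda>t. cis (s * (x \<bullet> (\<xi> + t *\<^sub>R axis i 1)))) has_vector_derivative
          ((s * x $ i) *\<^sub>R (\<i> * cis (s * (x \<bullet> (\<xi> + t *\<^sub>R axis i 1)))))) (at t)"
        unfolding has_vector_derivative_def by (simp add: inner_axis mult_ac)
      note * = has_vector_derivative_mult_right[OF this, of "g x"]
      have "F' t x = g x * ((s * x $ i) *\<^sub>R (\<i> * cis (s * (x \<bullet> (\<xi> + t *\<^sub>R axis i 1)))))"
        by (simp add: F'_def scaleR_conv_of_real[where ?'a = complex] mult_ac)
      then show ?thesis unfolding F_def using * by simp
    qed
    show "cmod (F' t x) \<le> cmod ((\<i> * s * complex_of_real (x $ i)) * g x)" for t x
      by (simp add: F'_def norm_mult)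
    show "integrable lborel (\<lambda>x. cmod ((\<i> * s * complex_of_real (x $ i)) * g x))"
      by (intro integrable_norm rapid_integrable r)
    show "F' 0 \<in> borel_measurable lborel"
      unfolding F'_def using rapid_measurable[OF rapid_mult_cis[OF r]] by simp
  qed
  then show "((\<lambda>t. ft s g (\<xi> + t *\<^sub>R axis i 1)) has_vector_derivative ft s (\<lambda>x. (\<i> * s * complex_of_real (x $ i)) * g x) \<xi>) (at 0)"
    by (simp add: F_def F'_def ft_def)
qed

lemma smooth_ft: "rapid g \<Longrightarrow> smooth (ft s g)"
proof (rule smooth_coinduct[where X = "\<lambda>f. \<exists>g. rapid g \<and> f = ft s g"])
  show "\<exists>f'. has_pd i f f' \<and> (\<exists>g. rapid g \<and> f' = ft s g)" if f: "\<exists>g. rapid g \<and> f = ft s g" for f :: "real^'n \<Rightarrow> complex" and i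
  proof -
    obtain g where g: "rapid g" "f = ft s g" using f by blast
    show ?thesis using has_pd_ft[OF g(1)] rapid_mult_coord[OF g(1)] unfolding g(2) by blast
  qed
qed (auto intro: continuous_on_ft)

text \<open>The symbol of the differential operator \<open>Dw w\<close> on the Fourier side, see
  \<open>Dw_ft\<close>.\<close>

definition symb :: "real \<Rightarrow> 'n::finite list \<Rightarrow> real^'n \<Rightarrow> complex" where
  "symb s w x = (\<Prod>i\<leftarrow>w. \<i> * s * complex_of_real (x $ i))"

lemma symb_simps [simp]: "symb s [] x = 1" "symb s (i # w) x = (\<i> * s * complex_of_real (x $ i)) * symb s w x"
  by (simp_all add: symb_def)

lemma norm_symb_le: "\<bar>s\<bar> = 1 \<Longrightarrow> cmod (symb s w x) \<le> norm x ^ length w"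
  by (induction w) (auto simp: norm_mult component_le_norm_cart intro!: mult_mono)

lemma rapid_symb_mult: "rapid g \<Longrightarrow> rapid (\<lambda>x. symb s w x * g x)"
proof (induction w)
  case (Cons i w)
  then show ?case using rapid_mult_coord[of "\<lambda>x. symb s w x * g x" "\<i> * s" i] by (simp add: mult.assoc)
qed simp

lemma Dw_ft:
  assumes "rapid g"
  shows "Dw w (ft s g) = ft s (\<lambda>x. symb s w x * g x)"
proof (induction w)
  case (Cons i w)
  then show ?case
    using has_pd_ft[OF rapid_symb_mult[OF assms], of i s s w]
    by (simp add: Dw_Cons has_pd_iff mult.assoc)
qed simp

lemma has_pd_cis:
  "has_pd i (\<lambda>x. cis (s * (x \<bullet> \<xi>))) (\<lambda>x. (\<i> * s * complex_of_real (\<xi> $ i)) * cis (s * (x \<bullet> \<xi>)))"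
  unfolding has_pd_def
proof
  fix x
  have "((\<lambda>t. cis (s * ((x + t *\<^sub>R axis i 1) \<bullet> \<xi>))) has_derivative
      (\<lambda>h. (s * ((h *\<^sub>R axis i 1) \<bullet> \<xi>)) *\<^sub>R (\<i> * cis (s * ((x + 0 *\<^sub>R axis i 1) \<bullet> \<xi>))))) (at 0)"
    by (auto intro!: derivative_eq_intros)
  moreover have *: "(s * ((h *\<^sub>R axis i 1) \<bullet> \<xi>)) *\<^sub>R (\<i> * cis (s * ((x + 0 *\<^sub>R axis i 1) \<bullet> \<xi>))) =
      h *\<^sub>R ((\<i> * s * complex_of_real (\<xi> $ i)) * cis (s * (x \<bullet> \<xi>)))" for h
    by (simp add: inner_axis' scaleR_conv_of_real[where ?'a = complex] mult_ac)
  ultimately show "((\<lambda>t. cis (s * ((x + t *\<^sub>R axis i 1) \<bullet> \<xi>))) has_vector_derivative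
      (\<i> * s * complex_of_real (\<xi> $ i)) * cis (s * (x \<bullet> \<xi>))) (at 0)"
    unfolding has_vector_derivative_def by (simp only: *)
qed

lemma integral_translate:
  fixes f :: "'a::euclidean_space \<Rightarrow> complex"
  assumes "f \<in> borel_measurable borel"
  shows "(LINT x|lborel. f (x + c)) = (LINT x|lborel. f x)"
proof -
  have "(LINT x|lborel. f x) = (LINT x|distr lborel borel ((+) c). f x)"
    by (simp add: lborel_distr_plus)
  also have "\<dots> = (LINT x|lborel. f (c + x))"
    using assms by (subst integral_distr) auto
  finally show ?thesis by (simp add: add.commute)
qed

text \<open>By translation invariance the integral of \<open>h\<close> shifted by \<open>t\<close>
  in direction \<open>i\<close> does not depend on \<open>t\<close>. Differentiating under the
  integral at \<open>t = 0\<close> gives the claim.\<close>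

lemma integral_partial_deriv_eq_0:
  fixes h :: "real^'n::finite \<Rightarrow> complex"
  assumes "rapid h" "rapid h'" "has_pd i h h'"
  shows "(LINT x|lborel. h' x) = 0"
proof -
  let ?d = "2 * DIM(real^'n)"
  obtain C where C: "C > 0" "\<And>x. cmod (h' x) \<le> C * inverse ((1 + norm x) ^ ?d)"
    using rapid_le_inverse_polynomial[OF assms(2)] by blast
  have hm: "h \<in> borel_measurable borel" "h' \<in> borel_measurable borel"
    using assms rapid_measurable by auto
  have "((\<lambda>t. LINT x|lborel. h (x + (1 * t) *\<^sub>R axis i 1)) has_vector_derivative (LINT x|lborel. 1 *\<^sub>R h' (x + (1 * 0) *\<^sub>R axis i 1))) (at 0)"
  proof (rule has_vector_derivative_integral)
    show "integrable lborel (\<lambda>x. h (x + (1 * t) *\<^sub>R axis i 1))" for t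
    proof -
      have "integrable (distr lborel borel ((+) (t *\<^sub>R axis i 1))) h"
        using rapid_integrable[OF assms(1)] by (simp add: lborel_distr_plus)
      then show ?thesis
        using hm by (subst (asm) integrable_distr_eq) (auto simp: add.commute)
    qed
    show "((\<lambda>s. h (x + (1 * s) *\<^sub>R axis i 1)) has_vector_derivative 1 *\<^sub>R h' (x + (1 * t) *\<^sub>R axis i 1)) (at t)" for x t
      by (rule has_pd_along[OF assms(3)])
    show "cmod (1 *\<^sub>R h' (x + (1 * t) *\<^sub>R axis i 1)) \<le> (C * 2 ^ ?d) * inverse ((1 + norm x) ^ ?d)" if "\<bar>t\<bar> < 1" for x t
    proof -
      \<comment> \<open>A shift by less than \<open>1\<close> changes \<open>1 + norm x\<close> at
        most by the factor \<open>2\<close>, so one integrable majorant serves all translates at the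
        price of \<open>2 ^ ?d\<close>.\<close>
      have "norm x \<le> norm (x + t *\<^sub>R axis i 1) + norm (t *\<^sub>R axis i 1 :: real^'n)"
        using norm_triangle_ineq4[of "x + t *\<^sub>R axis i 1" "t *\<^sub>R axis i 1"] by simp
      also have "\<dots> \<le> norm (x + t *\<^sub>R axis i 1) + 1"
        using that by (simp add: norm_axis_1)
      also have "\<dots> \<le> 2 * norm (x + t *\<^sub>R axis i 1) + 1" by simp
      finally have "1 + norm x \<le> 2 * (1 + norm (x + t *\<^sub>R axis i 1))" by simp
      then have "(1 + norm x) ^ ?d \<le> (2 * (1 + norm (x + t *\<^sub>R axis i 1))) ^ ?d"
        by (intro power_mono) auto
      then have "inverse ((2 * (1 + norm (x + t *\<^sub>R axis i 1))) ^ ?d) \<le> inverse ((1 + norm x) ^ ?d)"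
        by (intro le_imp_inverse_le zero_less_power add_pos_nonneg) auto
      moreover have "inverse (u ^ ?d) = 2 ^ ?d * inverse ((2 * u) ^ ?d)" for u :: real
        by (simp add: power_mult_distrib[of 2 u])
      ultimately have "inverse ((1 + norm (x + t *\<^sub>R axis i 1)) ^ ?d) \<le> 2 ^ ?d * inverse ((1 + norm x) ^ ?d)"
        by (metis mult_left_mono zero_le_numeral zero_le_power)
      then show ?thesis
        using C order_trans[OF C(2)[of "x + t *\<^sub>R axis i 1"] mult_left_mono[of _ _ C]] by (simp add: mult.assoc)
    qed
    show "integrable lborel (\<lambda>x. (C * 2 ^ ?d) * inverse ((1 + norm (x::real^'n)) ^ ?d))"
      by (intro integrable_mult_right integrable_inverse_polynomial)
    show "(\<lambda>x. 1 *\<^sub>R h' (x + (1 * 0) *\<^sub>R axis i 1)) \<in> borel_measurable lborel"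
      using hm by simp
  qed
  moreover have "(\<lambda>t. LINT x|lborel. h (x + (1 * t) *\<^sub>R axis i 1)) = (\<lambda>t. LINT x|lborel. h x)"
    using integral_translate[OF hm(1)] by simp
  ultimately have "((\<lambda>t::real. LINT x|lborel. h x) has_vector_derivative (LINT x|lborel. h' x)) (at 0)"
    by simp
  then show ?thesis
    using vector_derivative_at has_vector_derivative_const by metis
qed

text \<open>Integration by parts: \<open>integral_partial_deriv_eq_0\<close> is applied to
  \<open>h\<close> times the character.\<close>

lemma ft_partial_deriv:
  assumes "rapid h" "rapid h'" "has_pd i h h'"
  shows "ft s h' \<xi> = - (\<i> * s * complex_of_real (\<xi> $ i)) * ft s h \<xi>"
proof -
  let ?c = "\<i> * s * complex_of_real (\<xi> $ i)"
  have r: "rapid (\<lambda>x. h x * cis (s * (x \<bullet> \<xi>)))" "rapid (\<lambda>x. h' x * cis (s * (x \<bullet> \<xi>)))"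
    using assms rapid_mult_cis by auto
  have c: "rapid (\<lambda>x. ?c * (h x * cis (s * (x \<bullet> \<xi>))))"
    by (rule rapid_mult_bounded[OF r(1), of "\<lambda>_. ?c" "cmod ?c" 0]) auto
  have sum: "rapid (\<lambda>x. h' x * cis (s * (x \<bullet> \<xi>)) + ?c * (h x * cis (s * (x \<bullet> \<xi>))))"
    unfolding rapid_def
  proof (intro conjI allI)
    show "continuous_on UNIV (\<lambda>x. h' x * cis (s * (x \<bullet> \<xi>)) + ?c * (h x * cis (s * (x \<bullet> \<xi>))))"
      using rapid_continuous[OF r(2)] rapid_continuous[OF c] by (rule continuous_on_add)
    fix k
    obtain A B where "\<And>x. (1 + norm x) ^ k * cmod (h' x * cis (s * (x \<bullet> \<xi>))) \<le> A"
      "\<And>x. (1 + norm x) ^ k * cmod (?c * (h x * cis (s * (x \<bullet> \<xi>)))) \<le> B"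
      using rapid_bound[OF r(2)] rapid_bound[OF c] by metis
    then have "(1 + norm x) ^ k * cmod (h' x * cis (s * (x \<bullet> \<xi>)) + ?c * (h x * cis (s * (x \<bullet> \<xi>)))) \<le> A + B" for x
      using order_trans[OF mult_left_mono[OF norm_triangle_ineq[of "h' x * cis (s * (x \<bullet> \<xi>))" "?c * (h x * cis (s * (x \<bullet> \<xi>)))"], of "(1 + norm x) ^ k"]]
      by (simp add: distrib_left add_mono)
    then show "\<exists>C. \<forall>x. (1 + norm x) ^ k * cmod (h' x * cis (s * (x \<bullet> \<xi>)) + ?c * (h x * cis (s * (x \<bullet> \<xi>)))) \<le> C"
      by blast
  qed
  have "has_pd i (\<lambda>x. h x * cis (s * (x \<bullet> \<xi>))) (\<lambda>x. h' x * cis (s * (x \<bullet> \<xi>)) + ?c * (h x * cis (s * (x \<bullet> \<xi>))))"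
    using has_pd_mult[OF assms(3) has_pd_cis[of i s \<xi>]] by (simp add: mult_ac)
  from integral_partial_deriv_eq_0[OF r(1) sum this]
  have "ft s h' \<xi> + ?c * ft s h \<xi> = 0"
    using rapid_integrable[OF r(2)] rapid_integrable[OF c] rapid_integrable[OF r(1)]
    by (simp add: ft_def)
  then show ?thesis by (simp add: eq_neg_iff_add_eq_0)
qed

section \<open>Fourier inversion\<close>

text \<open>Only partial derivatives are available, so \<open>x\<close> is reached from
  \<open>0\<close> by changing one coordinate at a time.\<close>

lemma has_pd_zero_imp_const:
  fixes f :: "real^'n::finite \<Rightarrow> complex"
  assumes "\<And>i. has_pd i f (\<lambda>x. 0)"
  shows "f x = f 0"
proof -
  have step: "f (y + t *\<^sub>R axis i 1) = f y" for y i and t :: real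
  proof -
    have "((\<lambda>t. f (y + (1 * t) *\<^sub>R axis i 1)) has_vector_derivative 0) (at s)" for s :: real
      using has_pd_along[OF assms[of i], where \<sigma> = 1 and x = y and s = s] by simp
    then obtain c where "\<And>t. f (y + (1 * t) *\<^sub>R axis i 1) = c"
      using has_vector_derivative_zero_constant[of UNIV "\<lambda>t. f (y + (1 * t) *\<^sub>R axis i 1)"] by auto
    from this[of t] this[of 0] show ?thesis by simp
  qed
  have "f (\<Sum>i\<in>A. (x $ i) *\<^sub>R axis i 1) = f 0" if "finite A" for A
    using that
  proof (induction A rule: finite_induct)
    case (insert i A)
    then show ?case
      using step[of "\<Sum>i\<in>A. (x $ i) *\<^sub>R axis i 1" "x $ i" i] by (simp add: add.commute)
  qed simp
  from this[of UNIV] show ?thesis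
    using basis_expansion[of x] by (simp add: scalar_mult_eq_scaleR)
qed

lemma power_le_exp_fact: "x \<ge> 0 \<Longrightarrow> x ^ k \<le> exp x * (fact k :: real)"
proof -
  assume x: "x \<ge> 0"
  have "x ^ k /\<^sub>R fact k \<le> exp x"
    unfolding exp_def
    by (rule order_trans[OF _ sum_le_suminf[of _ "{k}"]]) (use x summable_exp_generic[of x] in auto)
  then show ?thesis by (simp add: field_simps)
qed

definition gauss :: "real^'n::finite \<Rightarrow> complex" where
  "gauss x = complex_of_real (exp (- (norm x)\<^sup>2 / 2))"

lemma rapid_gauss: "rapid (gauss :: real^'n::finite \<Rightarrow> complex)"
  unfolding rapid_def
proof (intro conjI allI)
  show "continuous_on UNIV (gauss :: real^'n::finite \<Rightarrow> complex)"
    unfolding gauss_def by (intro continuous_intros) auto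
  fix k
  have "(1 + norm x) ^ k * cmod (gauss x) \<le> fact k * exp (3/2)" for x :: "real^'n"
  proof -
    define r where "r = norm x"
    have "(1 + r) ^ k \<le> fact k * exp (1 + r)"
      using power_le_exp_fact[of "1 + r" k] by (simp add: r_def mult.commute)
    then have "(1 + r) ^ k * exp (- r\<^sup>2 / 2) \<le> fact k * exp (1 + r) * exp (- r\<^sup>2 / 2)"
      by (intro mult_right_mono) auto
    also have "\<dots> = fact k * exp (1 + r - r\<^sup>2 / 2)"
      by (simp add: mult.assoc flip: exp_add)
    \<comment> \<open>This is \<open>(r - 1)\<^sup>2 \<ge> 0\<close>.\<close>
    also have "1 + r - r\<^sup>2 / 2 \<le> 3/2"
      using zero_le_power2[of "r - 1"] by (simp add: power2_diff)
    then have "fact k * exp (1 + r - r\<^sup>2 / 2) \<le> fact k * exp (3/2)"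
      by (intro mult_left_mono) auto
    finally show ?thesis by (simp add: gauss_def r_def)
  qed
  then show "\<exists>C. \<forall>x::real^'n. (1 + norm x) ^ k * cmod (gauss x) \<le> C" by blast
qed

lemma norm_sq_along: "(norm (x + t *\<^sub>R axis i 1 :: real^'n::finite))\<^sup>2 = (norm x)\<^sup>2 + 2 * t * x $ i + t\<^sup>2"
  unfolding power2_norm_eq_inner
  by (simp add: inner_add_left inner_add_right inner_axis inner_axis' inner_axis_axis power2_eq_square algebra_simps)

lemma has_pd_exp_norm_sq:
  "has_pd i (\<lambda>x. complex_of_real (exp (c * (norm x)\<^sup>2 / 2)))
     (\<lambda>x. (c * complex_of_real (x $ i)) * complex_of_real (exp (c * (norm x)\<^sup>2 / 2)))"
  unfolding has_pd_def norm_sq_along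
proof
  fix x :: "real^'a"
  have "((\<lambda>t. exp (c * ((norm x)\<^sup>2 + 2 * t * x $ i + t\<^sup>2) / 2)) has_real_derivative (c * x $ i) * exp (c * (norm x)\<^sup>2 / 2)) (at 0)"
    by (auto intro!: derivative_eq_intros)
  then show "((\<lambda>t. complex_of_real (exp (c * ((norm x)\<^sup>2 + 2 * t * x $ i + t\<^sup>2) / 2))) has_vector_derivative
      (c * complex_of_real (x $ i)) * complex_of_real (exp (c * (norm x)\<^sup>2 / 2))) (at 0)"
    by (auto dest!: has_vector_derivative_of_real)
qed

text \<open>Both sides solve the same system of first order equations.\<close>

lemma ft_gauss:
  fixes \<xi> :: "real^'n::finite"
  assumes "\<bar>s\<bar> = 1"
  shows "ft s gauss \<xi> = (LINT x|lborel. gauss (x::real^'n)) * gauss \<xi>"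
proof -
  have g: "rapid (gauss :: real^'n \<Rightarrow> complex)" by (rule rapid_gauss)
  have s2: "complex_of_real s * complex_of_real s = 1"
    using assms by (metis abs_mult_self_eq mult_1 of_real_1 of_real_mult)
  have gpd: "has_pd i gauss (\<lambda>x. (- 1 * complex_of_real (x $ i)) * gauss x)" for i :: 'n
    using has_pd_exp_norm_sq[of i "-1"] unfolding gauss_def by (simp add: gauss_def[abs_def])
  have scale: "ft s (\<lambda>x. (a * complex_of_real (x $ i)) * gauss x) \<eta> = a * ft s (\<lambda>x. complex_of_real (x $ i) * gauss x) \<eta>" for a i and \<eta> :: "real^'n"
    unfolding ft_def by (subst integral_mult_right_zero[symmetric]) (simp add: mult.assoc)
  \<comment> \<open>The partial derivative of the Gaussian is the Gaussian times minus the
    coordinate. The transform exchanges derivatives with multiplication by coordinates, so it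
    satisfies the same equation; the sign is right because \<open>\<i> * s\<close> squares to
    \<open>- 1\<close>.\<close>
  have pd: "has_pd i (ft s gauss) (\<lambda>\<eta>. - complex_of_real (\<eta> $ i) * ft s gauss \<eta>)" for i :: 'n
  proof -
    have "- 1 * ft s (\<lambda>x. complex_of_real (x $ i) * gauss x) \<eta> = - (\<i> * s * complex_of_real (\<eta> $ i)) * ft s gauss \<eta>" for \<eta>
      using ft_partial_deriv[OF g rapid_mult_coord[OF g] gpd[of i], of s \<eta>] unfolding scale .
    then have "ft s (\<lambda>x. complex_of_real (x $ i) * gauss x) \<eta> = (\<i> * s * complex_of_real (\<eta> $ i)) * ft s gauss \<eta>" for \<eta>
      by (simp only: mult_minus1 mult_minus_left neg_equal_iff_equal mult_1)
    then have "ft s (\<lambda>x. (\<i> * s * complex_of_real (x $ i)) * gauss x) = (\<lambda>\<eta>. - complex_of_real (\<eta> $ i) * ft s gauss \<eta>)"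
      unfolding scale[abs_def] using s2 by (auto simp: fun_eq_iff algebra_simps)
    then show ?thesis using has_pd_ft[OF g, of i s] by simp
  qed
  let ?E = "\<lambda>\<eta>::real^'n. complex_of_real (exp (1 * (norm \<eta>)\<^sup>2 / 2))"
  \<comment> \<open>Dividing by the Gaussian leaves a function with vanishing partial derivatives,
    hence a constant, namely its value at \<open>0\<close>.\<close>
  have zero: "has_pd i (\<lambda>\<eta>. ft s gauss \<eta> * ?E \<eta>) (\<lambda>\<eta>. 0)" for i :: 'n
    using has_pd_mult[OF pd has_pd_exp_norm_sq[of i 1]] by (simp add: algebra_simps)
  have "ft s gauss \<xi> * ?E \<xi> = ft s gauss (0::real^'n) * ?E 0"
    by (rule has_pd_zero_imp_const[of "\<lambda>\<eta>. ft s gauss \<eta> * ?E \<eta>", OF zero])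
  also have "\<dots> = (LINT x|lborel. gauss (x::real^'n))"
    by (simp add: ft_def)
  finally have E: "ft s gauss \<xi> * ?E \<xi> = (LINT x|lborel. gauss (x::real^'n))" .
  have "?E \<xi> * gauss \<xi> = 1"
    unfolding gauss_def of_real_mult[symmetric] exp_add[symmetric] by simp
  then have "ft s gauss \<xi> = (ft s gauss \<xi> * ?E \<xi>) * gauss \<xi>"
    by (metis mult.assoc mult.right_neutral)
  then show ?thesis unfolding E .
qed

text \<open>Inversion divides by the square of this constant. An everywhere positive function with
  integral \<open>0\<close> would make the whole space a null set.\<close>

lemma integral_gauss_nonzero: "(LINT x|lborel. gauss (x::real^'n::finite)) \<noteq> 0"
proof
  assume 0: "(LINT x|lborel. gauss (x::real^'n)) = 0"
  have eq: "gauss = (\<lambda>x::real^'n. complex_of_real (exp (- (norm x)\<^sup>2 / 2)))"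
    by (simp add: gauss_def[abs_def])
  have int: "integrable lborel (\<lambda>x::real^'n. exp (- (norm x)\<^sup>2 / 2))"
    using rapid_integrable[of "gauss :: real^'n \<Rightarrow> complex", OF rapid_gauss] unfolding eq
    by (simp only: complex_of_real_integrable_eq)
  have "(LINT x|lborel. exp (- (norm (x::real^'n))\<^sup>2 / 2)) = 0"
    using 0 unfolding eq by (simp add: integral_complex_of_real)
  then have "AE x in lborel. exp (- (norm (x::real^'n))\<^sup>2 / 2) = 0"
    using integral_nonneg_eq_0_iff_AE[OF int] by simp
  then have "AE x in (lborel :: (real^'n) measure). False" by simp
  then obtain N where "{x \<in> space lborel. \<not> False} \<subseteq> N" "emeasure lborel N = 0" "N \<in> sets (lborel :: (real^'n) measure)"
    by (rule AE_E)
  then show False by (simp add: top.extremum_unique)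
qed

lemma integral_affine:
  fixes f :: "'a::euclidean_space \<Rightarrow> complex"
  assumes [measurable]: "f \<in> borel_measurable borel" and "e > 0"
  shows "(LINT x|lborel. f x) = complex_of_real (e ^ DIM('a)) * (LINT z|lborel. f (t + e *\<^sub>R z))"
proof -
  have "(LINT x|lborel. f x) = (LINT x|density (distr lborel borel (\<lambda>x. t + e *\<^sub>R x)) (\<lambda>_. \<bar>e\<bar> ^ DIM('a)). f x)"
    using assms by (subst lborel_affine[of e t]) auto
  also have "\<dots> = (LINT x|distr lborel borel (\<lambda>x. t + e *\<^sub>R x). (\<bar>e\<bar> ^ DIM('a)) *\<^sub>R f x)"
    by (subst integral_density) auto
  also have "\<dots> = (LINT z|lborel. (\<bar>e\<bar> ^ DIM('a)) *\<^sub>R f (t + e *\<^sub>R z))"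
    by (subst integral_distr) auto
  also have "\<dots> = complex_of_real (e ^ DIM('a)) * (LINT z|lborel. f (t + e *\<^sub>R z))"
    using assms by (simp add: scaleR_conv_of_real)
  finally show ?thesis .
qed

text \<open>Fubini for the kernel \<open>cis (s * (y \<bullet> \<xi>))\<close>, which is symmetric
  in its two variables.\<close>

lemma ft_multiplication_formula:
  fixes f g :: "real^'n::finite \<Rightarrow> complex"
  assumes f: "rapid f" and g: "rapid g"
  shows "(LINT \<xi>|lborel. ft s f \<xi> * g \<xi>) = (LINT y|lborel. f y * ft s g y)"
proof -
  have [measurable]: "f \<in> borel_measurable borel" "g \<in> borel_measurable borel"
    using f g by (auto intro: rapid_measurable)
  have [measurable]: "(\<lambda>p. cis (s * (fst p \<bullet> snd p))) \<in> borel_measurable (borel \<Otimes>\<^sub>M borel :: ((real^'n) \<times> (real^'n)) measure)"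
    unfolding borel_prod by (intro borel_measurable_continuous_onI continuous_intros)
  have "integrable (lborel \<Otimes>\<^sub>M lborel) (\<lambda>p. f (fst p) * g (snd p) * cis (s * (fst p \<bullet> snd p)))"
  proof (rule lborel_pair.Fubini_integrable)
    show "(\<lambda>p. f (fst p) * g (snd p) * cis (s * (fst p \<bullet> snd p))) \<in> borel_measurable (lborel \<Otimes>\<^sub>M lborel)"
      by measurable
    show "integrable lborel (\<lambda>x. LINT y|lborel. norm (f (fst (x, y)) * g (snd (x, y)) * cis (s * (fst (x, y) \<bullet> snd (x, y)))))"
      using rapid_integrable[OF f] by (simp add: norm_mult)
    show "AE x in lborel. integrable lborel (\<lambda>y. f (fst (x, y)) * g (snd (x, y)) * cis (s * (fst (x, y) \<bullet> snd (x, y))))"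
      using rapid_integrable[OF rapid_mult_cis[OF g]]
      by (intro AE_I2) (simp add: mult.assoc inner_commute)
  qed
  then have int: "integrable (lborel \<Otimes>\<^sub>M lborel) (\<lambda>(y, \<xi>). f y * g \<xi> * cis (s * (y \<bullet> \<xi>)))"
    by (simp add: case_prod_beta')
  have "(LINT \<xi>|lborel. ft s f \<xi> * g \<xi>) = (LINT \<xi>|lborel. LINT y|lborel. f y * g \<xi> * cis (s * (y \<bullet> \<xi>)))"
    unfolding ft_def integral_mult_left_zero[symmetric] by (simp only: mult_ac)
  also have "\<dots> = (LINT y|lborel. LINT \<xi>|lborel. f y * g \<xi> * cis (s * (y \<bullet> \<xi>)))"
    by (rule lborel_pair.Fubini_integral[OF int])
  also have "\<dots> = (LINT y|lborel. f y * ft s g y)"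
    unfolding ft_def integral_mult_right_zero[symmetric] by (simp only: mult_ac inner_commute)
  finally show ?thesis .
qed

lemma rapid_scale:
  assumes "rapid g" "0 < e" "e \<le> 1"
  shows "rapid (\<lambda>x. g (e *\<^sub>R x))"
  unfolding rapid_def
proof (intro conjI allI)
  show "continuous_on UNIV (\<lambda>x. g (e *\<^sub>R x))"
    by (rule continuous_on_compose2[OF rapid_continuous[OF assms(1)]]) (auto intro: continuous_intros)
  fix k
  obtain C where C: "C > 0" "\<And>x. (1 + norm x) ^ k * cmod (g x) \<le> C"
    using rapid_bound[OF assms(1)] by blast
  have "(1 + norm x) ^ k * cmod (g (e *\<^sub>R x)) \<le> inverse e ^ k * C" for x
  proof -
    have "1 + norm x \<le> inverse e * (1 + norm (e *\<^sub>R x))"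
      using assms by (simp add: field_simps)
    then have "(1 + norm x) ^ k \<le> (inverse e * (1 + norm (e *\<^sub>R x))) ^ k"
      by (intro power_mono) auto
    then have "(1 + norm x) ^ k * cmod (g (e *\<^sub>R x)) \<le> inverse e ^ k * ((1 + norm (e *\<^sub>R x)) ^ k * cmod (g (e *\<^sub>R x)))"
      unfolding power_mult_distrib mult.assoc[symmetric] by (intro mult_right_mono) auto
    also have "\<dots> \<le> inverse e ^ k * C"
      using assms by (intro mult_left_mono C(2)) auto
    finally show ?thesis .
  qed
  then show "\<exists>C. \<forall>x. (1 + norm x) ^ k * cmod (g (e *\<^sub>R x)) \<le> C" by blast
qed

text \<open>A Gaussian factor is inserted into the inverse integral and moved to \<open>f\<close> by
  the multiplication formula, where its transform is an approximate identity at \<open>x\<close>.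
  Both sides converge as the factor tends to \<open>1\<close>. The constant is squared: it arises
  once from the transform of the Gaussian and once from its integral.\<close>

theorem ft_inversion:
  fixes f :: "real^'n::finite \<Rightarrow> complex"
  assumes f: "rapid f" and ff: "rapid (ft s f)" and s: "\<bar>s\<bar> = 1"
  shows "ft (- s) (ft s f) x = (LINT z|lborel. gauss (z::real^'n))\<^sup>2 * f x"
proof -
  define c where "c = (LINT z|lborel. gauss (z::real^'n))"
  define e where "e n = inverse (real (Suc n))" for n
  have e: "0 < e n" "e n \<le> 1" for n by (auto simp: e_def field_simps)
  have e0: "e \<longlonglongrightarrow> 0" unfolding e_def by (rule LIMSEQ_inverse_real_of_nat)
  define g where "g n \<xi> = gauss (e n *\<^sub>R \<xi>) * cis (- s * (\<xi> \<bullet> x))" for n and \<xi> :: "real^'n"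
  have g: "rapid (g n)" for n
    unfolding g_def by (intro rapid_mult_cis rapid_scale rapid_gauss e)
  have fg: "rapid (\<lambda>y. f y * ft s (g n) y)" for n
  proof (subst mult.commute, rule rapid_mult_bounded[OF f continuous_on_ft[OF g]])
    show "cmod (ft s (g n) y) \<le> (LINT x|lborel. cmod (g n x)) * (1 + norm y) ^ 0" for y
      using norm_ft_le[OF g] by simp
  qed
  \<comment> \<open>Substituting \<open>\<eta> = e n * \<xi>\<close> shows that the transform of
    \<open>g n\<close> is a Gaussian of width \<open>e n\<close> around \<open>x\<close>, with a
    negative power of \<open>e n\<close> in front. That power cancels the Jacobian of the later
    substitution \<open>y = x + e n * z\<close>.\<close>
  have tr: "complex_of_real (e n ^ DIM(real^'n)) * ft s (g n) (x + e n *\<^sub>R z) = c * gauss z" for n z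
  proof -
    let ?h = "\<lambda>\<eta>. gauss \<eta> * cis (s * (\<eta> \<bullet> z))"
    have "(LINT \<eta>|lborel. ?h \<eta>) = complex_of_real (e n ^ DIM(real^'n)) * (LINT \<xi>|lborel. ?h (0 + e n *\<^sub>R \<xi>))"
      by (rule integral_affine[OF rapid_measurable[OF rapid_mult_cis[OF rapid_gauss]] e(1)])
    also have "(\<lambda>\<xi>. ?h (0 + e n *\<^sub>R \<xi>)) = (\<lambda>\<xi>. g n \<xi> * cis (s * (\<xi> \<bullet> (x + e n *\<^sub>R z))))"
      by (auto simp: g_def cis_mult inner_add_right algebra_simps fun_eq_iff)
    finally show ?thesis
      using ft_gauss[OF s, of z] by (simp add: ft_def c_def)
  qed
  have cont_gauss: "isCont (gauss :: real^'n \<Rightarrow> complex) y" for y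
    using rapid_continuous[OF rapid_gauss] by (auto simp: continuous_on_eq_continuous_at)
  have "(\<lambda>n. LINT \<xi>|lborel. ft s f \<xi> * g n \<xi>) \<longlonglongrightarrow> (LINT \<xi>|lborel. ft s f \<xi> * cis (- s * (\<xi> \<bullet> x)))"
  proof (rule integral_dominated_convergence[where w = "\<lambda>\<xi>. cmod (ft s f \<xi>)"])
    show "AE \<xi> in lborel. (\<lambda>n. ft s f \<xi> * g n \<xi>) \<longlonglongrightarrow> ft s f \<xi> * cis (- s * (\<xi> \<bullet> x))"
    proof (rule AE_I2)
      fix \<xi> :: "real^'n"
      have "(\<lambda>n. gauss (e n *\<^sub>R \<xi>)) \<longlonglongrightarrow> gauss (0 *\<^sub>R \<xi>)"
        by (intro isCont_tendsto_compose[of _ gauss] tendsto_intros e0 cont_gauss)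
      then have "(\<lambda>n. ft s f \<xi> * (gauss (e n *\<^sub>R \<xi>) * cis (- s * (\<xi> \<bullet> x)))) \<longlonglongrightarrow> ft s f \<xi> * (1 * cis (- s * (\<xi> \<bullet> x)))"
        by (intro tendsto_intros) (simp add: gauss_def)
      then show "(\<lambda>n. ft s f \<xi> * g n \<xi>) \<longlonglongrightarrow> ft s f \<xi> * cis (- s * (\<xi> \<bullet> x))"
        by (simp add: g_def)
    qed
    show "AE \<xi> in lborel. cmod (ft s f \<xi> * g n \<xi>) \<le> cmod (ft s f \<xi>)" for n
      by (intro AE_I2) (simp add: g_def gauss_def norm_mult mult_left_le)
    show "(\<lambda>\<xi>. ft s f \<xi> * g n \<xi>) \<in> borel_measurable lborel" for n
      using rapid_measurable[OF ff] rapid_measurable[OF g[of n]] by simp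
    show "(\<lambda>\<xi>. ft s f \<xi> * cis (- s * (\<xi> \<bullet> x))) \<in> borel_measurable lborel"
      using rapid_measurable[OF rapid_mult_cis[OF ff, of "- s" x]] by simp
    show "integrable lborel (\<lambda>\<xi>. cmod (ft s f \<xi>))"
      by (intro integrable_norm rapid_integrable ff)
  qed
  moreover have "(LINT \<xi>|lborel. ft s f \<xi> * g n \<xi>) = (LINT z|lborel. f (x + e n *\<^sub>R z) * (c * gauss z))" for n
  proof -
    have "(LINT \<xi>|lborel. ft s f \<xi> * g n \<xi>) = (LINT y|lborel. f y * ft s (g n) y)"
      by (rule ft_multiplication_formula[OF f g])
    also have "\<dots> = complex_of_real (e n ^ DIM(real^'n)) * (LINT z|lborel. f (x + e n *\<^sub>R z) * ft s (g n) (x + e n *\<^sub>R z))"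
      by (rule integral_affine[OF rapid_measurable[OF fg] e(1)])
    also have "\<dots> = (LINT z|lborel. f (x + e n *\<^sub>R z) * (complex_of_real (e n ^ DIM(real^'n)) * ft s (g n) (x + e n *\<^sub>R z)))"
      by (subst integral_mult_right_zero[symmetric]) (simp add: mult_ac)
    finally show ?thesis unfolding tr .
  qed
  moreover have "(\<lambda>n. LINT z|lborel. f (x + e n *\<^sub>R z) * (c * gauss z)) \<longlonglongrightarrow> (LINT z|lborel. f x * (c * gauss (z::real^'n)))"
  proof -
    obtain C where C: "C > 0" "\<And>y. cmod (f y) \<le> C" using rapid_bounded[OF f] by blast
    have cg: "rapid (\<lambda>z::real^'n. c * gauss z)"
      by (rule rapid_mult_bounded[OF rapid_gauss, of "\<lambda>_. c" "cmod c" 0]) auto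
    have [measurable]: "f \<in> borel_measurable borel" "(\<lambda>z::real^'n. c * gauss z) \<in> borel_measurable borel"
      using rapid_measurable[OF f] rapid_measurable[OF cg] by auto
    show ?thesis
    proof (rule integral_dominated_convergence[where w = "\<lambda>z. C * cmod (c * gauss z)"])
      show "AE z in lborel. (\<lambda>n. f (x + e n *\<^sub>R z) * (c * gauss z)) \<longlonglongrightarrow> f x * (c * gauss (z::real^'n))"
      proof (rule AE_I2)
        fix z :: "real^'n"
        have "(\<lambda>n. f (x + e n *\<^sub>R z)) \<longlonglongrightarrow> f (x + 0 *\<^sub>R z)"
          using rapid_continuous[OF f]
          by (intro isCont_tendsto_compose[of _ f] tendsto_intros e0) (simp add: continuous_on_eq_continuous_at)
        then have "(\<lambda>n. f (x + e n *\<^sub>R z)) \<longlonglongrightarrow> f x" by simp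
        then show "(\<lambda>n. f (x + e n *\<^sub>R z) * (c * gauss z)) \<longlonglongrightarrow> f x * (c * gauss z)"
          by (intro tendsto_intros)
      qed
      show "AE z in lborel. cmod (f (x + e n *\<^sub>R z) * (c * gauss z)) \<le> C * cmod (c * gauss (z::real^'n))" for n
        unfolding norm_mult[of "f _"] using C(2) by (intro AE_I2 mult_right_mono) auto
      show "integrable lborel (\<lambda>z::real^'n. C * cmod (c * gauss z))"
        by (intro integrable_mult_right integrable_norm rapid_integrable cg)
    qed measurable
  qed
  ultimately have "(LINT \<xi>|lborel. ft s f \<xi> * cis (- s * (\<xi> \<bullet> x))) = (LINT z|lborel. f x * (c * gauss (z::real^'n)))"
    using LIMSEQ_unique by (simp add: LIMSEQ_unique)
  also have "\<dots> = c\<^sup>2 * f x"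
    by (simp add: c_def power2_eq_square)
  finally show ?thesis by (simp add: ft_def c_def)
qed

section \<open>A Landau inequality on the half-line\<close>

text \<open>The Lagrange basis for the equidistant nodes \<open>0, ..., n - 1\<close>.\<close>

definition lagrange_poly :: "nat \<Rightarrow> nat \<Rightarrow> real poly" where
  "lagrange_poly n j = (\<Prod>i\<in>{..<n} - {j}. smult (inverse (real j - real i)) [:- real i, 1:])"

lemma degree_lagrange_poly: "j < n \<Longrightarrow> degree (lagrange_poly n j) < n"
proof -
  assume j: "j < n"
  have "degree (lagrange_poly n j) \<le> (\<Sum>i\<in>{..<n} - {j}. 1)"
    unfolding lagrange_poly_def
    by (rule order_trans[OF degree_prod_sum_le]) (auto intro!: sum_mono)
  also have "\<dots> = n - 1" using j by simp
  finally show ?thesis using j by simp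
qed

lemma poly_lagrange_poly:
  assumes "i < n" "j < n"
  shows "poly (lagrange_poly n j) (real i) = (if i = j then 1 else 0)"
proof (cases "i = j")
  case True
  have "poly (smult (inverse (real j - real l)) [:- real l, 1:]) (real j) = 1" if "l \<noteq> j" for l
  proof -
    have "poly (smult (inverse (real j - real l)) [:- real l, 1:]) (real j) = inverse (real j - real l) * (real j - real l)"
      by (simp add: algebra_simps)
    then show ?thesis using that by simp
  qed
  then show ?thesis
    using True unfolding lagrange_poly_def poly_prod by (auto intro!: prod.neutral simp del: poly_smult)
next
  case False
  then have "poly (lagrange_poly n j) (real i) = 0"
    using assms unfolding lagrange_poly_def poly_prod by (intro prod_zero) auto
  then show ?thesis using False by simp
qed

text \<open>Interpolation reproduces the monomial of degree \<open>i < n\<close>; compare the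
  coefficients of degree \<open>k\<close>. Used as weights on \<open>n\<close> samples, these
  numbers therefore isolate the Taylor coefficient of order \<open>k\<close>.\<close>

lemma sum_coeff_lagrange_poly:
  assumes "i < n" "k < n"
  shows "(\<Sum>j<n. coeff (lagrange_poly n j) k * real j ^ i) = (if i = k then 1 else 0)"
proof -
  have "(\<Sum>j<n. smult (real j ^ i) (lagrange_poly n j)) = monom 1 i"
  proof (rule poly_eqI_degree)
    fix x assume "x \<in> real ` {..<n}"
    then obtain l where l: "l < n" "x = real l" by auto
    then have "poly (\<Sum>j<n. smult (real j ^ i) (lagrange_poly n j)) x = (\<Sum>j<n. real j ^ i * (if l = j then 1 else 0))"
      by (simp add: poly_sum poly_lagrange_poly)
    also have "\<dots> = poly (monom 1 i) x"
      using l by (simp add: poly_monom if_distrib cong: if_cong)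
    finally show "poly (\<Sum>j<n. smult (real j ^ i) (lagrange_poly n j)) x = poly (monom 1 i) x" .
  next
    have "degree (smult (real j ^ i) (lagrange_poly n j)) \<le> n - 1" if "j < n" for j
      using degree_lagrange_poly[OF that] degree_smult_le[of "real j ^ i" "lagrange_poly n j"] by linarith
    then have "degree (\<Sum>j<n. smult (real j ^ i) (lagrange_poly n j)) \<le> n - 1"
      by (intro degree_sum_le) auto
    then show "degree (\<Sum>j<n. smult (real j ^ i) (lagrange_poly n j)) < card (real ` {..<n})"
      using assms by (simp add: card_image)
  qed (use assms in \<open>simp add: card_image degree_monom_eq\<close>)
  then have "coeff (\<Sum>j<n. smult (real j ^ i) (lagrange_poly n j)) k = coeff (monom 1 i) k" by simp
  then show ?thesis by (simp add: coeff_sum mult.commute)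
qed

text \<open>Taking absolute values of all coefficients and evaluating at \<open>r\<close> bounds
  each single term, and a linear factor then contributes
  \<open>\<bar>c i\<bar> * (\<bar>a i\<bar> + r)\<close>.\<close>

lemma abs_coeff_prod_linear_le:
  fixes c a :: "'i \<Rightarrow> real"
  assumes "finite A" "r \<ge> 0"
  shows "\<bar>coeff (\<Prod>i\<in>A. smult (c i) [:- a i, 1:]) k\<bar> * r ^ k \<le> (\<Prod>i\<in>A. \<bar>c i\<bar> * (\<bar>a i\<bar> + r))"
  using assms(1)
proof (induction A arbitrary: k rule: finite_induct)
  case empty
  show ?case by (simp add: coeff_1 zero_power)
next
  case (insert x A)
  define p where "p = (\<Prod>i\<in>A. smult (c i) [:- a i, 1:])"
  define M where "M = (\<Prod>i\<in>A. \<bar>c i\<bar> * (\<bar>a i\<bar> + r))"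
  have IH: "\<bar>coeff p k\<bar> * r ^ k \<le> M" for k using insert.IH by (simp add: p_def M_def)
  have "M \<ge> 0" using order_trans[OF _ IH[of 0]] by simp
  have "\<bar>coeff ([:- a x, 1:] * p) k\<bar> * r ^ k \<le> (\<bar>a x\<bar> + r) * M"
  proof (cases k)
    case 0
    have "\<bar>a x\<bar> * \<bar>coeff p 0\<bar> \<le> \<bar>a x\<bar> * M"
      using IH[of 0] by (intro mult_left_mono) auto
    then show ?thesis using 0 \<open>M \<ge> 0\<close> assms(2)
      by (simp add: abs_mult distrib_right add_increasing2)
  next
    case (Suc l)
    have "\<bar>coeff ([:- a x, 1:] * p) k\<bar> * r ^ k = \<bar>- a x * coeff p k + coeff p l\<bar> * r ^ k"
      using Suc by (simp add: mult_pCons_left)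
    also have "\<dots> \<le> (\<bar>a x\<bar> * \<bar>coeff p k\<bar> + \<bar>coeff p l\<bar>) * r ^ k"
      using abs_triangle_ineq[of "- a x * coeff p k" "coeff p l"] assms(2)
      by (intro mult_right_mono) (auto simp: abs_mult)
    also have "\<dots> = \<bar>a x\<bar> * (\<bar>coeff p k\<bar> * r ^ k) + r * (\<bar>coeff p l\<bar> * r ^ l)"
      using Suc by (simp add: algebra_simps)
    also have "\<dots> \<le> \<bar>a x\<bar> * M + r * M"
      using IH assms(2) by (intro add_mono mult_left_mono) auto
    finally show ?thesis by (simp add: distrib_right)
  qed
  then have "\<bar>c x\<bar> * (\<bar>coeff ([:- a x, 1:] * p) k\<bar> * r ^ k) \<le> \<bar>c x\<bar> * ((\<bar>a x\<bar> + r) * M)"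
    by (intro mult_left_mono) auto
  moreover have "coeff (smult (c x) [:- a x, 1:] * p) k = c x * coeff ([:- a x, 1:] * p) k"
    by (simp only: mult_smult_left coeff_smult)
  ultimately show ?case
    unfolding prod.insert[OF insert.hyps] p_def[symmetric] M_def[symmetric]
    by (simp only: abs_mult mult.assoc)
qed

lemma prod_node_distances:
  assumes "j < n"
  shows "(\<Prod>i\<in>{..<n} - {j}. \<bar>real j - real i\<bar>) = fact j * fact (n - 1 - j)"
proof -
  have "(\<Prod>i\<in>{..<n} - {j}. \<bar>real j - real i\<bar>) = (\<Prod>i\<in>{..<j} \<union> {j<..<n}. \<bar>real j - real i\<bar>)"
    using assms by (intro prod.cong) auto
  also have "\<dots> = (\<Prod>i<j. \<bar>real j - real i\<bar>) * (\<Prod>i\<in>{j<..<n}. \<bar>real j - real i\<bar>)"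
    by (intro prod.union_disjoint) auto
  also have "(\<Prod>i<j. \<bar>real j - real i\<bar>) = (\<Prod>i<j. real (j - i))"
    by (intro prod.cong) (auto simp: of_nat_diff)
  also have "\<dots> = fact j"
    unfolding fact_prod_rev by (simp add: lessThan_atLeast0)
  also have "(\<Prod>i\<in>{j<..<n}. \<bar>real j - real i\<bar>) = (\<Prod>i\<in>{1..n - 1 - j}. real i)"
    by (rule prod.reindex_bij_witness[of _ "\<lambda>i. i + j" "\<lambda>i. i - j"]) (auto simp: of_nat_diff)
  also have "\<dots> = fact (n - 1 - j)"
    unfolding fact_prod by simp
  finally show ?thesis .
qed

lemma exp_of_nat_le: "exp (real n) \<le> 3 ^ n"
proof -
  have "exp (real n) = exp 1 ^ n" by (simp flip: exp_of_nat_mult)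
  also have "\<dots> \<le> 3 ^ n" using exp_le by (intro power_mono) auto
  finally show ?thesis .
qed

text \<open>Take \<open>r = n\<close> in \<open>abs_coeff_prod_linear_le\<close>. Each numerator is
  at most \<open>2 * n\<close>, and the denominators multiply to \<open>j! (n - 1 - j)!\<close>,
  whose inverse is at most \<open>2 ^ (n - 1) / (n - 1)!\<close>. With
  \<open>n ^ (n - 1) / (n - 1)! \<le> exp n \<le> 3 ^ n\<close> this leaves
  \<open>4 ^ n * 3 ^ n\<close>.\<close>

lemma abs_coeff_lagrange_poly_le:
  assumes "j < n"
  shows "\<bar>coeff (lagrange_poly n j) k\<bar> * real n ^ k \<le> 12 ^ n"
proof -
  have n: "n \<ge> 1" using assms by simp
  have "\<bar>coeff (lagrange_poly n j) k\<bar> * real n ^ k \<le>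
      (\<Prod>i\<in>{..<n} - {j}. \<bar>inverse (real j - real i)\<bar> * (\<bar>real i\<bar> + real n))"
    unfolding lagrange_poly_def by (rule abs_coeff_prod_linear_le) auto
  also have "\<dots> \<le> (\<Prod>i\<in>{..<n} - {j}. \<bar>inverse (real j - real i)\<bar> * (2 * real n))"
    by (intro prod_mono conjI mult_left_mono mult_nonneg_nonneg) auto
  also have "\<dots> = (\<Prod>i\<in>{..<n} - {j}. (2 * real n) / \<bar>real j - real i\<bar>)"
    by (intro prod.cong) (auto simp: divide_inverse abs_inverse mult.commute)
  also have "\<dots> = (\<Prod>i\<in>{..<n} - {j}. 2 * real n) / (\<Prod>i\<in>{..<n} - {j}. \<bar>real j - real i\<bar>)"
    by (rule prod_dividef)
  also have "\<dots> = (2 * real n) ^ (n - 1) / (fact j * fact (n - 1 - j))"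
    using assms by (simp add: prod_node_distances)
  also have "\<dots> \<le> (2 * real n) ^ (n - 1) * (2 ^ (n - 1) / fact (n - 1))"
  proof -
    have "real ((n - 1) choose j) \<le> 2 ^ (n - 1)"
      by (metis binomial_le_pow2 numeral_power_eq_of_nat_cancel_iff of_nat_le_iff of_nat_numeral of_nat_power)
    moreover have "real ((n - 1) choose j) = fact (n - 1) / (fact j * fact (n - 1 - j))"
      using assms by (intro binomial_fact) auto
    ultimately have "fact (n - 1) * inverse (fact j * fact (n - 1 - j)) \<le> (2 ^ (n - 1) :: real)"
      by (simp only: divide_inverse)
    then have "inverse (fact j * fact (n - 1 - j)) \<le> (2 ^ (n - 1) / fact (n - 1) :: real)"
      by (subst pos_le_divide_eq) (simp_all add: mult.commute)
    then show ?thesis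
      unfolding divide_inverse[of "(2 * real n) ^ (n - 1)"] by (intro mult_left_mono) auto
  qed
  also have "\<dots> = 4 ^ (n - 1) * (real n ^ (n - 1) / fact (n - 1))"
    by (simp add: power_mult_distrib mult_ac flip: power_mult_distrib[of 2 2])
  also have "\<dots> \<le> 4 ^ (n - 1) * 3 ^ n"
    using power_le_exp_fact[of "real n" "n - 1"] exp_of_nat_le[of n]
    by (intro mult_left_mono) (auto simp: divide_le_eq intro: order_trans mult_right_mono)
  also have "\<dots> \<le> 4 ^ n * 3 ^ n"
    by (intro mult_right_mono power_increasing) auto
  also have "\<dots> = 12 ^ n" by (simp flip: power_mult_distrib)
  finally show ?thesis .
qed

text \<open>A crude form of the integral remainder: the integrand is at most
  \<open>B * b ^ (n - 1) / (n - 1)!\<close> on an interval of length \<open>b\<close>.\<close>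

lemma taylor_remainder_le:
  fixes D :: "nat \<Rightarrow> real \<Rightarrow> complex"
  assumes "n > 0" "b \<ge> 0"
    and D: "\<And>j t. t \<ge> 0 \<Longrightarrow> (D j has_vector_derivative D (Suc j) t) (at t)"
    and B: "\<And>t. t \<ge> 0 \<Longrightarrow> cmod (D n t) \<le> B"
  shows "cmod (D 0 b - (\<Sum>i<n. (b ^ i / fact i) *\<^sub>R D i 0)) \<le> B * b ^ n / fact (n - 1)"
proof -
  let ?i = "\<lambda>x. ((b - x) ^ (n - 1) / fact (n - 1)) *\<^sub>R D n x"
  have "(?i has_integral D 0 b - (\<Sum>i<n. ((b - 0) ^ i / fact i) *\<^sub>R D i 0)) {0..b}"
  proof (rule Taylor_has_integral[OF assms(1) refl _ assms(2)])
    show "(D m has_vector_derivative D (Suc m) t) (at t within {0..b})" if "m < n" "0 \<le> t" "t \<le> b" for m t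
      using D[of t m] that by (auto intro: has_vector_derivative_at_within)
  qed
  note int = this
  have "cmod (D 0 b - (\<Sum>i<n. ((b - 0) ^ i / fact i) *\<^sub>R D i 0)) \<le> (b ^ (n - 1) / fact (n - 1) * B) * measure lborel {0..b}"
  proof (rule has_integral_bound_real[OF _ finite.emptyI int])
    fix x assume x: "x \<in> {0..b} - {}"
    then have "(b - x) ^ (n - 1) / fact (n - 1) * cmod (D n x) \<le> b ^ (n - 1) / fact (n - 1) * B"
      using B[of x] by (intro mult_mono divide_right_mono power_mono) auto
    then show "cmod (?i x) \<le> b ^ (n - 1) / fact (n - 1) * B" using x by simp
  next
    show "0 \<le> b ^ (n - 1) / fact (n - 1) * B"
      using assms(2) order_trans[OF norm_ge_zero B[of 0]] by simp
  qed
  also have "\<dots> = B * b ^ n / fact (n - 1)"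
    using assms by (simp add: power_eq_if)
  finally show ?thesis by simp
qed

text \<open>Sample \<open>D 0\<close> at the points \<open>j * h\<close> with \<open>j < n\<close>
  and Taylor expand each value at \<open>0\<close>. The Lagrange weights cancel all Taylor terms
  except that of order \<open>k\<close>, which is thus a combination of bounded values and
  remainders. The base is \<open>144 = 2 * 12 * 6\<close>, for the number of samples, the weights
  and the remainders.\<close>

lemma norm_deriv_zero_le:
  fixes D :: "nat \<Rightarrow> real \<Rightarrow> complex"
  assumes D: "\<And>j t. t \<ge> 0 \<Longrightarrow> (D j has_vector_derivative D (Suc j) t) (at t)"
    and A: "\<And>t. t \<ge> 0 \<Longrightarrow> cmod (D 0 t) \<le> A"
    and B: "\<And>t. t \<ge> 0 \<Longrightarrow> cmod (D n t) \<le> B"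
    and "h > 0" "k < n"
  shows "cmod (D k 0) * h ^ k \<le> 144 ^ n * (A + B * h ^ n)"
proof -
  define w where "w j = coeff (lagrange_poly n j) k" for j
  define R where "R j = D 0 (real j * h) - (\<Sum>i<n. ((real j * h) ^ i / fact i) *\<^sub>R D i 0)" for j
  have n: "n > 0" using assms by simp
  have A0: "A \<ge> 0" and B0: "B \<ge> 0"
    using order_trans[OF norm_ge_zero A[of 0]] order_trans[OF norm_ge_zero B[of 0]] by auto
  have R: "cmod (R j) \<le> 6 ^ n * (B * h ^ n)" if "j < n" for j
  proof -
    have "cmod (R j) \<le> B * (real j * h) ^ n / fact (n - 1)"
      unfolding R_def using assms n by (intro taylor_remainder_le[OF n _ D B]) auto
    also have "\<dots> = (B * h ^ n) * (real j ^ n / fact (n - 1))" by (simp add: power_mult_distrib)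
    also have "\<dots> \<le> (B * h ^ n) * 6 ^ n"
    proof (rule mult_left_mono)
      \<comment> \<open>\<open>n ^ n \<le> exp n * n!\<close> contributes \<open>3 ^ n\<close>, and
        \<open>n! = n * (n - 1)!\<close> another \<open>2 ^ n\<close>.\<close>
      have "real j ^ n \<le> real n ^ n" using that by (intro power_mono) auto
      also have "\<dots> \<le> exp (real n) * fact n" by (rule power_le_exp_fact) simp
      also have "\<dots> \<le> 3 ^ n * (2 ^ n * fact (n - 1))"
      proof (rule mult_mono)
        have "real n * fact (n - 1) \<le> 2 ^ n * fact (n - 1)"
          using of_nat_less_two_power[of n, where ?'a = real] by (intro mult_right_mono) auto
        then show "fact n \<le> (2 ^ n * fact (n - 1) :: real)"
          using fact_reduce[OF n, where ?'a = real] by simp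
      qed (use exp_of_nat_le in auto)
      also have "\<dots> = 6 ^ n * fact (n - 1)" by (simp flip: power_mult_distrib mult.assoc)
      finally show "real j ^ n / fact (n - 1) \<le> 6 ^ n" by (simp add: divide_le_eq)
    qed (use assms B0 in auto)
    finally show ?thesis by (simp add: mult.commute)
  qed
  have w: "\<bar>w j\<bar> * real n ^ k \<le> 12 ^ n" if "j < n" for j
    unfolding w_def by (rule abs_coeff_lagrange_poly_le[OF that])
  have "(\<Sum>j<n. w j *\<^sub>R D 0 (real j * h)) =
      (\<Sum>j<n. w j *\<^sub>R (\<Sum>i<n. ((real j * h) ^ i / fact i) *\<^sub>R D i 0)) + (\<Sum>j<n. w j *\<^sub>R R j)"
    by (simp add: R_def scaleR_diff_right sum_subtractf)
  also have "(\<Sum>j<n. w j *\<^sub>R (\<Sum>i<n. ((real j * h) ^ i / fact i) *\<^sub>R D i 0)) =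
      (\<Sum>i<n. (\<Sum>j<n. w j * real j ^ i) *\<^sub>R ((h ^ i / fact i) *\<^sub>R D i 0))"
    unfolding scaleR_sum_right scaleR_sum_left
    by (subst sum.swap) (simp add: power_mult_distrib mult.assoc)
  also have "\<dots> = (\<Sum>i<n. (if i = k then 1 else 0) *\<^sub>R ((h ^ i / fact i) *\<^sub>R D i 0))"
    using assms(5) by (intro sum.cong refl) (simp add: w_def sum_coeff_lagrange_poly)
  also have "\<dots> = (\<Sum>i<n. if i = k then (h ^ k / fact k) *\<^sub>R D k 0 else 0)"
    by (intro sum.cong) auto
  also have "\<dots> = (h ^ k / fact k) *\<^sub>R D k 0"
    using assms(5) by simp
  finally have "(h ^ k / fact k) *\<^sub>R D k 0 = (\<Sum>j<n. w j *\<^sub>R (D 0 (real j * h) - R j))"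
    by (simp add: scaleR_diff_right sum_subtractf)
  then have "cmod (D k 0) * (h ^ k / fact k) \<le> (\<Sum>j<n. \<bar>w j\<bar> * cmod (D 0 (real j * h) - R j))"
    using assms norm_sum[of "\<lambda>j. w j *\<^sub>R (D 0 (real j * h) - R j)" "{..<n}"]
    by (auto simp: mult.commute dest: arg_cong[where f = norm])
  also have "\<dots> \<le> (\<Sum>j<n. \<bar>w j\<bar> * (A + 6 ^ n * (B * h ^ n)))"
    using A R assms
    by (intro sum_mono mult_left_mono order_trans[OF norm_triangle_ineq4] add_mono) auto
  finally have "cmod (D k 0) * (h ^ k / fact k) * real n ^ k \<le> (\<Sum>j<n. \<bar>w j\<bar> * (A + 6 ^ n * (B * h ^ n))) * real n ^ k"
    by (intro mult_right_mono) auto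
  also have "\<dots> = (\<Sum>j<n. (\<bar>w j\<bar> * real n ^ k) * (A + 6 ^ n * (B * h ^ n)))"
    unfolding sum_distrib_right by (intro sum.cong refl) (simp only: mult_ac)
  also have "\<dots> \<le> (\<Sum>j<n. 12 ^ n * (A + 6 ^ n * (B * h ^ n)))"
    using A0 B0 assms w by (intro sum_mono mult_right_mono) auto
  also have "\<dots> = real n * 12 ^ n * (A + 6 ^ n * (B * h ^ n))" by simp
  also have "\<dots> \<le> 2 ^ n * 12 ^ n * (6 ^ n * (A + B * h ^ n))"
  proof (intro mult_mono)
    show "real n \<le> 2 ^ n" using of_nat_less_two_power[of n, where ?'a = real] by simp
    have "A \<le> 6 ^ n * A" using A0 one_le_power[of "6::real" n] mult_right_mono[of 1 "6 ^ n" A] by simp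
    then show "A + 6 ^ n * (B * h ^ n) \<le> 6 ^ n * (A + B * h ^ n)" by (simp add: distrib_left)
  qed (use A0 B0 assms in auto)
  also have "\<dots> = 144 ^ n * (A + B * h ^ n)" by (simp flip: power_mult_distrib mult.assoc)
  finally have "cmod (D k 0) * h ^ k * (real n ^ k / fact k) \<le> 144 ^ n * (A + B * h ^ n)" by simp
  \<comment> \<open>The bound on the weights carries the gain \<open>n ^ k\<close>, which
    compensates the \<open>k!\<close> of Taylor's formula; otherwise the estimate would not be
    geometric.\<close>
  moreover have "1 \<le> real n ^ k / fact k"
  proof -
    have "(fact k :: real) \<le> real (k ^ k)"
      using fact_le_power[of k, where ?'a = real] by simp
    also have "\<dots> \<le> real n ^ k" using assms by (simp add: power_mono)
    finally show ?thesis by simp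
  qed
  then have "cmod (D k 0) * h ^ k * 1 \<le> cmod (D k 0) * h ^ k * (real n ^ k / fact k)"
    using assms by (intro mult_left_mono) auto
  ultimately show ?thesis by simp
qed

text \<open>Take \<open>n = 2 * k\<close>, so that \<open>144 ^ 2 = 20736\<close>. The step
  \<open>h\<close> with \<open>h ^ (2 * k) = A / B\<close> balances the two terms. The case
  \<open>k = 0\<close> is separate, since \<open>norm_deriv_zero_le\<close> wants
  \<open>k < n\<close>.\<close>

lemma landau_half_line:
  fixes D :: "nat \<Rightarrow> real \<Rightarrow> complex"
  assumes D: "\<And>j t. t \<ge> 0 \<Longrightarrow> (D j has_vector_derivative D (Suc j) t) (at t)"
    and A: "\<And>t. t \<ge> 0 \<Longrightarrow> cmod (D 0 t) \<le> A"
    and B: "\<And>t. t \<ge> 0 \<Longrightarrow> cmod (D (2 * k) t) \<le> B"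
    and pos: "A > 0" "B > 0"
  shows "cmod (D k 0) \<le> 2 * 20736 ^ k * sqrt (A * B)"
proof (cases "k = 0")
  case True
  then have "cmod (D k 0) * cmod (D k 0) \<le> A * B"
    using A[of 0] B[of 0] pos by (intro mult_mono) auto
  then have "cmod (D k 0) \<le> sqrt (A * B)"
    by (intro real_le_rsqrt) (simp add: power2_eq_square)
  then show ?thesis using True pos by (simp add: order_trans[OF _ mult_right_mono[of 1 2]])
next
  case False
  define h where "h = root k (sqrt (A / B))"
  have h: "h > 0" "h ^ k = sqrt (A / B)"
    using False pos by (auto simp: h_def)
  have h2: "h ^ (2 * k) = A / B"
    using h(2) pos by (simp add: power_even_eq)
  have "cmod (D k 0) * sqrt (A / B) \<le> 144 ^ (2 * k) * (A + B * h ^ (2 * k))"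
    using norm_deriv_zero_le[OF D A B h(1), of k] False h(2) by simp
  also have "\<dots> = 20736 ^ k * (2 * A)"
    unfolding h2 using pos by (simp add: power_mult)
  also have "\<dots> = (2 * 20736 ^ k * sqrt (A * B)) * sqrt (A / B)"
    using pos by (simp add: real_sqrt_mult real_sqrt_divide field_simps)
  finally show ?thesis using pos by simp
qed

section \<open>Weighted bounds for derivatives\<close>

context weight
begin

text \<open>For \<open>\<sigma> = n\<close> and \<open>\<sigma> = - n\<close> the best constants \<open>R\<close> are the norms \<open>q\<^bsub>m,n\<^esub>\<close> and \<open>r\<^bsub>m,n\<^esub>\<close>.\<close>

definition wbound :: "nat \<Rightarrow> real \<Rightarrow> (real^'n::finite \<Rightarrow> complex) \<Rightarrow> real \<Rightarrow> bool" where
  "wbound m \<sigma> f R \<longleftrightarrow>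
     (\<forall>\<alpha> x. exp (\<sigma> * \<omega> (norm x)) * wt m (mlength \<alpha>) * cmod (mderiv \<alpha> f x) \<le> R)"

lemma wbound_nonneg:
  fixes f :: "real^'n::finite \<Rightarrow> complex"
  assumes "wbound m \<sigma> f R"
  shows "R \<ge> 0"
proof -
  let ?x = "0 :: real^'n" and ?\<alpha> = "\<lambda>_::'n. 0 :: nat"
  have "0 \<le> exp (\<sigma> * \<omega> (norm ?x)) * wt m (mlength ?\<alpha>) * cmod (mderiv ?\<alpha> f ?x)"
    by (intro mult_nonneg_nonneg) auto
  also have "\<dots> \<le> R" using assms unfolding wbound_def by blast
  finally show ?thesis .
qed

lemma wbound_mono:
  assumes "wbound m \<sigma> f R" "R \<le> R'" "\<sigma>' \<le> \<sigma>"
  shows "wbound m \<sigma>' f R'"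
  unfolding wbound_def
proof safe
  fix \<alpha> and x :: "real^'a"
  have "exp (\<sigma>' * \<omega> (norm x)) \<le> exp (\<sigma> * \<omega> (norm x))"
    using assms(3) omega_nonneg[of "norm x"] by (auto intro: mult_right_mono)
  then have "exp (\<sigma>' * \<omega> (norm x)) * wt m (mlength \<alpha>) * cmod (mderiv \<alpha> f x)
      \<le> exp (\<sigma> * \<omega> (norm x)) * wt m (mlength \<alpha>) * cmod (mderiv \<alpha> f x)"
    by (intro mult_right_mono) auto
  also have "\<dots> \<le> R'" using assms unfolding wbound_def by (meson order_trans)
  finally show "exp (\<sigma>' * \<omega> (norm x)) * wt m (mlength \<alpha>) * cmod (mderiv \<alpha> f x) \<le> R'" .
qed

text \<open>By \<open>subseq_word\<close> every subword is the word of some multi-index, so the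
  bound reaches all factors that occur in the Leibniz rule.\<close>

lemma wbound_word:
  assumes "wbound m \<sigma> f R" "subseq u (word \<alpha> coordinates)"
  shows "exp (\<sigma> * \<omega> (norm x)) * wt m (length u) * cmod (Dw u f x) \<le> R"
proof -
  obtain \<beta> where "u = word \<beta> coordinates"
    using subseq_word[OF coordinates(2) assms(2)] by blast
  then show ?thesis
    using assms(1) unfolding wbound_def mderiv_eq_Dw mlength_eq_length by blast
qed

text \<open>\<open>wt_superadditive\<close> distributes the weight over the two factors of each
  Leibniz term, and the exponents of \<omega> add up. \<open>m'\<close> and \<open>D\<close> are
  chosen before the functions, the exponents and the constants, so bounds uniform over sets of
  functions follow.\<close>

lemma wbound_mult:
  assumes "m \<ge> 1"
  shows "\<exists>m'\<ge>1. \<exists>D>0. \<forall>\<sigma> \<tau> R Q (f :: real^'n::finite \<Rightarrow> complex) g. smooth f \<longrightarrow> smooth g \<longrightarrow>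
    wbound m' \<sigma> f R \<longrightarrow> wbound m' \<tau> g Q \<longrightarrow> wbound m (\<sigma> + \<tau>) (\<lambda>x. f x * g x) (D * R * Q)"
proof -
  obtain m' D where m': "m' \<ge> 1" "D > 0" "\<And>k. 2 ^ k * wt m k \<le> D * wt m' k"
    using wt_geometric[OF assms, of 2] by auto
  have "wbound m (\<sigma> + \<tau>) (\<lambda>x. f x * g x) (D * R * Q)"
    if fg: "smooth f" "smooth g" "wbound m' \<sigma> f R" "wbound m' \<tau> g Q"
    for \<sigma> \<tau> R Q and f g :: "real^'n \<Rightarrow> complex"
    unfolding wbound_def
  proof safe
    fix \<alpha> and x :: "real^'n"
    let ?w = "word \<alpha> (coordinates :: 'n list)" and ?e = "exp ((\<sigma> + \<tau>) * \<omega> (norm x))"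
    let ?W = "wt m' (length ?w)"
    have RQ: "R \<ge> 0" "Q \<ge> 0" using fg wbound_nonneg by auto
    show "?e * wt m (mlength \<alpha>) * cmod (mderiv \<alpha> (\<lambda>x. f x * g x) x) \<le> D * R * Q"
    proof (cases "?W = 0")
      case True
      then have "wt m (length ?w) = 0"
        using m'(3) by (rule wt_eq_0_if_geometric[rotated 2]) simp
      then show ?thesis
        using RQ m'(2) by (simp add: mlength_eq_length)
    next
      case False
      then have W: "?W > 0" using wt_nonneg[of m' "length ?w"] by linarith
      have "cmod (Dw u f x) * cmod (Dw v g x) \<le> R * Q / (?e * ?W)"
        if uv: "subseq u ?w" "subseq v ?w" "length u + length v = length ?w" for u v
      proof -
        have "?e * ?W * (cmod (Dw u f x) * cmod (Dw v g x)) \<le>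
            ?e * (wt m' (length u) * wt m' (length v)) * (cmod (Dw u f x) * cmod (Dw v g x))"
          using wt_superadditive[OF m'(1), of "length u" "length v"] uv(3)
          by (intro mult_right_mono mult_left_mono) auto
        also have "\<dots> = (exp (\<sigma> * \<omega> (norm x)) * wt m' (length u) * cmod (Dw u f x)) *
            (exp (\<tau> * \<omega> (norm x)) * wt m' (length v) * cmod (Dw v g x))"
          by (simp add: distrib_right exp_add mult_ac)
        also have "\<dots> \<le> R * Q"
          using RQ by (intro mult_mono wbound_word[OF fg(3) uv(1)] wbound_word[OF fg(4) uv(2)]) auto
        finally show ?thesis using W by (simp add: pos_le_divide_eq mult.commute)
      qed
      then have "cmod (Dw ?w (\<lambda>x. f x * g x) x) \<le> 2 ^ length ?w * (R * Q / (?e * ?W))"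
        by (rule norm_Dw_mult_le[OF fg(1,2)])
      then have "?e * wt m (length ?w) * cmod (Dw ?w (\<lambda>x. f x * g x) x) \<le>
          ?e * wt m (length ?w) * (2 ^ length ?w * (R * Q / (?e * ?W)))"
        by (intro mult_left_mono) auto
      also have "\<dots> = (2 ^ length ?w * wt m (length ?w)) * (R * Q) / ?W"
        by simp
      also have "\<dots> \<le> (D * ?W) * (R * Q) / ?W"
        using W RQ m'(3) by (intro divide_right_mono mult_right_mono) auto
      also have "\<dots> = D * R * Q" using W by simp
      finally show ?thesis by (simp add: mderiv_eq_Dw mlength_eq_length)
    qed
  qed
  then show ?thesis using m' by blast
qed

definition H_space :: "(real^'n::finite \<Rightarrow> complex) set" where
  "H_space = {f. smooth f \<and> (\<forall>m\<ge>1. \<forall>n::nat. \<exists>R. wbound m (real n) f R)}"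

text \<open>The growth index \<open>k\<close> of \<open>f\<close> is the same for all
  \<open>m\<close>; the decay index \<open>n + k\<close> of \<open>g\<close> makes up for
  it.\<close>

lemma H_space_mult:
  assumes "smooth f" "\<And>m. m \<ge> 1 \<Longrightarrow> \<exists>R. wbound m (- real k) f R" "g \<in> H_space"
  shows "(\<lambda>x. f x * g x) \<in> H_space"
  unfolding H_space_def
proof (intro CollectI conjI allI impI)
  have g: "smooth g" "\<And>m n. m \<ge> 1 \<Longrightarrow> \<exists>R. wbound m (real n) g R"
    using assms(3) unfolding H_space_def by auto
  show "smooth (\<lambda>x. f x * g x)" using assms(1) g(1) by (rule smooth_mult)
  fix m n :: nat assume "m \<ge> 1"
  then obtain m' D where m': "m' \<ge> 1"
    "\<And>\<sigma> \<tau> R Q. wbound m' \<sigma> f R \<Longrightarrow> wbound m' \<tau> g Q \<Longrightarrow> wbound m (\<sigma> + \<tau>) (\<lambda>x. f x * g x) (D * R * Q)"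
    using wbound_mult[of m] assms(1) g(1) by metis
  obtain R Q where "wbound m' (- real k) f R" "wbound m' (real (n + k)) g Q"
    using assms(2)[OF m'(1)] g(2)[OF m'(1)] by blast
  from m'(2)[OF this] show "\<exists>R. wbound m (real n) (\<lambda>x. f x * g x) R" by auto
qed

lemma omega_decay_rapid:
  fixes h :: "real^'n::finite \<Rightarrow> complex"
  assumes "continuous_on UNIV h" "\<And>n::nat. n \<ge> 1 \<Longrightarrow> \<exists>C. \<forall>x. exp (real n * \<omega> (norm x)) * cmod (h x) \<le> C"
  shows "rapid h"
  unfolding rapid_def
proof (intro conjI allI)
  fix k
  obtain n C where n: "n \<ge> 1" "C > 0" "\<And>t. t \<ge> 0 \<Longrightarrow> (1 + t) ^ k \<le> C * exp (real n * \<omega> t)"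
    using poly_le_exp_omega[of k] by blast
  obtain B where B: "\<And>x. exp (real n * \<omega> (norm x)) * cmod (h x) \<le> B"
    using assms(2)[OF n(1)] by blast
  have "(1 + norm x) ^ k * cmod (h x) \<le> C * B" for x
  proof -
    have "(1 + norm x) ^ k * cmod (h x) \<le> (C * exp (real n * \<omega> (norm x))) * cmod (h x)"
      using n(3) by (intro mult_right_mono) auto
    also have "\<dots> \<le> C * B"
      using B n(2) by (simp add: mult.assoc)
    finally show ?thesis .
  qed
  then show "\<exists>C. \<forall>x. (1 + norm x) ^ k * cmod (h x) \<le> C" by blast
qed (fact assms(1))

text \<open>The index \<open>b\<close> makes the constant uniform over a family;
  \<open>H_space_ft_pow_bound\<close> uses it with all multi-indices at once.\<close>

lemma omega_decay_le_inverse_polynomial: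
  fixes h :: "real^'n::finite \<Rightarrow> 'b \<Rightarrow> real"
  assumes "\<And>n::nat. n \<ge> 1 \<Longrightarrow> \<exists>C. \<forall>x b. exp (real n * \<omega> (norm x)) * h x b \<le> C" "\<And>x b. h x b \<ge> 0"
  shows "\<exists>C\<ge>0. \<forall>x b. exp (real m * \<omega> (norm x)) * h x b \<le> C * inverse ((1 + norm x) ^ k)"
proof -
  obtain n C where n: "n \<ge> 1" "C > 0" "\<And>t. t \<ge> 0 \<Longrightarrow> (1 + t) ^ k \<le> C * exp (real n * \<omega> t)"
    using poly_le_exp_omega[of k] by blast
  obtain B where B: "\<And>x b. exp (real (m + n) * \<omega> (norm x)) * h x b \<le> B"
    using assms(1)[of "m + n"] n(1) by auto
  have B0: "B \<ge> 0"
    using order_trans[OF _ B[of 0 undefined]] assms(2) by simp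
  have "exp (real m * \<omega> (norm x)) * h x b \<le> (C * B) * inverse ((1 + norm x) ^ k)" for x b
  proof -
    have p: "(1 + norm x) ^ k > 0" by (intro zero_less_power add_pos_nonneg) auto
    have "(1 + norm x) ^ k * (exp (real m * \<omega> (norm x)) * h x b) \<le>
        (C * exp (real n * \<omega> (norm x))) * (exp (real m * \<omega> (norm x)) * h x b)"
      using n(3) assms(2) by (intro mult_right_mono mult_nonneg_nonneg) auto
    also have "\<dots> = C * ((exp (real m * \<omega> (norm x)) * exp (real n * \<omega> (norm x))) * h x b)"
      by simp
    also have "exp (real m * \<omega> (norm x)) * exp (real n * \<omega> (norm x)) = exp (real (m + n) * \<omega> (norm x))"
      by (simp add: distrib_right exp_add)
    also have "C * (exp (real (m + n) * \<omega> (norm x)) * h x b) \<le> C * B" using B n(2) by (intro mult_left_mono) auto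
    finally show ?thesis using p by (simp add: field_simps)
  qed
  then show ?thesis using B0 n(2) by (intro exI[of _ "C * B"]) auto
qed

section \<open>From membership in the space to finite norms\<close>

lemma sup_norm_finite_iff: "sup_norm f < \<infinity> \<longleftrightarrow> (\<exists>C. \<forall>x. cmod (f x) \<le> C)"
proof
  assume fin: "sup_norm f < \<infinity>"
  have "cmod (f x) \<le> enn2real (sup_norm f)" for x
  proof -
    have "ennreal (cmod (f x)) \<le> sup_norm f"
      unfolding sup_norm_def by (rule SUP_upper) simp
    then show ?thesis using fin by (cases "sup_norm f") (auto simp: ennreal_le_iff)
  qed
  then show "\<exists>C. \<forall>x. cmod (f x) \<le> C" by blast
next
  assume "\<exists>C. \<forall>x. cmod (f x) \<le> C"
  then obtain C where "\<And>x. cmod (f x) \<le> C" by blast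
  then have "sup_norm f \<le> ennreal C"
    unfolding sup_norm_def by (intro SUP_least ennreal_leI)
  then show "sup_norm f < \<infinity>" by (metis ennreal_less_top infinity_ennreal_def order_le_less_trans)
qed

text \<open>Since \<omega> is nonnegative, the bounds for natural exponents \<open>n \<ge> 1\<close>
  imply those for all real \<open>l > 0\<close>.\<close>

lemma S_space_iff:
  "f \<in> S_space \<omega> \<longleftrightarrow> integrable lborel f \<and> smooth f \<and> smooth (fourier f) \<and>
    (\<forall>n\<ge>1::nat. \<forall>\<alpha>. (\<exists>C. \<forall>x. exp (real n * \<omega> (norm x)) * cmod (mderiv \<alpha> f x) \<le> C) \<and>
      (\<exists>C. \<forall>x. exp (real n * \<omega> (norm x)) * cmod (mderiv \<alpha> (fourier f) x) \<le> C))"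
proof -
  have *: "(\<forall>l>0. \<forall>\<alpha>. sup_norm (\<lambda>x. complex_of_real (exp (l * \<omega> (norm x))) * mderiv \<alpha> h x) < \<infinity>) \<longleftrightarrow>
    (\<forall>n\<ge>1::nat. \<forall>\<alpha>. \<exists>C. \<forall>x. exp (real n * \<omega> (norm x)) * cmod (mderiv \<alpha> h x) \<le> C)" for h :: "real^'n \<Rightarrow> complex"
  proof (intro iffI allI impI)
    fix n :: nat and \<alpha>
    assume "\<forall>l>0. \<forall>\<alpha>. sup_norm (\<lambda>x. complex_of_real (exp (l * \<omega> (norm x))) * mderiv \<alpha> h x) < \<infinity>" "n \<ge> 1"
    then have "sup_norm (\<lambda>x. complex_of_real (exp (real n * \<omega> (norm x))) * mderiv \<alpha> h x) < \<infinity>" by simp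
    then show "\<exists>C. \<forall>x. exp (real n * \<omega> (norm x)) * cmod (mderiv \<alpha> h x) \<le> C"
      unfolding sup_norm_finite_iff by (simp add: norm_mult)
  next
    fix l :: real and \<alpha>
    assume *: "\<forall>n\<ge>1::nat. \<forall>\<alpha>. \<exists>C. \<forall>x. exp (real n * \<omega> (norm x)) * cmod (mderiv \<alpha> h x) \<le> C" "l > 0"
    obtain n :: nat where n: "l \<le> real n" using real_arch_simple by blast
    with \<open>l > 0\<close> have "n \<ge> 1" by (cases n) auto
    then obtain C where C: "\<And>x. exp (real n * \<omega> (norm x)) * cmod (mderiv \<alpha> h x) \<le> C"
      using * by blast
    have "cmod (complex_of_real (exp (l * \<omega> (norm x))) * mderiv \<alpha> h x) \<le> C" for x
    proof -
      have "exp (l * \<omega> (norm x)) * cmod (mderiv \<alpha> h x) \<le> exp (real n * \<omega> (norm x)) * cmod (mderiv \<alpha> h x)"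
        using n omega_nonneg[of "norm x"] by (intro mult_right_mono) (auto intro: mult_right_mono)
      then show ?thesis using C[of x] by (simp add: norm_mult)
    qed
    then show "sup_norm (\<lambda>x. complex_of_real (exp (l * \<omega> (norm x))) * mderiv \<alpha> h x) < \<infinity>"
      unfolding sup_norm_finite_iff by blast
  qed
  show ?thesis
    unfolding S_space_def mem_Collect_eq using *[of f] *[of "fourier f"] by blast
qed

lemma mderiv_zero: "mderiv (\<lambda>_. 0) f = f"
proof -
  have "word (\<lambda>_. 0) is = []" for "is" :: "'a list" by (induction "is") (auto simp: word_Cons)
  then show ?thesis by (simp add: mderiv_eq_Dw)
qed

text \<open>The bound comes from the inversion formula: differentiation is multiplication by monomials on the
  Fourier side, and these are dominated by \<open>exp (m * \<omega>)\<close>.\<close>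

lemma S_space_deriv_bound:
  fixes f :: "real^'n::finite \<Rightarrow> complex"
  assumes f: "f \<in> S_space \<omega>" and m: "m \<ge> 1"
  shows "\<exists>C>0. \<forall>w x. wt m (length w) * cmod (Dw w f x) \<le> C"
proof -
  define g where "g = fourier f"
  have fd: "\<exists>C. \<forall>x. exp (real n * \<omega> (norm x)) * cmod (f x) \<le> C" and
    gd: "\<exists>C. \<forall>x. exp (real n * \<omega> (norm x)) * cmod (g x) \<le> C" if "n \<ge> 1" for n :: nat
    using f that unfolding S_space_iff g_def by (metis mderiv_zero)+
  have "smooth f" "smooth g" using f unfolding S_space_iff g_def by auto
  then have rf: "rapid f" and rg: "rapid g"
    using fd gd by (auto intro!: omega_decay_rapid smooth_continuous)
  define c where "c = (LINT z|lborel. gauss (z::real^'n))\<^sup>2"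
  have c: "c \<noteq> 0" using integral_gauss_nonzero by (simp add: c_def)
  have f_eq: "f = (\<lambda>x. inverse c * ft 1 g x)"
    using ft_inversion[OF rf, of "-1"] rg c by (simp add: g_def fourier_eq_ft c_def fun_eq_iff)
  obtain C where C: "C \<ge> 0" "\<And>x. exp (real m * \<omega> (norm x)) * cmod (g x) \<le> C * inv_poly x"
    using omega_decay_le_inverse_polynomial[of "\<lambda>x (_::unit). cmod (g x)" m "2 * DIM(real^'n)"] gd by auto
  define I where "I = (LINT x|lborel. inv_poly (x::real^'n))"
  have "wt m (length w) * cmod (Dw w f x) \<le> cmod (inverse c) * (C * I)" for w x
  proof -
    have r: "rapid (\<lambda>x. symb 1 w x * g x)" by (rule rapid_symb_mult[OF rg])
    have "Dw w f x = inverse c * ft 1 (\<lambda>x. symb 1 w x * g x) x"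
      by (subst f_eq) (simp add: Dw_cmult smooth_ft rg Dw_ft)
    then have "wt m (length w) * cmod (Dw w f x) = cmod (inverse c) * (wt m (length w) * cmod (ft 1 (\<lambda>x. symb 1 w x * g x) x))"
      by (simp add: norm_mult)
    also have "\<dots> \<le> cmod (inverse c) * (wt m (length w) * (LINT x|lborel. cmod (symb 1 w x * g x)))"
      by (intro mult_left_mono norm_ft_le r) auto
    also have "wt m (length w) * (LINT x|lborel. cmod (symb 1 w x * g x)) = (LINT x|lborel. wt m (length w) * cmod (symb 1 w x * g x))"
      by simp
    also have "\<dots> \<le> (LINT x|lborel. C * inv_poly (x::real^'n))"
    proof (rule integral_mono)
      show "integrable lborel (\<lambda>x. wt m (length w) * cmod (symb 1 w x * g x))"
        by (intro integrable_mult_right integrable_norm rapid_integrable r)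
      show "integrable lborel (\<lambda>x::real^'n. C * inv_poly x)"
        by (intro integrable_mult_right integrable_inverse_polynomial)
      fix x :: "real^'n"
      have "wt m (length w) * cmod (symb 1 w x * g x) \<le> wt m (length w) * (norm x ^ length w * cmod (g x))"
        unfolding norm_mult by (intro mult_left_mono mult_right_mono norm_symb_le) auto
      also have "\<dots> \<le> exp (real m * \<omega> (norm x)) * cmod (g x)"
        unfolding mult.assoc[symmetric] by (intro mult_right_mono wt_pow_le' m) auto
      also have "\<dots> \<le> C * inv_poly x" by (rule C(2))
      finally show "wt m (length w) * cmod (symb 1 w x * g x) \<le> \<dots>" .
    qed
    also have "\<dots> = C * I" by (simp add: I_def)
    finally show ?thesis by (simp add: mult_left_mono)
  qed
  moreover have "cmod (inverse c) * (C * I) \<le> \<bar>cmod (inverse c) * (C * I)\<bar> + 1" by linarith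
  ultimately have "\<forall>w x. wt m (length w) * cmod (Dw w f x) \<le> \<bar>cmod (inverse c) * (C * I)\<bar> + 1"
    by (blast intro: order_trans)
  moreover have "\<bar>cmod (inverse c) * (C * I)\<bar> + 1 > 0" by linarith
  ultimately show ?thesis by blast
qed

text \<open>If the direction has the sign of \<open>x $ i\<close>, the mixed term in the square of
  the norm is nonnegative. The weight along the half-line is then at least the weight at
  \<open>x\<close>.\<close>

lemma norm_le_outward:
  fixes x :: "real^'n::finite"
  assumes "\<sigma> * x $ i \<ge> 0" "t \<ge> 0"
  shows "norm x \<le> norm (x + (\<sigma> * t) *\<^sub>R axis i 1)"
proof -
  have "0 \<le> t * (\<sigma> * x $ i)" using assms by simp
  then have "(norm x)\<^sup>2 \<le> (norm (x + (\<sigma> * t) *\<^sub>R axis i 1))\<^sup>2"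
    unfolding norm_sq_along by (simp add: algebra_simps)
  then show ?thesis by (rule power2_le_imp_le) simp
qed

text \<open>Interpolating with \<open>landau_half_line\<close> in the direction pointing away from the origin transfers the
  decay of \<open>f\<close> to its derivatives, one coordinate at a time.\<close>

lemma S_space_weighted_deriv_bound:
  fixes f :: "real^'n::finite \<Rightarrow> complex"
  assumes f: "f \<in> S_space \<omega>" and "m \<ge> 1"
  shows "\<exists>C>0. \<forall>\<alpha> x. exp (real n * \<omega> (norm x)) * wt m (length (word \<alpha> is)) * cmod (Dw (word \<alpha> is) f x) \<le> C"
  using assms(2)
proof (induction "is" arbitrary: m n)
  case Nil
  have "\<exists>C. \<forall>x. exp (real n * \<omega> (norm x)) * cmod (f x) \<le> C"
  proof -
    obtain C where C: "\<And>x. exp (real (Suc n) * \<omega> (norm x)) * cmod (f x) \<le> C"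
      using f unfolding S_space_iff by (metis mderiv_zero le_add1 plus_1_eq_Suc)
    have "exp (real n * \<omega> (norm x)) * cmod (f x) \<le> C" for x
    proof -
      have "exp (real n * \<omega> (norm x)) * cmod (f x) \<le> exp (real (Suc n) * \<omega> (norm x)) * cmod (f x)"
        using omega_nonneg[of "norm x"] by (intro mult_right_mono) (auto intro: mult_right_mono)
      then show ?thesis using C[of x] by linarith
    qed
    then show ?thesis by blast
  qed
  then obtain C where "\<And>x. exp (real n * \<omega> (norm x)) * cmod (f x) \<le> C" by blast
  moreover have "C \<le> \<bar>C\<bar> + 1" "\<bar>C\<bar> + 1 > 0" by linarith+
  ultimately have "\<forall>x. exp (real n * \<omega> (norm x)) * cmod (f x) \<le> \<bar>C\<bar> + 1" "\<bar>C\<bar> + 1 > 0"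
    by (blast intro: order_trans)+
  then show ?case
    using Nil by (intro exI[of _ "\<bar>C\<bar> + 1"]) (simp add: wt_0)
next
  case (Cons i "is")
  have sf: "smooth f" using f unfolding S_space_iff by blast
  \<comment> \<open>\<open>20736\<close> is the geometric constant of
    \<open>landau_half_line\<close>.\<close>
  obtain m' D where m': "m' \<ge> 1" "D > 0" "\<And>k. 20736 ^ k * wt m k \<le> D * wt m' k"
    using wt_geometric[OF Cons.prems, of 20736] by auto
  have m2: "2 * m' \<ge> 1" using m' by simp
  \<comment> \<open>Interpolation takes a square root, so the bound for the lower order is requested
    with \<open>n\<close> and \<open>m'\<close> doubled.\<close>
  obtain C1 where C1: "C1 > 0" "\<And>\<alpha> x. exp (real (2 * n) * \<omega> (norm x)) * wt (2 * m') (length (word \<alpha> is)) * cmod (Dw (word \<alpha> is) f x) \<le> C1"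
    using Cons.IH[OF m2, of "2 * n"] by blast
  \<comment> \<open>For the upper order no decay in \<open>x\<close> is known yet. The bound without
    a weight in \<open>x\<close> suffices, because the decay is taken from the lower order.\<close>
  obtain C2 where C2: "C2 > 0" "\<And>w x. wt (2 * m') (length w) * cmod (Dw w f x) \<le> C2"
    using S_space_deriv_bound[OF f m2] by blast
  have "exp (real n * \<omega> (norm x)) * wt m (length (word \<alpha> (i # is))) * cmod (Dw (word \<alpha> (i # is)) f x) \<le> 2 * D * sqrt (C1 * C2)" for \<alpha> x
  proof -
    define v where "v = word \<alpha> is"
    define k where "k = \<alpha> i"
    define a where "a = length v"
    define e where "e = exp (real n * \<omega> (norm x))"
    have w: "word \<alpha> (i # is) = replicate k i @ v" by (simp add: word_Cons v_def k_def)
    have len: "length (word \<alpha> (i # is)) = a + k" by (simp add: w a_def)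
    show ?thesis
    proof (cases "wt m' (a + k) = 0")
      case True
      then have "wt m (a + k) = 0"
        using m'(3) by (rule wt_eq_0_if_geometric[rotated 2]) simp
      then show ?thesis unfolding len using m'(2) C1(1) C2(1) by simp
    next
      case False
      then have W: "wt m' (a + k) > 0" using wt_nonneg[of m' "a + k"] by linarith
      have mid: "wt m' (a + k) ^ 2 \<le> wt (2 * m') a * wt (2 * m') (a + 2 * k)"
        by (rule wt_midpoint[OF m'(1)])
      then have "0 < wt (2 * m') a * wt (2 * m') (a + 2 * k)"
        using W zero_less_power[OF W, of 2] by linarith
      then have Wa: "wt (2 * m') a > 0" "wt (2 * m') (a + 2 * k) > 0"
        using wt_nonneg[of "2 * m'" a] wt_nonneg[of "2 * m'" "a + 2 * k"] by (auto simp: zero_less_mult_iff)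
      \<comment> \<open>\<open>A\<close> and \<open>B\<close> bound, along the half-line, the
        derivative for the word \<open>v\<close> and the one with \<open>2 * k\<close> further
        derivatives in direction \<open>i\<close>; the target order \<open>a + k\<close> lies
        halfway.\<close>
      define A where "A = C1 / (e\<^sup>2 * wt (2 * m') a)"
      define B where "B = C2 / wt (2 * m') (a + 2 * k)"
      have e: "e > 0" by (simp add: e_def)
      have AB: "A > 0" "B > 0" using Wa C1 C2 e by (auto simp: A_def B_def)
      define \<sigma> :: real where "\<sigma> = (if x $ i \<ge> 0 then 1 else - 1)"
      have \<sigma>: "\<bar>\<sigma>\<bar> = 1" "\<sigma> * x $ i \<ge> 0" by (auto simp: \<sigma>_def)
      define G where "G j t = \<sigma> ^ j *\<^sub>R Dw (replicate j i @ v) f (x + (\<sigma> * t) *\<^sub>R axis i 1)" for j t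
      have normG: "cmod (G j t) = cmod (Dw (replicate j i @ v) f (x + (\<sigma> * t) *\<^sub>R axis i 1))" for j t
        using \<sigma>(1) by (simp add: G_def power_abs)
      have "cmod (G k 0) \<le> 2 * 20736 ^ k * sqrt (A * B)"
      proof (rule landau_half_line)
        show "(G j has_vector_derivative G (Suc j) t) (at t)" for j t
        proof -
          have "has_pd i (Dw (replicate j i @ v) f) (Dw (replicate (Suc j) i @ v) f)"
            using smooth_has_pd[OF smooth_Dw[OF sf], of i "replicate j i @ v"] by (simp add: Dw_Cons)
          from has_vector_derivative_scaleR[OF DERIV_const has_pd_along[OF this, of x \<sigma> t], of "\<sigma> ^ j"]
          show ?thesis unfolding G_def by (simp add: mult.commute)
        qed
        show "cmod (G 0 t) \<le> A" if "t \<ge> 0" for t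
        proof -
          let ?y = "x + (\<sigma> * t) *\<^sub>R axis i 1"
          have "\<omega> (norm x) \<le> \<omega> (norm ?y)"
            by (intro omega_mono norm_le_outward \<sigma> that) auto
          then have "e\<^sup>2 \<le> exp (real (2 * n) * \<omega> (norm ?y))"
            unfolding e_def exp_double[symmetric] by (simp add: mult_left_mono)
          then have "e\<^sup>2 * wt (2 * m') a * cmod (Dw v f ?y) \<le>
              exp (real (2 * n) * \<omega> (norm ?y)) * wt (2 * m') a * cmod (Dw v f ?y)"
            by (intro mult_right_mono) auto
          also have "\<dots> \<le> C1" using C1(2)[of ?y \<alpha>] by (simp add: v_def a_def)
          finally show ?thesis
            using e Wa by (simp add: normG A_def pos_le_divide_eq mult.commute)
        qed
        show "cmod (G (2 * k) t) \<le> B" for t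
          using C2(2)[of "replicate (2 * k) i @ v" "x + (\<sigma> * t) *\<^sub>R axis i 1"] Wa
          by (simp add: normG B_def a_def pos_le_divide_eq mult.commute add.commute)
      qed (use AB in auto)
      also have "sqrt (A * B) = sqrt (C1 * C2) / (e * sqrt (wt (2 * m') a * wt (2 * m') (a + 2 * k)))"
        using e by (simp add: A_def B_def real_sqrt_divide real_sqrt_mult)
      also have "\<dots> \<le> sqrt (C1 * C2) / (e * wt m' (a + k))"
        using e W C1(1) C2(1) mid Wa
        by (intro divide_left_mono mult_left_mono real_le_rsqrt mult_pos_pos) auto
      finally have "cmod (G k 0) \<le> 2 * 20736 ^ k * (sqrt (C1 * C2) / (e * wt m' (a + k)))"
        by simp
      then have "e * wt m (a + k) * cmod (G k 0) \<le> e * wt m (a + k) * (2 * 20736 ^ k * (sqrt (C1 * C2) / (e * wt m' (a + k))))"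
        using e by (intro mult_left_mono) auto
      also have "\<dots> = 2 * sqrt (C1 * C2) * (20736 ^ k * wt m (a + k)) / wt m' (a + k)"
        using e by simp
      also have "\<dots> \<le> 2 * sqrt (C1 * C2) * (D * wt m' (a + k)) / wt m' (a + k)"
      proof -
        have "20736 ^ k * wt m (a + k) \<le> 20736 ^ (a + k) * wt m (a + k)"
          by (intro mult_right_mono power_increasing) auto
        also have "\<dots> \<le> D * wt m' (a + k)" by (rule m'(3))
        finally show ?thesis using W C1(1) C2(1) by (intro divide_right_mono mult_left_mono) auto
      qed
      also have "\<dots> = 2 * D * sqrt (C1 * C2)" using W by simp
      finally show ?thesis
        unfolding len by (simp add: normG w e_def mult.assoc)
    qed
  qed
  then show ?case using m'(2) C1(1) C2(1) by (intro exI[of _ "2 * D * sqrt (C1 * C2)"]) auto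
qed

lemma S_space_subset_H_space: "S_space \<omega> \<subseteq> (H_space :: (real^'n::finite \<Rightarrow> complex) set)"
proof
  fix f :: "real^'n \<Rightarrow> complex" assume f: "f \<in> S_space \<omega>"
  have "\<exists>R. wbound m (real n) f R" if "m \<ge> 1" for m n
    using S_space_weighted_deriv_bound[OF f that, of n coordinates]
    unfolding wbound_def mderiv_eq_Dw mlength_eq_length by blast
  moreover have "smooth f" using f unfolding S_space_iff by blast
  ultimately show "f \<in> H_space" unfolding H_space_def by blast
qed

section \<open>From finite norms to decay of the Fourier transform\<close>

lemma H_space_decay:
  fixes h :: "real^'n::finite \<Rightarrow> complex"
  assumes "h \<in> H_space"
  shows "\<exists>C. \<forall>x. exp (real n * \<omega> (norm x)) * cmod (mderiv \<alpha> h x) \<le> C"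
proof -
  obtain m where m: "m \<ge> 1" "wt m (mlength \<alpha>) > 0" using wt_pos by blast
  obtain R where R: "wbound m (real n) h R"
    using assms m(1) unfolding H_space_def by blast
  have "exp (real n * \<omega> (norm x)) * cmod (mderiv \<alpha> h x) \<le> R / wt m (mlength \<alpha>)" for x
    using R m(2) unfolding wbound_def by (simp add: pos_le_divide_eq mult_ac)
  then show ?thesis by blast
qed

lemma H_space_smooth: "h \<in> H_space \<Longrightarrow> smooth h"
  by (simp add: H_space_def)

lemma rapid_mderiv_H_space: "h \<in> H_space \<Longrightarrow> rapid (mderiv \<alpha> h)"
  unfolding mderiv_eq_Dw
  by (intro omega_decay_rapid smooth_continuous smooth_Dw H_space_smooth)
     (auto dest: H_space_decay simp flip: mderiv_eq_Dw)

lemma rapid_H_space: "h \<in> H_space \<Longrightarrow> rapid h"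
  using rapid_mderiv_H_space[of h "\<lambda>_. 0"] by (simp add: mderiv_zero)

text \<open>All derivatives of a coordinate function are bounded by \<open>1 + norm x\<close>, hence
  by a multiple of \<open>exp (k * \<omega> (norm x))\<close>. Such a function is of the growth type
  that \<open>H_space_mult\<close> admits.\<close>

lemma H_space_mult_coord:
  fixes h :: "real^'n::finite \<Rightarrow> complex"
  assumes "h \<in> H_space"
  shows "(\<lambda>x. (c * complex_of_real (x $ i)) * h x) \<in> H_space"
proof -
  obtain k C where k: "k \<ge> 1" "C > 0" "\<And>t. t \<ge> 0 \<Longrightarrow> (1 + t) ^ 1 \<le> C * exp (real k * \<omega> t)"
    using poly_le_exp_omega[of 1] by blast
  show ?thesis
  proof (rule H_space_mult[OF _ _ assms])
    show "smooth (\<lambda>x. c * complex_of_real (x $ i))"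
      by (intro smooth_cmult smooth_coord)
    fix m :: nat assume m: "m \<ge> 1"
    have "exp (- real k * \<omega> (norm x)) * wt m (mlength \<alpha>) * cmod (mderiv \<alpha> (\<lambda>x. c * complex_of_real (x $ i)) x) \<le> cmod c * C"
      for \<alpha> and x :: "real^'n"
    proof -
      have "cmod (mderiv \<alpha> (\<lambda>x. c * complex_of_real (x $ i)) x) \<le> cmod c * (1 + norm x)"
        unfolding mderiv_eq_Dw
        by (subst Dw_cmult[OF smooth_coord]) (simp add: norm_mult mult_left_mono norm_Dw_coord_le)
      also have "\<dots> \<le> cmod c * (C * exp (real k * \<omega> (norm x)))"
        using k(3)[of "norm x"] by (intro mult_left_mono) auto
      finally have "exp (- real k * \<omega> (norm x)) * wt m (mlength \<alpha>) * cmod (mderiv \<alpha> (\<lambda>x. c * complex_of_real (x $ i)) x)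
          \<le> exp (- real k * \<omega> (norm x)) * 1 * (cmod c * (C * exp (real k * \<omega> (norm x))))"
        using wt_le_1[OF m] by (intro mult_mono) auto
      also have "\<dots> = cmod c * C" by (simp add: exp_minus)
      finally show ?thesis .
    qed
    then show "\<exists>R. wbound m (- real k) (\<lambda>x. c * complex_of_real (x $ i)) R"
      unfolding wbound_def by blast
  qed
qed

lemma H_space_mult_symb: "h \<in> H_space \<Longrightarrow> (\<lambda>x. symb s w x * h x) \<in> H_space"
proof (induction w)
  case (Cons i w)
  then show ?case
    using H_space_mult_coord[of "\<lambda>x. symb s w x * h x" "\<i> * s" i] by (simp add: mult.assoc)
qed simp

lemma mderiv_single: "mderiv (\<lambda>j. if j = i then k else 0) h = Dw (replicate k i) h"
  by (simp add: mderiv_eq_Dw word_single coordinates)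

lemma mlength_single: "mlength (\<lambda>j. if j = i then k else 0) = k"
  by (simp add: mlength_eq_length word_single coordinates)

lemma ft_Dw_replicate:
  assumes "h \<in> H_space"
  shows "ft s (Dw (replicate k i) h) \<xi> = (- (\<i> * s * complex_of_real (\<xi> $ i))) ^ k * ft s h \<xi>"
proof (induction k)
  case (Suc k)
  have r: "rapid (Dw (replicate k i) h)" for k
    using rapid_mderiv_H_space[OF assms] mderiv_single[of i k h] by metis
  have "has_pd i (Dw (replicate k i) h) (Dw (replicate (Suc k) i) h)"
    using smooth_has_pd[OF smooth_Dw[OF H_space_smooth[OF assms]]] by (simp add: Dw_Cons)
  then show ?case
    using ft_partial_deriv[OF r r, of i k "Suc k" s \<xi>] Suc by (simp add: mult.assoc)
qed simp

text \<open>Integrate by parts \<open>k\<close> times in a single coordinate. The constant does not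
  depend on \<open>k\<close> because one norm bounds the derivatives of all orders
  simultaneously.\<close>

lemma H_space_ft_pow_bound:
  fixes h :: "real^'n::finite \<Rightarrow> complex"
  assumes "h \<in> H_space" "\<bar>s\<bar> = 1" "m \<ge> 1"
  shows "\<exists>C\<ge>0. \<forall>k i \<xi>. wt m k * \<bar>\<xi> $ i\<bar> ^ k * cmod (ft s h \<xi>) \<le> C"
proof -
  have "\<exists>C. \<forall>x \<alpha>. exp (real n * \<omega> (norm x)) * (wt m (mlength \<alpha>) * cmod (mderiv \<alpha> h x)) \<le> C" for n
    using assms(1,3) unfolding H_space_def wbound_def by (simp add: mult.assoc) blast
  then obtain C where C: "C \<ge> 0" "\<And>x \<alpha>. wt m (mlength \<alpha>) * cmod (mderiv \<alpha> h x) \<le> C * inv_poly x"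
    using omega_decay_le_inverse_polynomial[of "\<lambda>x \<alpha>. wt m (mlength \<alpha>) * cmod (mderiv \<alpha> h x)" 0 "2 * DIM(real^'n)"] by auto
  define I where "I = (LINT x|lborel. inv_poly (x::real^'n))"
  have "I \<ge> 0" unfolding I_def by (rule integral_nonneg_AE) auto
  have "wt m k * \<bar>\<xi> $ i\<bar> ^ k * cmod (ft s h \<xi>) \<le> C * I" for k i \<xi>
  proof -
    have r: "rapid (Dw (replicate k i) h)"
      using rapid_mderiv_H_space[OF assms(1)] mderiv_single[of i k h] by metis
    have "wt m k * \<bar>\<xi> $ i\<bar> ^ k * cmod (ft s h \<xi>) = wt m k * cmod (ft s (Dw (replicate k i) h) \<xi>)"
      unfolding ft_Dw_replicate[OF assms(1)] using assms(2) by (simp add: norm_mult norm_power)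
    also have "\<dots> \<le> wt m k * (LINT x|lborel. cmod (Dw (replicate k i) h x))"
      by (intro mult_left_mono norm_ft_le r) auto
    also have "\<dots> = (LINT x|lborel. wt m k * cmod (Dw (replicate k i) h x))" by simp
    also have "\<dots> \<le> (LINT x|lborel. C * inv_poly (x::real^'n))"
    proof (rule integral_mono)
      show "integrable lborel (\<lambda>x. wt m k * cmod (Dw (replicate k i) h x))"
        by (intro integrable_mult_right integrable_norm rapid_integrable r)
      show "integrable lborel (\<lambda>x::real^'n. C * inv_poly x)"
        by (intro integrable_mult_right integrable_inverse_polynomial)
      show "wt m k * cmod (Dw (replicate k i) h x) \<le> C * inv_poly x" for x
        using C(2)[of "\<lambda>j. if j = i then k else 0" x] by (simp only: mderiv_single mlength_single)
    qed
    also have "\<dots> = C * I" by (simp add: I_def)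
    finally show ?thesis .
  qed
  then show ?thesis using C(1) \<open>I \<ge> 0\<close> by (intro exI[of _ "C * I"]) auto
qed

text \<open>Integration by parts yields powers of one coordinate. Choosing the largest one loses a
  factor \<open>CARD('n)\<close> in the norm, which \<open>omega_scale\<close> absorbs.\<close>

lemma ex_norm_le_card_component: "\<exists>i. norm (x :: real^'n::finite) \<le> real CARD('n) * \<bar>x $ i\<bar>"
proof -
  have fin: "finite (range (\<lambda>i. \<bar>x $ i\<bar>))" by simp
  obtain i where i: "Max (range (\<lambda>i. \<bar>x $ i\<bar>)) = \<bar>x $ i\<bar>"
    using Max_in[OF fin] by (metis UNIV_not_empty image_is_empty rangeE)
  have "norm x \<le> (\<Sum>j\<in>UNIV. \<bar>x $ j\<bar>)" by (rule norm_le_l1_cart)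
  also have "\<dots> \<le> (\<Sum>j\<in>(UNIV::'n set). \<bar>x $ i\<bar>)"
    using Max_ge[OF fin] by (intro sum_mono) (simp flip: i)
  finally show ?thesis by auto
qed

text \<open>The bound of \<open>H_space_ft_pow_bound\<close> is uniform in \<open>k\<close> and
  \<open>i\<close>, so both may depend on \<open>\<xi>\<close>: \<open>i\<close> is a largest
  coordinate, and \<open>k\<close> is the order for which \<open>exp_omega_le_wt_pow\<close>
  recovers the exponential.\<close>

lemma H_space_ft_decay:
  fixes h :: "real^'n::finite \<Rightarrow> complex"
  assumes h: "h \<in> H_space" and s: "\<bar>s\<bar> = 1"
  shows "\<exists>C. \<forall>\<xi>. exp (real n * \<omega> (norm \<xi>)) * cmod (ft s h \<xi>) \<le> C"
proof -
  let ?N = "real CARD('n)"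
  obtain L :: nat where L: "\<And>t. t \<ge> 0 \<Longrightarrow> \<omega> (?N * t) \<le> real L * (1 + \<omega> t)"
    using omega_scale[of ?N] by auto
  obtain m C where m: "m \<ge> 1" "C > 0" "\<And>t. t \<ge> 1 \<Longrightarrow> \<exists>k. exp (real (n * L) * \<omega> t) \<le> C * wt m k * t ^ k"
    using exp_omega_le_wt_pow[of "n * L"] by blast
  obtain B where B: "B \<ge> 0" "\<And>k i \<xi>. wt m k * \<bar>\<xi> $ i\<bar> ^ k * cmod (ft s h \<xi>) \<le> B"
    using H_space_ft_pow_bound[OF h s m(1)] by blast
  let ?E = "exp (real (n * L))"
  have "exp (real n * \<omega> (norm \<xi>)) * cmod (ft s h \<xi>) \<le> ?E * (C + 1) * B" for \<xi>
  proof -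
    obtain i where i: "norm \<xi> \<le> ?N * \<bar>\<xi> $ i\<bar>" using ex_norm_le_card_component by blast
    let ?t = "\<bar>\<xi> $ i\<bar>"
    have "\<omega> (norm \<xi>) \<le> real L * (1 + \<omega> ?t)"
      using omega_mono[OF norm_ge_zero i] L[of ?t] by simp
    then have "real n * \<omega> (norm \<xi>) \<le> real n * (real L * (1 + \<omega> ?t))"
      by (intro mult_left_mono) auto
    then have "exp (real n * \<omega> (norm \<xi>)) \<le> exp (real n * (real L * (1 + \<omega> ?t)))" by simp
    also have "\<dots> = ?E * exp (real (n * L) * \<omega> ?t)"
      by (simp add: distrib_left exp_add mult.assoc)
    finally have 1: "exp (real n * \<omega> (norm \<xi>)) \<le> ?E * exp (real (n * L) * \<omega> ?t)" .
    have "\<exists>k. exp (real (n * L) * \<omega> ?t) \<le> (C + 1) * (wt m k * ?t ^ k)"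
    proof (cases "?t \<ge> 1")
      case True
      obtain k where "exp (real (n * L) * \<omega> ?t) \<le> C * wt m k * ?t ^ k" using m(3)[OF True] by blast
      also have "\<dots> \<le> (C + 1) * (wt m k * ?t ^ k)" by (simp add: distrib_right mult.assoc)
      finally show ?thesis by blast
    next
      case False
      \<comment> \<open>Here \<omega> vanishes and \<open>k = 0\<close> works; the summand
        \<open>1\<close> in \<open>C + 1\<close> covers this case.\<close>
      then show ?thesis using m(1,2) by (intro exI[of _ 0]) (simp add: omega_zero wt_0)
    qed
    then obtain k where k: "exp (real (n * L) * \<omega> ?t) \<le> (C + 1) * (wt m k * ?t ^ k)" by blast
    have "exp (real n * \<omega> (norm \<xi>)) * cmod (ft s h \<xi>) \<le> (?E * ((C + 1) * (wt m k * ?t ^ k))) * cmod (ft s h \<xi>)"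
      using 1 k by (intro mult_right_mono order_trans[OF 1] mult_left_mono) auto
    also have "\<dots> = ?E * (C + 1) * (wt m k * ?t ^ k * cmod (ft s h \<xi>))" by (simp only: mult.assoc)
    also have "\<dots> \<le> ?E * (C + 1) * B"
      using B(2) m(2) by (intro mult_left_mono) auto
    finally show ?thesis .
  qed
  then show ?thesis by blast
qed

theorem S_space_eq_H_space: "S_space \<omega> = (H_space :: (real^'n::finite \<Rightarrow> complex) set)"
proof
  show "S_space \<omega> \<subseteq> (H_space :: (real^'n \<Rightarrow> complex) set)" by (rule S_space_subset_H_space)
  show "(H_space :: (real^'n \<Rightarrow> complex) set) \<subseteq> S_space \<omega>"
  proof
    fix h :: "real^'n \<Rightarrow> complex" assume h: "h \<in> H_space"
    have "\<exists>C. \<forall>x. exp (real n * \<omega> (norm x)) * cmod (mderiv \<alpha> (fourier h) x) \<le> C" for n :: nat and \<alpha>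
      \<comment> \<open>A derivative of the transform is the transform of a monomial times
        \<open>h\<close>, which is again in \<open>H_space\<close>; so decay of transforms without
        derivatives is enough.\<close>
      unfolding mderiv_eq_Dw fourier_eq_ft Dw_ft[OF rapid_H_space[OF h]]
      by (rule H_space_ft_decay[OF H_space_mult_symb[OF h]]) simp
    then show "h \<in> S_space \<omega>"
      unfolding S_space_iff
      using rapid_integrable[OF rapid_H_space[OF h]] H_space_smooth[OF h] H_space_decay[OF h]
        smooth_ft[OF rapid_H_space[OF h]] by (simp add: fourier_eq_ft)
  qed
qed

end

section \<open>Multiplication as a bilinear map\<close>

context weight
begin

text \<open>One weighted derivative evaluated at one point, as a linear functional indexed by the
  pair of \<open>\<alpha>\<close> and \<open>x\<close>. The gliding hump selects such functionals
  one by one.\<close>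

definition wfunctional :: "nat \<Rightarrow> real \<Rightarrow> ('n::finite \<Rightarrow> nat) \<times> (real^'n) \<Rightarrow> (real^'n \<Rightarrow> complex) \<Rightarrow> complex" where
  "wfunctional m \<sigma> = (\<lambda>(\<alpha>, x) f. complex_of_real (exp (\<sigma> * \<omega> (norm x)) * wt m (mlength \<alpha>)) * mderiv \<alpha> f x)"

definition wnorm :: "nat \<Rightarrow> real \<Rightarrow> (real^'n::finite \<Rightarrow> complex) \<Rightarrow> ennreal" where
  "wnorm m \<sigma> f = (SUP z. ennreal (cmod (wfunctional m \<sigma> z f)))"

lemma norm_wfunctional:
  "cmod (wfunctional m \<sigma> (\<alpha>, x) f) = exp (\<sigma> * \<omega> (norm x)) * wt m (mlength \<alpha>) * cmod (mderiv \<alpha> f x)"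
  by (simp add: wfunctional_def norm_mult wt_def)

lemma wfunctional_add:
  "smooth f \<Longrightarrow> smooth g \<Longrightarrow> wfunctional m \<sigma> z (\<lambda>x. f x + g x) = wfunctional m \<sigma> z f + wfunctional m \<sigma> z g"
  by (cases z) (simp add: wfunctional_def mderiv_eq_Dw Dw_add distrib_left)

lemma wfunctional_cmult:
  "smooth f \<Longrightarrow> wfunctional m \<sigma> z (\<lambda>x. c * f x) = c * wfunctional m \<sigma> z f"
  by (cases z) (simp add: wfunctional_def mderiv_eq_Dw Dw_cmult)

lemma wbound_iff_functional: "wbound m \<sigma> f R \<longleftrightarrow> (\<forall>z. cmod (wfunctional m \<sigma> z f) \<le> R)"
  unfolding wbound_def split_paired_All norm_wfunctional ..

abbreviation "S_norms \<equiv> {wnorm m (real n) | m n. m \<ge> 1 \<and> n \<ge> 1}"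

abbreviation "OC_norms k \<equiv> {wnorm m (- real k) | m. m \<ge> 1}"

lemma wnorm_leI: "wbound m \<sigma> f R \<Longrightarrow> wnorm m \<sigma> f \<le> ennreal R"
  unfolding wbound_iff_functional wnorm_def by (intro SUP_least ennreal_leI) blast

lemma wnorm_finiteD:
  assumes "wnorm m \<sigma> f < \<infinity>"
  obtains R where "R \<ge> 0" "wnorm m \<sigma> f = ennreal R" "wbound m \<sigma> f R"
proof -
  obtain R where R: "R \<ge> 0" "wnorm m \<sigma> f = ennreal R"
    using assms by (cases "wnorm m \<sigma> f") auto
  have "ennreal (cmod (wfunctional m \<sigma> z f)) \<le> ennreal R" for z
    unfolding R(2)[symmetric] wnorm_def by (rule SUP_upper) simp
  then have "wbound m \<sigma> f R"
    unfolding wbound_iff_functional using R(1) by (meson ennreal_le_iff)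
  with R show ?thesis using that by blast
qed

lemma wnorm_finite_iff: "wnorm m \<sigma> f < \<infinity> \<longleftrightarrow> (\<exists>R. wbound m \<sigma> f R)"
proof
  assume "\<exists>R. wbound m \<sigma> f R"
  then obtain R where "wbound m \<sigma> f R" by blast
  from wnorm_leI[OF this] show "wnorm m \<sigma> f < \<infinity>"
    by (metis ennreal_less_top infinity_ennreal_def order_le_less_trans)
qed (blast elim: wnorm_finiteD)

lemma wnorm_less_top_iff: "wnorm m \<sigma> f < top \<longleftrightarrow> (\<exists>R. wbound m \<sigma> f R)"
  using wnorm_finite_iff by (simp add: infinity_ennreal_def)

lemma wnorm_eq_SUP:
  "wnorm m \<sigma> f = (SUP \<alpha>. SUP x. ennreal (exp (\<sigma> * \<omega> (norm x)) * wt m (mlength \<alpha>) * cmod (mderiv \<alpha> f x)))"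
  (is "_ = ?R")
proof (rule antisym)
  show "wnorm m \<sigma> f \<le> ?R"
    unfolding wnorm_def
  proof (rule SUP_least)
    fix z :: "('a \<Rightarrow> nat) \<times> (real^'a)"
    show "ennreal (cmod (wfunctional m \<sigma> z f)) \<le> ?R"
      by (cases z) (auto simp: norm_wfunctional intro!: SUP_upper2[OF UNIV_I] SUP_upper)
  qed
  show "?R \<le> wnorm m \<sigma> f"
    unfolding wnorm_def norm_wfunctional[symmetric] by (intro SUP_least SUP_upper) simp
qed

lemma seminorm_on_wnorm:
  assumes "\<And>f. f \<in> V \<Longrightarrow> smooth f" "\<And>f. f \<in> V \<Longrightarrow> wnorm m \<sigma> f < \<infinity>"
  shows "seminorm_on V (wnorm m \<sigma>)"
  using seminorm_on_SUP_functionals[of UNIV V "wfunctional m \<sigma>"] assms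
  unfolding wnorm_def[abs_def] by (simp add: wfunctional_add wfunctional_cmult)

lemma q_norm_eq:
  assumes "m \<ge> 1"
  shows "q_norm \<omega> m n = wnorm m (real n)"
proof
  fix f :: "real^'n::finite \<Rightarrow> complex"
  have "sup_norm (\<lambda>x. complex_of_real (exp (real n * \<omega> (norm x))) * mderiv \<alpha> f x) * ennreal (wt m (mlength \<alpha>)) =
      (SUP x. ennreal (exp (real n * \<omega> (norm x)) * wt m (mlength \<alpha>) * cmod (mderiv \<alpha> f x)))" for \<alpha>
    unfolding sup_norm_def SUP_mult_right_ennreal
    by (intro SUP_cong refl) (simp add: norm_mult mult_ac flip: ennreal_mult)
  then show "q_norm \<omega> m n f = wnorm m (real n) f"
    unfolding q_norm_def wnorm_eq_SUP exp_ereal_young[OF assms] by simp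
qed

lemma r_norm_eq:
  assumes "m \<ge> 1"
  shows "r_norm \<omega> m n = wnorm m (- real n)"
proof
  fix f :: "real^'n::finite \<Rightarrow> complex"
  show "r_norm \<omega> m n f = wnorm m (- real n) f"
    unfolding r_norm_def wnorm_eq_SUP exp_ereal_diff_young[OF assms]
    by (intro SUP_cong refl) (simp add: mult_ac flip: ennreal_mult)
qed

section \<open>The spaces and topologies in terms of \<open>wnorm\<close>\<close>

definition OC_step :: "nat \<Rightarrow> (real^'n::finite \<Rightarrow> complex) set" where
  "OC_step k = {f. smooth f \<and> (\<forall>m\<ge>1. wnorm m (- real k) f < \<infinity>)}"

lemma OC_step_eq: "(\<Inter>m\<in>{1..}. O_space \<omega> m k) = (OC_step k :: (real^'n::finite \<Rightarrow> complex) set)"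
proof -
  have "(\<forall>m\<in>{1..}. smooth f \<and> r_norm \<omega> m k f < \<infinity>) \<longleftrightarrow> smooth f \<and> (\<forall>m\<ge>1. wnorm m (- real k) f < \<infinity>)"
    for f :: "real^'n \<Rightarrow> complex"
    by (auto simp: r_norm_eq)
  then show ?thesis unfolding OC_step_def O_space_def by auto
qed

lemma OC_space_eq: "OC_space \<omega> = (\<Union>k\<in>{1..}. OC_step k)"
  unfolding OC_space_def OC_step_eq ..

lemma OC_step_topology_eq:
  "OC_step_topology \<omega> k = seminorm_topology (OC_step k :: (real^'n::finite \<Rightarrow> complex) set) (OC_norms k)"
proof -
  have "{r_norm \<omega> m k | m. m \<ge> 1} = {wnorm m (- real k) :: (real^'n \<Rightarrow> complex) \<Rightarrow> ennreal | m. m \<ge> 1}"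
    using r_norm_eq by metis
  then show ?thesis unfolding OC_step_topology_def OC_step_eq by (rule arg_cong)
qed

lemma OC_topology_eq:
  "OC_topology \<omega> = lc_inductive_limit {1..} (\<lambda>k. seminorm_topology (OC_step k) (OC_norms k))"
  unfolding OC_topology_def OC_step_topology_eq[abs_def] ..

lemma S_topology_eq:
  "S_topology \<omega> = seminorm_topology (S_space \<omega> :: (real^'n::finite \<Rightarrow> complex) set) S_norms"
proof -
  have "{q_norm \<omega> m n | m n. m \<ge> 1 \<and> n \<ge> 1} = {wnorm m (real n) :: (real^'n \<Rightarrow> complex) \<Rightarrow> ennreal | m n. m \<ge> 1 \<and> n \<ge> 1}"
    using q_norm_eq by metis
  then show ?thesis unfolding S_topology_def by (rule arg_cong)
qed

text \<open>The set \<open>I\<close> of pairs of \<open>m\<close> and \<open>\<sigma>\<close> lets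
  one proof cover \<open>S_space\<close> and every \<open>OC_step\<close>.\<close>

lemma complex_subspace_wnorm:
  "complex_subspace {f :: real^'n::finite \<Rightarrow> complex. smooth f \<and> (\<forall>z\<in>I. wnorm (fst z) (snd z) f < \<infinity>)}" (is "complex_subspace ?V")
proof -
  have sn: "seminorm_on {f. smooth f \<and> wnorm m \<sigma> f < \<infinity>} (wnorm m \<sigma>)" for m \<sigma>
    by (rule seminorm_on_wnorm) auto
  have add: "wnorm m \<sigma> (\<lambda>x. f x + g x) < \<infinity>"
    if "smooth f" "smooth g" "wnorm m \<sigma> f < \<infinity>" "wnorm m \<sigma> g < \<infinity>" for m \<sigma> and f g :: "real^'n \<Rightarrow> complex"
  proof -
    have "wnorm m \<sigma> (\<lambda>x. f x + g x) \<le> wnorm m \<sigma> f + wnorm m \<sigma> g"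
      using that by (intro seminorm_onD(2)[OF sn]) auto
    also have "\<dots> < \<infinity>" using that by simp
    finally show ?thesis .
  qed
  have cmult: "wnorm m \<sigma> (\<lambda>x. c * f x) < \<infinity>"
    if "smooth f" "wnorm m \<sigma> f < \<infinity>" for m \<sigma> c and f :: "real^'n \<Rightarrow> complex"
  proof -
    have "wnorm m \<sigma> (\<lambda>x. c * f x) = ennreal (cmod c) * wnorm m \<sigma> f"
      using that by (intro seminorm_onD(3)[OF sn]) auto
    also have "\<dots> < \<infinity>" using that by (simp add: ennreal_mult_less_top)
    finally show ?thesis .
  qed
  have zero: "wnorm m \<sigma> (\<lambda>x::real^'n. 0) < \<infinity>" for m \<sigma>
  proof -
    have "Dw w (\<lambda>x::real^'n. 0) = (\<lambda>x. 0)" for w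
      using Dw_cmult[OF smooth_const, of w 0 0] by simp
    then show ?thesis
      unfolding wnorm_finite_iff wbound_def mderiv_eq_Dw by (intro exI[of _ 0]) simp
  qed
  show ?thesis
    unfolding complex_subspace_def
  proof (intro conjI ballI allI)
    show "(\<lambda>x. 0) \<in> ?V" using zero smooth_const by auto
    show "(\<lambda>x. f x + g x) \<in> ?V" if "f \<in> ?V" "g \<in> ?V" for f g
      using that add smooth_add by auto
    show "(\<lambda>x. c * f x) \<in> ?V" if "f \<in> ?V" for c f
      using that cmult smooth_cmult by auto
  qed
qed

lemma S_space_eq: "S_space \<omega> = {f. smooth f \<and> (\<forall>z\<in>{(m, real n) | m n. m \<ge> 1}. wnorm (fst z) (snd z) f < \<infinity>)}"
  unfolding S_space_eq_H_space H_space_def by (auto simp: wnorm_less_top_iff)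

lemma complex_subspace_S_space: "complex_subspace (S_space \<omega>)"
  unfolding S_space_eq by (rule complex_subspace_wnorm)

lemma complex_subspace_OC_step: "complex_subspace (OC_step k :: (real^'n::finite \<Rightarrow> complex) set)"
  using complex_subspace_wnorm[of "{m. m \<ge> 1} \<times> {- real k}", where 'n = 'n] unfolding OC_step_def
  by simp

lemma OC_step_mono: "k \<le> l \<Longrightarrow> OC_step k \<subseteq> OC_step l"
  unfolding OC_step_def by (auto simp: wnorm_less_top_iff) (meson neg_le_iff_le of_nat_le_iff order_refl wbound_mono)

lemma complex_subspace_OC_space: "complex_subspace (OC_space \<omega> :: (real^'n::finite \<Rightarrow> complex) set)"
  unfolding complex_subspace_def OC_space_eq
proof (intro conjI ballI allI)
  show "(\<lambda>x. 0) \<in> (\<Union>k\<in>{1..}. OC_step k)"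
    using complex_subspaceD(1)[OF complex_subspace_OC_step] by blast
  fix f g :: "real^'n \<Rightarrow> complex" assume "f \<in> (\<Union>k\<in>{1..}. OC_step k)" "g \<in> (\<Union>k\<in>{1..}. OC_step k)"
  then obtain k l where "k \<ge> 1" "f \<in> OC_step k" "g \<in> OC_step l" by auto
  then have "f \<in> OC_step (max k l)" "g \<in> OC_step (max k l)"
    using OC_step_mono[of k "max k l"] OC_step_mono[of l "max k l"] by auto
  from complex_subspaceD(2)[OF complex_subspace_OC_step this] \<open>k \<ge> 1\<close>
  show "(\<lambda>x. f x + g x) \<in> (\<Union>k\<in>{1..}. OC_step k)" by force
next
  fix c and f :: "real^'n \<Rightarrow> complex" assume "f \<in> (\<Union>k\<in>{1..}. OC_step k)"
  then show "(\<lambda>x. c * f x) \<in> (\<Union>k\<in>{1..}. OC_step k)"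
    using complex_subspaceD(3)[OF complex_subspace_OC_step] by blast
qed

lemma S_space_smooth: "g \<in> S_space \<omega> \<Longrightarrow> smooth g"
  and S_space_wnorm_finite: "g \<in> S_space \<omega> \<Longrightarrow> m \<ge> 1 \<Longrightarrow> wnorm m (real n) g < \<infinity>"
  unfolding S_space_eq by auto

lemma OC_step_smooth: "f \<in> OC_step k \<Longrightarrow> smooth f"
  and OC_step_wnorm_finite: "f \<in> OC_step k \<Longrightarrow> m \<ge> 1 \<Longrightarrow> wnorm m (- real k) f < \<infinity>"
  unfolding OC_step_def by auto

lemma seminormed_S_space:
  "seminormed (S_space \<omega>) S_norms"
proof
  fix p assume "p \<in> S_norms"
  then show "seminorm_on (S_space \<omega>) p"
    using S_space_smooth S_space_wnorm_finite by (auto intro!: seminorm_on_wnorm)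
qed (use complex_subspace_S_space in auto)

lemma seminormed_OC_step:
  "seminormed (OC_step k) (OC_norms k)"
proof
  fix p assume "p \<in> OC_norms k"
  then show "seminorm_on (OC_step k) p"
    using OC_step_smooth OC_step_wnorm_finite by (auto intro!: seminorm_on_wnorm)
qed (use complex_subspace_OC_step in auto)

lemma topspace_S_topology: "topspace (S_topology \<omega>) = S_space \<omega>"
  unfolding S_topology_eq by (rule seminormed.topspace_seminorm[OF seminormed_S_space])

section \<open>The product estimate and seminorms on the inductive limit\<close>

lemma mult_op_in_S_space:
  assumes "f \<in> OC_space \<omega>" "g \<in> S_space \<omega>"
  shows "mult_op f g \<in> S_space \<omega>"
proof -
  obtain k where "f \<in> OC_step k" using assms(1) unfolding OC_space_eq by blast
  then show ?thesis
    using H_space_mult[OF OC_step_smooth, of f k k g] OC_step_wnorm_finite[of f k] assms(2)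
    unfolding mult_op_def S_space_eq_H_space wnorm_finite_iff by blast
qed

lemma wnorm_mult_le:
  assumes "m \<ge> 1"
  shows "\<exists>m'\<ge>1. \<exists>D>0. \<forall>\<sigma> \<tau> (f :: real^'n::finite \<Rightarrow> complex) g. smooth f \<longrightarrow> smooth g \<longrightarrow>
    wnorm m' \<sigma> f < \<infinity> \<longrightarrow> wnorm m' \<tau> g < \<infinity> \<longrightarrow>
    wnorm m (\<sigma> + \<tau>) (mult_op f g) \<le> ennreal D * wnorm m' \<sigma> f * wnorm m' \<tau> g"
proof -
  obtain m' D where m': "m' \<ge> 1" "D > 0"
    "\<And>\<sigma> \<tau> R Q (f :: real^'n \<Rightarrow> complex) g. smooth f \<Longrightarrow> smooth g \<Longrightarrow> wbound m' \<sigma> f R \<Longrightarrow> wbound m' \<tau> g Q \<Longrightarrow>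
      wbound m (\<sigma> + \<tau>) (\<lambda>x. f x * g x) (D * R * Q)"
    using wbound_mult[OF assms, where 'n = 'n] by metis
  have "wnorm m (\<sigma> + \<tau>) (mult_op f g) \<le> ennreal D * wnorm m' \<sigma> f * wnorm m' \<tau> g"
    if fg: "smooth f" "smooth g" "wnorm m' \<sigma> f < \<infinity>" "wnorm m' \<tau> g < \<infinity>" for \<sigma> \<tau> and f g :: "real^'n \<Rightarrow> complex"
  proof -
    obtain R Q where RQ: "R \<ge> 0" "wnorm m' \<sigma> f = ennreal R" "wbound m' \<sigma> f R"
      "Q \<ge> 0" "wnorm m' \<tau> g = ennreal Q" "wbound m' \<tau> g Q"
      using wnorm_finiteD[OF fg(3)] wnorm_finiteD[OF fg(4)] by metis
    have "wnorm m (\<sigma> + \<tau>) (mult_op f g) \<le> ennreal (D * R * Q)"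
      unfolding mult_op_def by (intro wnorm_leI m'(3) fg RQ)
    also have "\<dots> = ennreal D * wnorm m' \<sigma> f * wnorm m' \<tau> g"
      using m'(2) RQ by (simp add: ennreal_mult)
    finally show ?thesis .
  qed
  then show ?thesis using m'(1,2) by blast
qed

lemma bilinear_map_mult_op: "bilinear_map (OC_space \<omega>) (S_space \<omega>) (S_space \<omega>) mult_op"
proof -
  have "mult_op f (\<lambda>x. g x + h x) = (\<lambda>x. mult_op f g x + mult_op f h x)"
    "mult_op (\<lambda>x. g x + h x) f = (\<lambda>x. mult_op g f x + mult_op h f x)"
    "mult_op f (\<lambda>x. c * g x) = (\<lambda>x. c * mult_op f g x)"
    "mult_op (\<lambda>x. c * g x) f = (\<lambda>x. c * mult_op g f x)" for f g h :: "real^'a \<Rightarrow> complex" and c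
    by (auto simp: mult_op_def algebra_simps)
  then show ?thesis
    unfolding bilinear_map_def linear_map_def
    using complex_subspace_OC_space complex_subspace_S_space mult_op_in_S_space by auto
qed

lemma
  fixes p :: "(real^'n::finite \<Rightarrow> complex) \<Rightarrow> ennreal"
  assumes p: "seminorm_on (OC_space \<omega>) p"
    and bound: "\<And>k. k \<ge> 1 \<Longrightarrow> \<exists>m\<ge>1. \<exists>C. \<forall>f\<in>OC_step k. p f \<le> ennreal C * wnorm m (- real k) f"
  shows openin_OC_ball: "f \<in> OC_space \<omega> \<Longrightarrow> openin (OC_topology \<omega>) {g \<in> OC_space \<omega>. p (\<lambda>x. g x - f x) < ennreal \<epsilon>}"
    and topspace_OC_aux: "topspace (OC_topology \<omega> :: (real^'n \<Rightarrow> complex) topology) = OC_space \<omega>"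
proof -
  note a = seminormed_OC_step complex_subspace_OC_space[unfolded OC_space_eq] p[unfolded OC_space_eq]
  have b: "\<exists>q\<in>(OC_norms k). \<exists>C. \<forall>f\<in>OC_step k. p f \<le> ennreal C * q f" if "k \<in> {1..}" for k
    using bound[of k] that by auto
  show "f \<in> OC_space \<omega> \<Longrightarrow> openin (OC_topology \<omega>) {g \<in> OC_space \<omega>. p (\<lambda>x. g x - f x) < ennreal \<epsilon>}"
    using openin_lc_inductive_limit_ball[OF a b, of f \<epsilon>] unfolding OC_topology_eq OC_space_eq by simp
  show "topspace (OC_topology \<omega> :: (real^'n \<Rightarrow> complex) topology) = OC_space \<omega>"
    using topspace_lc_inductive_limit[OF a b] unfolding OC_topology_eq OC_space_eq by simp
qed

text \<open>The carrier of the limit is known once some admissible topology is exhibited; the zero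
  seminorm provides one.\<close>

lemma topspace_OC_topology: "topspace (OC_topology \<omega> :: (real^'n::finite \<Rightarrow> complex) topology) = OC_space \<omega>"
  by (rule topspace_OC_aux[of "\<lambda>_. 0"]) (auto simp: seminorm_on_def)

lemma openin_OC_ball0:
  assumes "seminorm_on (OC_space \<omega>) p"
    and "\<And>k. k \<ge> 1 \<Longrightarrow> \<exists>m\<ge>1. \<exists>C. \<forall>f\<in>OC_step k. p f \<le> ennreal C * wnorm m (- real k) f"
  shows "openin (OC_topology \<omega>) {g \<in> OC_space \<omega>. p g < ennreal \<epsilon>}"
  using openin_OC_ball[OF assms complex_subspaceD(1)[OF complex_subspace_OC_space], of \<epsilon>] by simp

text \<open>A gliding hump: a violation for every \<open>k\<close> would produce a continuous seminorm on the inductive limit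
  that is unbounded on \<open>A\<close>.\<close>

lemma OC_bounded_uniform:
  fixes A :: "(real^'n::finite \<Rightarrow> complex) set"
  assumes A: "tvs_bounded (OC_topology \<omega>) A" and m: "m \<ge> 1"
  shows "\<exists>k R. \<forall>f\<in>A. wbound m (- real k) f R"
proof (rule ccontr)
  assume "\<nexists>k R. \<forall>f\<in>A. wbound m (- real k) f R"
  \<comment> \<open>The failure for all pairs of \<open>k\<close> and \<open>R\<close> is exploited
    on the diagonal \<open>R = k\<close>.\<close>
  then have "\<forall>k. \<exists>f z. f \<in> A \<and> cmod (wfunctional m (- real k) z f) > real k"
    unfolding wbound_iff_functional by (meson not_le)
  then obtain F Z where F: "\<And>k. F k \<in> A" "\<And>k. cmod (wfunctional m (- real k) (Z k) (F k)) > real k"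
    by metis
  define p where "p f = (SUP k. ennreal (cmod (wfunctional m (- real k) (Z k) f)))" for f
  have bound: "\<exists>C. \<forall>f\<in>OC_step n. p f \<le> ennreal C * wnorm m (- real n) f" for n
  proof -
    \<comment> \<open>\<open>c k\<close> is the quotient of the weights with indices
      \<open>k\<close> and \<open>n\<close> at the point of the functional \<open>Z k\<close>. It is
      at most \<open>1\<close> for \<open>k \<ge> n\<close>, and only finitely many \<open>k\<close>
      remain, so \<open>p\<close> is dominated on each step.\<close>
    define c where "c k = exp ((real n - real k) * \<omega> (norm (snd (Z k))))" for k
    define C where "C = 1 + (\<Sum>k<n. c k)"
    have c0: "c k \<ge> 0" for k by (simp add: c_def)
    have "c k \<le> C" for k
    proof (cases "k < n")
      case True
      then have "c k \<le> (\<Sum>k<n. c k)" using c0 by (intro member_le_sum) auto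
      then show ?thesis by (simp add: C_def)
    next
      case False
      then have "(real n - real k) * \<omega> (norm (snd (Z k))) \<le> 0"
        using omega_nonneg[of "norm (snd (Z k))"] by (intro mult_nonpos_nonneg) auto
      then have "c k \<le> 1" by (simp add: c_def)
      then show ?thesis using sum_nonneg[of "{..<n}" c] c0 by (simp add: C_def)
    qed
    note cC = this
    have C0: "C \<ge> 0" using order_trans[OF c0 cC] .
    have "p f \<le> ennreal C * wnorm m (- real n) f" for f
      unfolding p_def
    proof (rule SUP_least)
      fix k
      obtain \<alpha> x where Z: "Z k = (\<alpha>, x)" by (cases "Z k")
      have "exp (- real k * \<omega> (norm x)) = c k * exp (- real n * \<omega> (norm x))"
        by (simp add: c_def Z algebra_simps flip: exp_add)
      then have "cmod (wfunctional m (- real k) (Z k) f) = c k * cmod (wfunctional m (- real n) (Z k) f)"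
        by (simp add: Z norm_wfunctional)
      also have "\<dots> \<le> C * cmod (wfunctional m (- real n) (Z k) f)"
        by (intro mult_right_mono cC) auto
      finally have "ennreal (cmod (wfunctional m (- real k) (Z k) f)) \<le> ennreal C * ennreal (cmod (wfunctional m (- real n) (Z k) f))"
        using C0 by (simp add: ennreal_leI flip: ennreal_mult)
      also have "\<dots> \<le> ennreal C * wnorm m (- real n) f"
        unfolding wnorm_def by (intro mult_left_mono SUP_upper) auto
      finally show "ennreal (cmod (wfunctional m (- real k) (Z k) f)) \<le> \<dots>" .
    qed
    then show ?thesis by blast
  qed
  have sm: "smooth f" if "f \<in> OC_space \<omega>" for f :: "real^'n \<Rightarrow> complex"
    using that OC_step_smooth unfolding OC_space_eq by blast
  have "p f < \<infinity>" if f: "f \<in> OC_space \<omega>" for f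
  proof -
    obtain n where n: "f \<in> OC_step n" using f unfolding OC_space_eq by blast
    then obtain C where "p f \<le> ennreal C * wnorm m (- real n) f" using bound by blast
    also have "\<dots> < \<infinity>" using OC_step_wnorm_finite[OF n m] by (simp add: ennreal_mult_less_top)
    finally show ?thesis .
  qed
  then have sn: "seminorm_on (OC_space \<omega>) p"
    unfolding p_def[abs_def] using sm
    by (intro seminorm_on_SUP_functionals) (auto simp: wfunctional_add wfunctional_cmult)
  have "openin (OC_topology \<omega>) {f \<in> OC_space \<omega>. p f < ennreal 1}"
    using bound m by (intro openin_OC_ball0[OF sn]) blast
  from tvs_bounded_seminorm_bound[OF A this complex_subspaceD(1)[OF complex_subspace_OC_space] sn]
  obtain r where r: "\<And>f. f \<in> A \<Longrightarrow> p f \<le> ennreal r" by blast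
  obtain k where k: "\<bar>r\<bar> < real k" using reals_Archimedean2 by blast
  have "ennreal (cmod (wfunctional m (- real k) (Z k) (F k))) \<le> p (F k)"
    unfolding p_def by (rule SUP_upper) simp
  also have "\<dots> \<le> ennreal \<bar>r\<bar>" using r[OF F(1)[of k]] by (rule order_trans) (simp add: ennreal_leI)
  finally have "cmod (wfunctional m (- real k) (Z k) (F k)) \<le> \<bar>r\<bar>" by simp
  then show False using F(2)[of k] k by linarith
qed

text \<open>The supremum \<open>p\<close> over \<open>g \<in> B\<close> is a seminorm on the whole
  union. On \<open>OC_step k\<close> it is dominated by \<open>D * \<bar>Q\<bar>\<close> times one
  norm, where \<open>Q\<close> bounds \<open>B\<close> in the norm with decay index
  \<open>n + k\<close>. A singleton \<open>B\<close> gives separate continuity, a bounded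
  \<open>B\<close> equicontinuity.\<close>

lemma openin_OC_mult_ball:
  fixes B :: "(real^'n::finite \<Rightarrow> complex) set"
  assumes B: "B \<subseteq> S_space \<omega>" "\<And>m n. m \<ge> 1 \<Longrightarrow> n \<ge> 1 \<Longrightarrow> \<exists>Q. \<forall>g\<in>B. wnorm m (real n) g \<le> ennreal Q"
    and mn: "m \<ge> 1" "n \<ge> 1" and f: "f \<in> OC_space \<omega>" and \<epsilon>: "\<epsilon> > 0"
  shows "\<exists>N. openin (OC_topology \<omega>) N \<and> f \<in> N \<and>
    (\<forall>h\<in>N. \<forall>g\<in>B. wnorm m (real n) (\<lambda>x. mult_op h g x - mult_op f g x) < ennreal \<epsilon>)"
proof -
  define p where "p h = (SUP i\<in>B \<times> UNIV. ennreal (cmod (wfunctional m (real n) (snd i) (mult_op h (fst i)))))" for h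
  have p_upper: "wnorm m (real n) (mult_op h g) \<le> p h" if "g \<in> B" for g h
    unfolding wnorm_def p_def using that by (intro SUP_least SUP_upper2[of "(g, _)"]) auto
  obtain m' D where m': "m' \<ge> 1" "D > 0"
    "\<And>\<sigma> \<tau> (f :: real^'n \<Rightarrow> complex) g. smooth f \<Longrightarrow> smooth g \<Longrightarrow> wnorm m' \<sigma> f < \<infinity> \<Longrightarrow> wnorm m' \<tau> g < \<infinity> \<Longrightarrow>
      wnorm m (\<sigma> + \<tau>) (mult_op f g) \<le> ennreal D * wnorm m' \<sigma> f * wnorm m' \<tau> g"
    using wnorm_mult_le[OF mn(1), where 'n = 'n] by metis
  have bound: "\<exists>C. \<forall>h\<in>OC_step k. p h \<le> ennreal C * wnorm m' (- real k) h" for k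
  proof -
    obtain Q where Q: "\<And>g. g \<in> B \<Longrightarrow> wnorm m' (real (n + k)) g \<le> ennreal Q"
      using B(2)[of m' "n + k"] m'(1) mn(2) by auto
    have "p h \<le> ennreal (D * \<bar>Q\<bar>) * wnorm m' (- real k) h" if h: "h \<in> OC_step k" for h
      unfolding p_def
    proof (rule SUP_least, clarsimp simp del: infinity_ennreal_def)
      fix g and \<alpha> :: "'n \<Rightarrow> nat" and x :: "real^'n" assume g: "g \<in> B"
      have "ennreal (cmod (wfunctional m (real n) (\<alpha>, x) (mult_op h g))) \<le> wnorm m (- real k + real (n + k)) (mult_op h g)"
        unfolding wnorm_def by (intro SUP_upper2[of "(\<alpha>, x)"]) auto
      also have "\<dots> \<le> ennreal D * wnorm m' (- real k) h * wnorm m' (real (n + k)) g"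
        using g B(1) h m'(1)
        by (intro m'(3) OC_step_smooth[OF h] OC_step_wnorm_finite[OF h] S_space_smooth S_space_wnorm_finite) auto
      also have "\<dots> \<le> ennreal D * wnorm m' (- real k) h * ennreal \<bar>Q\<bar>"
        using Q[OF g] by (intro mult_left_mono) (auto intro: order_trans ennreal_leI)
      also have "\<dots> = ennreal (D * \<bar>Q\<bar>) * wnorm m' (- real k) h"
        using m'(2) by (simp add: ennreal_mult mult_ac)
      finally show "ennreal (cmod (wfunctional m (real n) (\<alpha>, x) (mult_op h g))) \<le> \<dots>" .
    qed
    then show ?thesis by blast
  qed
  have "p h < \<infinity>" if h: "h \<in> OC_space \<omega>" for h
  proof -
    obtain k where k: "h \<in> OC_step k" using h unfolding OC_space_eq by blast
    then obtain C where "p h \<le> ennreal C * wnorm m' (- real k) h" using bound by blast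
    also have "\<dots> < \<infinity>" using OC_step_wnorm_finite[OF k m'(1)] by (simp add: ennreal_mult_less_top)
    finally show ?thesis .
  qed
  moreover have "wfunctional m (real n) z (mult_op (\<lambda>x. h1 x + h2 x) g) =
      wfunctional m (real n) z (mult_op h1 g) + wfunctional m (real n) z (mult_op h2 g)"
    if "g \<in> B" "h1 \<in> OC_space \<omega>" "h2 \<in> OC_space \<omega>" for g h1 h2 z
    using wfunctional_add[OF S_space_smooth[OF mult_op_in_S_space[of h1 g]] S_space_smooth[OF mult_op_in_S_space[of h2 g]], of m "real n" z] that B(1)
    by (auto simp: mult_op_def distrib_right)
  moreover have "wfunctional m (real n) z (mult_op (\<lambda>x. c * h x) g) = c * wfunctional m (real n) z (mult_op h g)"
    if "g \<in> B" "h \<in> OC_space \<omega>" for g h c z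
    using wfunctional_cmult[OF S_space_smooth[OF mult_op_in_S_space[of h g]], of m "real n" z c] that B(1)
    by (auto simp: mult_op_def mult.assoc)
  ultimately have sn: "seminorm_on (OC_space \<omega>) p"
    unfolding p_def[abs_def] by (intro seminorm_on_SUP_functionals) auto
  let ?N = "{h \<in> OC_space \<omega>. p (\<lambda>x. h x - f x) < ennreal \<epsilon>}"
  have "openin (OC_topology \<omega>) ?N"
    using bound m'(1) by (intro openin_OC_ball[OF sn _ f]) blast
  moreover have "f \<in> ?N"
    using f \<epsilon> seminorm_on_zero[OF sn complex_subspace_OC_space] by simp
  moreover have "wnorm m (real n) (\<lambda>x. mult_op h g x - mult_op f g x) < ennreal \<epsilon>"
    if "h \<in> ?N" "g \<in> B" for h g
  proof -
    have "wnorm m (real n) (\<lambda>x. mult_op h g x - mult_op f g x) = wnorm m (real n) (mult_op (\<lambda>x. h x - f x) g)"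
      by (simp add: mult_op_def left_diff_distrib)
    also have "\<dots> \<le> p (\<lambda>x. h x - f x)" by (rule p_upper[OF that(2)])
    also have "\<dots> < ennreal \<epsilon>" using that by simp
    finally show ?thesis .
  qed
  ultimately show ?thesis by (intro exI[of _ ?N]) blast
qed

section \<open>Continuity and equicontinuity of multiplication\<close>

lemma linear_map_mult_left: "f \<in> OC_space \<omega> \<Longrightarrow> linear_map (S_space \<omega>) (S_space \<omega>) (mult_op f)"
  and linear_map_mult_right: "g \<in> S_space \<omega> \<Longrightarrow> linear_map (OC_space \<omega>) (S_space \<omega>) (\<lambda>f. mult_op f g)"
  using bilinear_map_mult_op unfolding bilinear_map_def by blast+

text \<open>The index \<open>k\<close> in the hypothesis may depend on \<open>m\<close>, as it does
  in \<open>OC_bounded_uniform\<close>; only the one for \<open>m'\<close> enters. A singleton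
  \<open>A\<close> yields continuity for fixed \<open>f\<close>, a bounded \<open>A\<close>
  equicontinuity.\<close>

lemma mult_bounded_estimate:
  fixes A :: "(real^'n::finite \<Rightarrow> complex) set"
  assumes A: "A \<subseteq> OC_space \<omega>" "\<And>m. m \<ge> 1 \<Longrightarrow> \<exists>k R. \<forall>f\<in>A. wbound m (- real k) f R"
    and mn: "m \<ge> 1" "n \<ge> 1"
  shows "\<exists>m'\<ge>1. \<exists>n'\<ge>1. \<exists>C. \<forall>f\<in>A. \<forall>g\<in>S_space \<omega>.
    wnorm m (real n) (mult_op f g) \<le> ennreal C * wnorm m' (real n') g"
proof -
  obtain m' D where m': "m' \<ge> 1" "D > 0"
    "\<And>\<sigma> \<tau> (f :: real^'n \<Rightarrow> complex) g. smooth f \<Longrightarrow> smooth g \<Longrightarrow> wnorm m' \<sigma> f < \<infinity> \<Longrightarrow> wnorm m' \<tau> g < \<infinity> \<Longrightarrow>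
      wnorm m (\<sigma> + \<tau>) (mult_op f g) \<le> ennreal D * wnorm m' \<sigma> f * wnorm m' \<tau> g"
    using wnorm_mult_le[OF mn(1), where 'n = 'n] by metis
  obtain k R where R: "\<And>f. f \<in> A \<Longrightarrow> wbound m' (- real k) f R" using A(2)[OF m'(1)] by blast
  have "wnorm m (real n) (mult_op f g) \<le> ennreal (D * \<bar>R\<bar>) * wnorm m' (real (n + k)) g"
    if f: "f \<in> A" and g: "g \<in> S_space \<omega>" for f g
  proof -
    have "smooth f" using f A(1) OC_step_smooth unfolding OC_space_eq by blast
    then have "wnorm m (- real k + real (n + k)) (mult_op f g) \<le> ennreal D * wnorm m' (- real k) f * wnorm m' (real (n + k)) g"
      using R[OF f] by (intro m'(3) S_space_smooth[OF g] S_space_wnorm_finite[OF g m'(1)]) (auto simp: wnorm_less_top_iff)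
    also have "\<dots> \<le> ennreal D * ennreal \<bar>R\<bar> * wnorm m' (real (n + k)) g"
      using wnorm_leI[OF R[OF f]] by (intro mult_right_mono mult_left_mono) (auto intro: order_trans ennreal_leI)
    also have "ennreal D * ennreal \<bar>R\<bar> = ennreal (D * \<bar>R\<bar>)"
      using m'(2) by (simp add: ennreal_mult)
    finally show ?thesis by simp
  qed
  moreover have "n + k \<ge> 1" using mn by simp
  ultimately show ?thesis using m'(1) by blast
qed

lemma continuous_mult_left:
  fixes f :: "real^'n::finite \<Rightarrow> complex"
  assumes f: "f \<in> OC_space \<omega>"
  shows "continuous_map (S_topology \<omega>) (S_topology \<omega>) (mult_op f)"
  unfolding S_topology_eq
proof (rule continuous_map_seminorm_linear[OF seminormed_S_space seminormed_S_space linear_map_mult_left[OF f]])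
  fix q :: "(real^'n \<Rightarrow> complex) \<Rightarrow> ennreal" assume "q \<in> S_norms"
  then obtain m n where q: "q = wnorm m (real n)" "m \<ge> 1" "n \<ge> 1" by blast
  obtain k where "f \<in> OC_step k" using f unfolding OC_space_eq by blast
  then have "\<exists>k R. \<forall>f\<in>{f}. wbound m (- real k) f R" if "m \<ge> 1" for m
    using OC_step_wnorm_finite[of f k m] that unfolding wnorm_finite_iff by blast
  from mult_bounded_estimate[OF _ this q(2,3)] f
  obtain m' n' C where "m' \<ge> 1" "n' \<ge> 1" "\<forall>g\<in>S_space \<omega>. q (mult_op f g) \<le> ennreal C * wnorm m' (real n') g"
    unfolding q(1) by auto
  then show "\<exists>p\<in>S_norms. \<exists>C. \<forall>g\<in>S_space \<omega>. q (mult_op f g) \<le> ennreal C * p g"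
    by blast
qed

lemma continuous_mult_right:
  fixes g :: "real^'n::finite \<Rightarrow> complex"
  assumes g: "g \<in> S_space \<omega>"
  shows "continuous_map (OC_topology \<omega>) (S_topology \<omega>) (\<lambda>f. mult_op f g)"
  unfolding S_topology_eq
proof (rule seminormed.continuous_map_into_seminorm[OF seminormed_S_space])
  show "(\<lambda>f. mult_op f g) ` topspace (OC_topology \<omega>) \<subseteq> S_space \<omega>"
    using mult_op_in_S_space g by (auto simp: topspace_OC_topology)
  fix f :: "real^'n \<Rightarrow> complex" and p :: "(real^'n \<Rightarrow> complex) \<Rightarrow> ennreal" and \<epsilon> :: real
  assume f: "f \<in> topspace (OC_topology \<omega>)" and p: "p \<in> S_norms" and \<epsilon>: "\<epsilon> > 0"
  obtain m n where mn: "p = wnorm m (real n)" "m \<ge> 1" "n \<ge> 1" using p by blast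
  have "\<exists>Q. \<forall>g\<in>{g}. wnorm m (real n) g \<le> ennreal Q" if "m \<ge> 1" for m n
    using wnorm_finiteD[OF S_space_wnorm_finite[OF g that, of n]] by (metis order_refl singletonD)
  from openin_OC_mult_ball[OF _ this mn(2,3) _ \<epsilon>, of f] f g
  show "\<exists>N. openin (OC_topology \<omega>) N \<and> f \<in> N \<and> (\<forall>h\<in>N. p (\<lambda>z. mult_op h g z - mult_op f g z) < ennreal \<epsilon>)"
    unfolding mn(1) topspace_OC_topology by simp
qed

lemma equicontinuous_mult_left:
  fixes A :: "(real^'n::finite \<Rightarrow> complex) set"
  assumes A: "tvs_bounded (OC_topology \<omega>) A"
  shows "equicontinuous (S_topology \<omega>) (S_topology \<omega>) {mult_op f | f. f \<in> A}"
  unfolding equicontinuous_def topspace_S_topology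
proof (intro conjI ballI allI impI)
  have AO: "A \<subseteq> OC_space \<omega>" using A unfolding tvs_bounded_def topspace_OC_topology by blast
  fix h assume "h \<in> {mult_op f | f. f \<in> A}"
  then show "linear_map (S_space \<omega>) (S_space \<omega>) h" "continuous_map (S_topology \<omega>) (S_topology \<omega>) h"
    using AO linear_map_mult_left continuous_mult_left by auto
next
  have AO: "A \<subseteq> OC_space \<omega>" using A unfolding tvs_bounded_def topspace_OC_topology by blast
  interpret S: seminormed "S_space \<omega> :: (real^'n \<Rightarrow> complex) set" S_norms
    by (rule seminormed_S_space)
  fix U :: "(real^'n \<Rightarrow> complex) set" assume "openin (S_topology \<omega>) U \<and> (\<lambda>x. 0) \<in> U"
  then have U: "openin (seminorm_topology (S_space \<omega>) S_norms) U" "(\<lambda>x. 0) \<in> U"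
    by (auto simp: S_topology_eq)
  show "\<exists>W. openin (S_topology \<omega>) W \<and> (\<lambda>x. 0) \<in> W \<and> (\<forall>h\<in>{mult_op f | f. f \<in> A}. h ` W \<subseteq> U)"
  proof (rule S.equicontinuous_at_zero[OF _ _ _ U])
    show "(\<lambda>x. 0) \<in> topspace (S_topology \<omega> :: (real^'n \<Rightarrow> complex) topology)"
      unfolding topspace_S_topology by (rule complex_subspaceD(1)[OF complex_subspace_S_space])
    show "h f \<in> S_space \<omega>" if "h \<in> {mult_op f | f. f \<in> A}" "f \<in> topspace (S_topology \<omega>)" for h f
      using that AO mult_op_in_S_space by (auto simp: topspace_S_topology)
    fix p :: "(real^'n \<Rightarrow> complex) \<Rightarrow> ennreal" and \<epsilon> :: real assume p: "p \<in> S_norms" and \<epsilon>: "\<epsilon> > 0"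
    obtain m n where mn: "p = wnorm m (real n)" "m \<ge> 1" "n \<ge> 1" using p by blast
    obtain m' n' C where C: "m' \<ge> 1" "n' \<ge> 1"
      "\<And>f g. f \<in> A \<Longrightarrow> g \<in> S_space \<omega> \<Longrightarrow> wnorm m (real n) (mult_op f g) \<le> ennreal C * wnorm m' (real n') g"
      using mult_bounded_estimate[OF AO OC_bounded_uniform[OF A] mn(2,3)] by blast
    let ?W = "{g \<in> S_space \<omega> :: (real^'n \<Rightarrow> complex) set. wnorm m' (real n') g < ennreal (\<epsilon> / (\<bar>C\<bar> + 1))}"
    have d: "\<epsilon> / (\<bar>C\<bar> + 1) > 0" using \<epsilon> by (intro divide_pos_pos) auto
    have mem: "wnorm m' (real n') \<in> S_norms"
      using C(1,2) by blast
    have "wnorm m' (real n') (\<lambda>x::real^'n. 0) = 0"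
      by (rule seminorm_on_zero[OF S.seminorm[OF mem] S.subspace])
    then have "(\<lambda>x. 0) \<in> ?W"
      using d complex_subspaceD(1)[OF S.subspace] by simp
    moreover have "openin (S_topology \<omega>) ?W"
      unfolding S_topology_eq by (rule S.openin_seminorm_ball0[OF mem])
    moreover have "p (mult_op f g) < ennreal \<epsilon>" if f: "f \<in> A" and g: "g \<in> ?W" for f g
    proof -
      have "p (mult_op f g) \<le> ennreal C * wnorm m' (real n') g"
        using C(3)[OF f, of g] g mn(1) by simp
      also have "\<dots> \<le> ennreal \<bar>C\<bar> * ennreal (\<epsilon> / (\<bar>C\<bar> + 1))"
        using g by (intro mult_mono) (auto intro: ennreal_leI less_imp_le)
      also have "\<dots> = ennreal (\<bar>C\<bar> * (\<epsilon> / (\<bar>C\<bar> + 1)))"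
        using d by (intro ennreal_mult[symmetric]) auto
      also have "\<dots> < ennreal \<epsilon>"
      proof (rule ennreal_lessI[OF \<epsilon>])
        have "\<bar>C\<bar> * \<epsilon> < \<epsilon> * (\<bar>C\<bar> + 1)" using \<epsilon> by (simp add: algebra_simps)
        moreover have "\<bar>C\<bar> + 1 > 0" by linarith
        ultimately show "\<bar>C\<bar> * (\<epsilon> / (\<bar>C\<bar> + 1)) < \<epsilon>" by (simp add: pos_divide_less_eq)
      qed
      finally show ?thesis .
    qed
    ultimately show "\<exists>W. openin (S_topology \<omega>) W \<and> (\<lambda>x. 0) \<in> W \<and> (\<forall>h\<in>{mult_op f | f. f \<in> A}. \<forall>g\<in>W. p (h g) < ennreal \<epsilon>)"
      by (intro exI[of _ ?W]) blast
  qed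
qed

lemma equicontinuous_mult_right:
  fixes B :: "(real^'n::finite \<Rightarrow> complex) set"
  assumes B: "tvs_bounded (S_topology \<omega>) B"
  shows "equicontinuous (OC_topology \<omega>) (S_topology \<omega>) {\<lambda>f. mult_op f g | g. g \<in> B}"
  unfolding equicontinuous_def topspace_S_topology topspace_OC_topology
proof (intro conjI ballI allI impI)
  have BS: "B \<subseteq> S_space \<omega>" using B unfolding tvs_bounded_def topspace_S_topology by blast
  fix h assume "h \<in> {\<lambda>f. mult_op f g | g. g \<in> B}"
  then show "linear_map (OC_space \<omega>) (S_space \<omega>) h" "continuous_map (OC_topology \<omega>) (S_topology \<omega>) h"
    using BS linear_map_mult_right continuous_mult_right by auto
next
  have BS: "B \<subseteq> S_space \<omega>" using B unfolding tvs_bounded_def topspace_S_topology by blast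
  interpret S: seminormed "S_space \<omega> :: (real^'n \<Rightarrow> complex) set" S_norms
    by (rule seminormed_S_space)
  have Bb: "\<exists>Q. \<forall>g\<in>B. wnorm m (real n) g \<le> ennreal Q" if mn: "m \<ge> 1" "n \<ge> 1" for m n
  proof -
    have mem: "wnorm m (real n) \<in> S_norms" using mn by blast
    show ?thesis
      using tvs_bounded_seminorm_bound[OF B[unfolded S_topology_eq] S.openin_seminorm_ball0[OF mem]
          complex_subspaceD(1)[OF S.subspace] S.seminorm[OF mem]] .
  qed
  fix U :: "(real^'n \<Rightarrow> complex) set" assume "openin (S_topology \<omega>) U \<and> (\<lambda>x. 0) \<in> U"
  then have U: "openin (seminorm_topology (S_space \<omega>) S_norms) U" "(\<lambda>x. 0) \<in> U"
    by (auto simp: S_topology_eq)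
  have O0: "(\<lambda>x. 0) \<in> (OC_space \<omega> :: (real^'n \<Rightarrow> complex) set)"
    by (rule complex_subspaceD(1)[OF complex_subspace_OC_space])
  show "\<exists>W. openin (OC_topology \<omega>) W \<and> (\<lambda>x. 0) \<in> W \<and> (\<forall>h\<in>{\<lambda>f. mult_op f g | g. g \<in> B}. h ` W \<subseteq> U)"
  proof (rule S.equicontinuous_at_zero[OF _ _ _ U])
    show "(\<lambda>x. 0) \<in> topspace (OC_topology \<omega> :: (real^'n \<Rightarrow> complex) topology)"
      unfolding topspace_OC_topology by (rule O0)
    show "h f \<in> S_space \<omega>" if "h \<in> {\<lambda>f. mult_op f g | g. g \<in> B}" "f \<in> topspace (OC_topology \<omega>)" for h f
      using that BS mult_op_in_S_space by (auto simp: topspace_OC_topology)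
    fix p :: "(real^'n \<Rightarrow> complex) \<Rightarrow> ennreal" and \<epsilon> :: real assume p: "p \<in> S_norms" and \<epsilon>: "\<epsilon> > 0"
    obtain m n where mn: "p = wnorm m (real n)" "m \<ge> 1" "n \<ge> 1" using p by blast
    obtain N where "openin (OC_topology \<omega>) N" "(\<lambda>x. 0) \<in> N"
      "\<forall>h\<in>N. \<forall>g\<in>B. wnorm m (real n) (\<lambda>x. mult_op h g x - mult_op (\<lambda>x. 0) g x) < ennreal \<epsilon>"
      using openin_OC_mult_ball[OF BS Bb mn(2,3) O0 \<epsilon>] by blast
    moreover have "(\<lambda>x. mult_op h g x - mult_op (\<lambda>x. 0) g x) = mult_op h g" for h g :: "real^'n \<Rightarrow> complex"
      by (simp add: mult_op_def)
    ultimately show "\<exists>W. openin (OC_topology \<omega>) W \<and> (\<lambda>x. 0) \<in> W \<and> (\<forall>h\<in>{\<lambda>f. mult_op f g | g. g \<in> B}. \<forall>f\<in>W. p (h f) < ennreal \<epsilon>)"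
      unfolding mn(1) by (intro exI[of _ N]) auto
  qed
qed

end

theorem corollary4p2:
  fixes \<omega> :: "real \<Rightarrow> real"
  assumes "nonquasianalytic_weight \<omega>"
  shows "bilinear_map (OC_space \<omega> :: (real^'n::finite \<Rightarrow> complex) set)
           (S_space \<omega>) (S_space \<omega>) mult_op
         \<and> separately_continuous (OC_topology \<omega> :: (real^'n::finite \<Rightarrow> complex) topology)
           (S_topology \<omega>) (S_topology \<omega>) mult_op
         \<and> hypocontinuous (OC_topology \<omega> :: (real^'n::finite \<Rightarrow> complex) topology)
           (S_topology \<omega>) (S_topology \<omega>) mult_op"
proof -
  interpret weight \<omega> by unfold_locales (fact assms)
  show ?thesis
    unfolding separately_continuous_def hypocontinuous_def topspace_OC_topology topspace_S_topology
    using bilinear_map_mult_op continuous_mult_left continuous_mult_right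
      equicontinuous_mult_left equicontinuous_mult_right by blast
qed

end
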